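(* For a graph $G$, let $\alpha(\mathcal{F}_k)$ denote the scaling constant of the approximation of the traveling salesman cone of $G$ determined by $\mathcal{F}_k$ (see context). Write $a\wedge b=\min(a,b)$. The following inequalities hold. (1) If $G$ is the complete graph on $n$ vertices and $k\in\{1,2,\dots,\lfloor \frac n2\rfloor\}$, then $$\alpha(\mathcal{F}_k)\le 1+\frac{(n-1)}{2}\frac{\sum_{i=k}^{\lfloor \frac n2\rfloor\wedge 2k}\binom{i}{k}\beta_i}{\sum_{i=k}^{\lfloor \frac n2\rfloor\wedge 2k}\binom{i}{k}(\alpha_i-\beta_i)}\le\frac{n}{k}+\frac{10}{n},$$ where $\alpha_i$ and $\beta_i$ are the explicit constants given in the context. (2) If $G$ is the complete bipartite graph on two sets of $n$ vertices and $k\in\{1,2,\dots,n\}$, then $$\alpha(\mathcal{F}_k)\le 1+\frac{n}{2}\frac{\sum_{i=k}^{n\wedge 2k}\binom{i}{k}\eta_i}{\sum_{i=k}^{n\wedge 2k}\binom{i}{k}(\gamma_i-\eta_i)}\le\frac{2n}{k}+\frac{2(k+1)}{k(2n-k-3)},$$ where $\gamma_i$ and $\eta_i$ are the explicit constants given in the context.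
   Context: Traveling salesman cone and scaling constant. Let $G$ be a graph with a hamiltonian cycle, on $N$ vertices. Let $X$ be the finite set of hamiltonian cycles of $G$ with the uniform probability measure $\mu$, let $\phi:X\to\mathrm{Sym}^2(\mathbb{R}^N)$ (symmetric $N\times N$ matrices) send a cycle to its adjacency matrix, let $V$ be the span of $\phi(X)$, and let $g:V\to\mathbb{R}$ be $\frac1{2N}$ times the sum of the entries of a matrix. Let $C\subseteq V$ be the convex cone generated by $\phi(X)$ (the traveling salesman cone of $G$), $\overline{x}=\int_X\phi\,d\mu$, and $C^*=\{\ell\in V^*:\ell(c)\ge0\ \forall c\in C\}$. Let $\mathcal{F}_k$ be the space of functions $u\mapsto P(\phi(u))$ on $X$, with $P$ a homogeneous polynomial of degree $k$ in the matrix entries. Let $C^*(\mathcal{F}_k)$ be the set of $\lambda\in V^*$ such that $\int_X\lambda(\phi(u))p(u)^2d\mu(u)\ge0$ for all $p\in\mathcal{F}_k$. Let $\Lambda^\vee=\{\ell\in V^*:\ell(\overline{x})=1\}$, $B^\vee=C^*\cap\Lambda^\vee$, $B^\vee(\mathcal{F}_k)=C^*(\mathcal{F}_k)\cap\Lambda^\vee$. The scaling constant $\alpha(\mathcal{F}_k)$ is the infimum of the real numbers $\alpha>0$ with $\frac1\alpha(B^\vee(\mathcal{F}_k)-g)\subseteq B^\vee-g$ ($\infty$ if there are none). (Equivalently: with $C(\mathcal{F}_k)=C^*(\mathcal{F}_k)^*\subseteq V$, $\Lambda=g^{-1}(1)$, $B=C\cap\Lambda$, $B(\mathcal{F}_k)=C(\mathcal{F}_k)\cap\Lambda$,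 the inclusion $B-\overline{x}\subseteq\alpha(B(\mathcal{F}_k)-\overline{x})$.) Constants (depending on $n$). For the complete graph on $n$ vertices, if $n=2r$: $$\alpha_k=2^{k-2}\left(4(k+2)r^2-2(k(k+7)+4)r+3k(k+3)\right)\frac{(r-2)!\,(2r-k-2)!}{k!\,(r-k)!},$$ $$\beta_k=2^{k-1}\left(\binom{r-2}{k-2}+4\binom{r-1}{k}\right)(2r-k-2)!.$$ If $n=2r+1$: $$\alpha_k=2^{k-2}\left(4(k+2)r^2-2k(k+4)r+(k-1)k+4r\right)\frac{(r-1)!\,(2r-k-1)!}{k!\,(r-k)!},$$ $$\beta_k=2^{k-2}\left(k^2(2r-1)-8kr^2+6kr+k+4(r-1)r(2r+1)\right)\frac{(r-2)!\,(2r-k-1)!}{k!\,(r-k)!}.$$ For the complete bipartite graph on two sets of $n$ vertices: $$\gamma_k=\binom{n-1}{k-1}(2n-k-1)!\binom{2n-2k}{n-k}^{-1}+\binom{n-1}{k}(2n-k-2)!\binom{2(n-k-1)}{n-k-1}^{-1}+\binom{n-2}{k}(2n-k-2)!\binom{2(n-k-1)}{n-k-1}^{-1}$$ $$\qquad+2^2\binom{n-2}{k-1}(2n-k-2)!\binom{2n-2k}{n-k}^{-1}+\binom{n-2}{k-2}(2n-k-2)!\binom{2n-2k}{n-k}^{-1},$$ $$\eta_k=2\left(\binom{n-2}{k}(2n-k-2)!\binom{2(n-k-1)}{n-k-1}^{-1}+2^2\binom{n-2}{k-1}(2n-k-2)!\binom{2n-2k}{n-k}^{-1}+\binom{n-2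}{k-2}(2n-k-2)!\binom{2n-2k}{n-k}^{-1}\right).$$
   Formalization: In (2) the last inequality is claimed only for 2n-k-3>0; this drops just (n,k)=(2,1), (2,2), (3,3), where the right side divides by 0 or (for n=2) the middle denominator vanishes; at n=2 the first inequality reads the middle as 1. *)

theory Defs
  imports "HOL-Analysis.Analysis"
begin

text \<open>A graph is given by its edge set \<open>E :: 'v set set\<close>; its vertex set is the whole
  finite type \<open>'v\<close>, so that \<open>N = CARD('v)\<close> and \<open>N \<times> N\<close> matrices have
  type \<open>real^'v^'v\<close>.\<close>

definition complete_edges :: "'v set set" where
  "complete_edges = {{u, v} | u v. u \<noteq> v}"

definition complete_bipartite_edges :: "'v set \<Rightarrow> 'v set \<Rightarrow> 'v set set" where
  "complete_bipartite_edges A B = {{a, b} | a b. a \<in> A \<and> b \<in> B}"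

text \<open>A Hamiltonian cycle is identified with its edge set, so that cyclic rotations and
  reversals of the same enumeration of the vertices are not counted separately.\<close>

definition ham_cycles :: "('v::finite) set set \<Rightarrow> 'v set set set" where
  "ham_cycles E = {c. c \<subseteq> E \<and>
     (\<exists>vs. distinct vs \<and> set vs = UNIV \<and> length vs \<ge> 3 \<and>
           c = {{vs ! i, vs ! ((i + 1) mod length vs)} | i. i < length vs})}"

definition adj_matrix :: "('v::finite) set set \<Rightarrow> real^'v^'v" where
  "adj_matrix c = (\<chi> i j. if {i, j} \<in> c then 1 else 0)"

definition ts_span :: "('v::finite) set set \<Rightarrow> (real^'v^'v) set" where
  "ts_span E = span (adj_matrix ` ham_cycles E)"

definition ts_cone :: "('v::finite) set set \<Rightarrow> (real^'v^'v) set" where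
  "ts_cone E = convex_cone hull (adj_matrix ` ham_cycles E)"

definition ts_barycenter :: "('v::finite) set set \<Rightarrow> real^'v^'v" where
  "ts_barycenter E = (\<integral>u. adj_matrix u \<partial>uniform_count_measure (ham_cycles E))"

text \<open>Functionals on the subspace \<open>V\<close> are functions that are \<open>undefined\<close> outside
  \<open>V\<close>, so that equality in the dual space is equality on \<open>V\<close>.\<close>

definition dual_space :: "'a::real_vector set \<Rightarrow> ('a \<Rightarrow> real) set" where
  "dual_space V = {l \<in> extensional V.
     (\<forall>x\<in>V. \<forall>y\<in>V. l (x + y) = l x + l y) \<and> (\<forall>c. \<forall>x\<in>V. l (c *\<^sub>R x) = c * l x)}"

definition ts_g :: "('v::finite) set set \<Rightarrow> real^'v^'v \<Rightarrow> real" where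
  "ts_g E = (\<lambda>A\<in>ts_span E. 1 / (2 * real CARD('v)) * (\<Sum>i\<in>UNIV. \<Sum>j\<in>UNIV. A $ i $ j))"

definition ts_dual_cone :: "('v::finite) set set \<Rightarrow> (real^'v^'v \<Rightarrow> real) set" where
  "ts_dual_cone E = {l \<in> dual_space (ts_span E). \<forall>c\<in>ts_cone E. l c \<ge> 0}"

text \<open>\<open>hom_poly k a\<close> is the homogeneous polynomial of degree \<open>k\<close> in the matrix
  entries whose coefficient at the monomial with exponents \<open>m\<close> is \<open>a m\<close>.\<close>

definition hom_poly ::
  "nat \<Rightarrow> (('v::finite \<times> 'v \<Rightarrow> nat) \<Rightarrow> real) \<Rightarrow> real^'v^'v \<Rightarrow> real" where
  "hom_poly k a A =
     (\<Sum>m\<in>{m. (\<Sum>e\<in>UNIV. m e) = k}. a m * (\<Prod>e\<in>UNIV. (A $ fst e $ snd e) ^ m e))"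

definition ts_F :: "('v::finite) set set \<Rightarrow> nat \<Rightarrow> ('v set set \<Rightarrow> real) set" where
  "ts_F E k = {(\<lambda>u\<in>ham_cycles E. hom_poly k a (adj_matrix u)) | a. True}"

definition ts_dual_cone_approx ::
  "('v::finite) set set \<Rightarrow> ('v set set \<Rightarrow> real) set \<Rightarrow> (real^'v^'v \<Rightarrow> real) set" where
  "ts_dual_cone_approx E F = {l \<in> dual_space (ts_span E).
     \<forall>p\<in>F. (\<integral>u. l (adj_matrix u) * (p u)\<^sup>2 \<partial>uniform_count_measure (ham_cycles E)) \<ge> 0}"

definition ts_Lambda_dual :: "('v::finite) set set \<Rightarrow> (real^'v^'v \<Rightarrow> real) set" where
  "ts_Lambda_dual E = {l \<in> dual_space (ts_span E). l (ts_barycenter E) = 1}"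

definition ts_B_dual :: "('v::finite) set set \<Rightarrow> (real^'v^'v \<Rightarrow> real) set" where
  "ts_B_dual E = ts_dual_cone E \<inter> ts_Lambda_dual E"

definition ts_B_dual_approx ::
  "('v::finite) set set \<Rightarrow> ('v set set \<Rightarrow> real) set \<Rightarrow> (real^'v^'v \<Rightarrow> real) set" where
  "ts_B_dual_approx E F = ts_dual_cone_approx E F \<inter> ts_Lambda_dual E"

text \<open>The infimum is taken in \<open>ereal\<close>, where the infimum of the empty set is \<open>\<infinity>\<close>.\<close>

definition scaling_constant ::
  "('v::finite) set set \<Rightarrow> ('v set set \<Rightarrow> real) set \<Rightarrow> ereal" where
  "scaling_constant E F = Inf (ereal ` {\<alpha>. \<alpha> > 0 \<and>
     (\<lambda>l. \<lambda>x\<in>ts_span E. 1 / \<alpha> * (l x - ts_g E x)) ` ts_B_dual_approx E F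
       \<subseteq> (\<lambda>l. \<lambda>x\<in>ts_span E. l x - ts_g E x) ` ts_B_dual E})"

text \<open>The lower index of a binomial coefficient below can be negative (for \<open>k = 1\<close>), and
  the coefficient is then 0; truncated subtraction would give 1 instead.\<close>

definition binom :: "nat \<Rightarrow> int \<Rightarrow> real" where
  "binom m j = (if j < 0 then 0 else real (m choose nat j))"

text \<open>For \<open>3 \<le> n\<close> and \<open>1 \<le> k \<le> n div 2\<close> the arguments of the factorials in
  \<open>tsp_alpha n k\<close> and \<open>tsp_beta n k\<close> are nonnegative, except for \<open>r - 2\<close> in the odd
  case of \<open>tsp_beta 3 1\<close>; there the polynomial factor is 0, and so is the product.\<close>

definition tsp_alpha :: "nat \<Rightarrow> nat \<Rightarrow> real" where
  "tsp_alpha n k = (let r = n div 2; R = real r; K = real k in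
     if even n then
       2 powi (int k - 2) * (4 * (K + 2) * R^2 - 2 * (K * (K + 7) + 4) * R + 3 * K * (K + 3))
         * (fact (r - 2) * fact (2 * r - k - 2) / (fact k * fact (r - k)))
     else
       2 powi (int k - 2) * (4 * (K + 2) * R^2 - 2 * K * (K + 4) * R + (K - 1) * K + 4 * R)
         * (fact (r - 1) * fact (2 * r - k - 1) / (fact k * fact (r - k))))"

definition tsp_beta :: "nat \<Rightarrow> nat \<Rightarrow> real" where
  "tsp_beta n k = (let r = n div 2; R = real r; K = real k in
     if even n then
       2 powi (int k - 1) * (binom (r - 2) (int k - 2) + 4 * binom (r - 1) (int k))
         * fact (2 * r - k - 2)
     else
       2 powi (int k - 2)
         * (K^2 * (2 * R - 1) - 8 * K * R^2 + 6 * K * R + K + 4 * (R - 1) * R * (2 * R + 1))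
         * (fact (r - 2) * fact (2 * r - k - 1) / (fact k * fact (r - k))))"

text \<open>For \<open>k = n\<close> the expressions \<open>n - k - 1\<close> below are negative, but the summands
  containing them have a vanishing binomial factor.\<close>

definition tsp_gamma :: "nat \<Rightarrow> nat \<Rightarrow> real" where
  "tsp_gamma n k =
     binom (n - 1) (int k - 1) * fact (2 * n - k - 1)
         * inverse (binom (2 * n - 2 * k) (int n - int k))
   + binom (n - 1) (int k) * fact (2 * n - k - 2)
         * inverse (binom (2 * (n - k - 1)) (int n - int k - 1))
   + binom (n - 2) (int k) * fact (2 * n - k - 2)
         * inverse (binom (2 * (n - k - 1)) (int n - int k - 1))
   + 2^2 * binom (n - 2) (int k - 1) * fact (2 * n - k - 2)
         * inverse (binom (2 * n - 2 * k) (int n - int k))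
   + binom (n - 2) (int k - 2) * fact (2 * n - k - 2)
         * inverse (binom (2 * n - 2 * k) (int n - int k))"

definition tsp_eta :: "nat \<Rightarrow> nat \<Rightarrow> real" where
  "tsp_eta n k = 2 *
    (binom (n - 2) (int k) * fact (2 * n - k - 2)
         * inverse (binom (2 * (n - k - 1)) (int n - int k - 1))
   + 2^2 * binom (n - 2) (int k - 1) * fact (2 * n - k - 2)
         * inverse (binom (2 * n - 2 * k) (int n - int k))
   + binom (n - 2) (int k - 2) * fact (2 * n - k - 2)
         * inverse (binom (2 * n - 2 * k) (int n - int k)))"

definition complete_bound :: "nat \<Rightarrow> nat \<Rightarrow> real" where
  "complete_bound n k = 1 + (real n - 1) / 2 *
     ((\<Sum>i = k..min (n div 2) (2 * k). real (i choose k) * tsp_beta n i) /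
      (\<Sum>i = k..min (n div 2) (2 * k). real (i choose k) * (tsp_alpha n i - tsp_beta n i)))"

text \<open>For \<open>n = 2\<close> the denominator is 0 and the value here is 1 by the convention
  \<open>x / 0 = 0\<close>.\<close>

definition bipartite_bound :: "nat \<Rightarrow> nat \<Rightarrow> real" where
  "bipartite_bound n k = 1 + real n / 2 *
     ((\<Sum>i = k..min n (2 * k). real (i choose k) * tsp_eta n i) /
      (\<Sum>i = k..min n (2 * k). real (i choose k) * (tsp_gamma n i - tsp_eta n i)))"

end

theory Submission
  imports Defs
begin

(*#PART A*)
lemma reweighting_by_binomials:
  fixes d q :: "nat \<Rightarrow> real"
  assumes cross: "\<And>x y. x < y \<Longrightarrow> x + y < k \<Longrightarrow>
      d (k - x) * d (k - y) * (q (k - x) - q (k - y)) \<le> d x * d y * (q y - q x)"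
  shows "(\<Sum>x\<le>k. d x * real (k choose x)) * (\<Sum>x\<le>k. d x * q x)
      \<le> (\<Sum>x\<le>k. d x) * (\<Sum>x\<le>k. d x * real (k choose x) * q x)"
proof -
  define B where "B x = real (k choose x)" for x
  define F where "F x y = d x * d y * (B x - B y) * (q x - q y)" for x y
  have sym: "F x y = F y x" for x y
    by (simp add: F_def algebra_simps)
  have refl_sum: "(\<Sum>x\<le>k. g (k - x)) = (\<Sum>x\<le>k. g x)" for g :: "nat \<Rightarrow> real"
    by (rule sum.reindex_bij_witness[where i = "\<lambda>x. k - x" and j = "\<lambda>x. k - x"]) auto
  have Brefl: "B (k - x) = B x" if "x \<le> k" for x
    using that binomial_symmetric[of x k] by (simp add: B_def)
  have Bmono: "B x \<le> B y" if "x < y" "x + y < k" for x y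
  proof (cases "2 * y \<le> k")
    case True
    then show ?thesis using binomial_mono[of x y k] that by (simp add: B_def)
  next
    case False
    have "k choose x \<le> k choose (k - y)"
      by (rule binomial_mono) (use that False in auto)
    then show ?thesis using Brefl[of y] that by (simp add: B_def)
  qed
  have ordered: "0 \<le> F x y + F (k - x) (k - y)" if "x < y" "x + y < k" for x y
  proof -
    have "F x y + F (k - x) (k - y) =
        (B y - B x) * (d x * d y * (q y - q x) - d (k - x) * d (k - y) * (q (k - x) - q (k - y)))"
      using that by (simp add: F_def Brefl algebra_simps)
    also have "\<dots> \<ge> 0"
      using Bmono[OF that] cross[OF that] by (intro mult_nonneg_nonneg) auto
    finally show ?thesis .
  qed
  have lt: "0 \<le> F x y + F (k - x) (k - y)" if "x < y" "y \<le> k" for x y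
  proof -
    consider "x + y < k" | "x + y = k" | "x + y > k" by linarith
    then show ?thesis
    proof cases
      case 1
      then show ?thesis using ordered that by simp
    next
      case 2
      then have "y = k - x" using that by simp
      then show ?thesis using that by (simp add: F_def Brefl)
    next
      case 3
      have "0 \<le> F (k - y) (k - x) + F (k - (k - y)) (k - (k - x))"
        by (rule ordered) (use 3 that in auto)
      then show ?thesis using that sym[of x y] sym[of "k - x" "k - y"] by simp
    qed
  qed
  have nonneg: "0 \<le> F x y + F (k - x) (k - y)" if "x \<le> k" "y \<le> k" for x y
  proof (cases x y rule: linorder_cases)
    case less
    then show ?thesis using lt that by simp
  next
    case equal
    then show ?thesis by (simp add: F_def)
  next
    case greater
    then show ?thesis using lt[of y x] that sym[of x y] sym[of "k - x" "k - y"] by metis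
  qed
  have "(\<Sum>x\<le>k. \<Sum>y\<le>k. F (k - x) (k - y)) = (\<Sum>x\<le>k. \<Sum>y\<le>k. F (k - x) y)"
    by (intro sum.cong refl refl_sum)
  also have "\<dots> = (\<Sum>x\<le>k. \<Sum>y\<le>k. F x y)"
    by (rule refl_sum)
  finally have "2 * (\<Sum>x\<le>k. \<Sum>y\<le>k. F x y) = (\<Sum>x\<le>k. \<Sum>y\<le>k. F x y + F (k - x) (k - y))"
    by (simp add: sum.distrib)
  also have "\<dots> \<ge> 0"
    by (intro sum_nonneg nonneg) auto
  finally have "0 \<le> (\<Sum>x\<le>k. \<Sum>y\<le>k. F x y)" by simp
  also have "(\<Sum>x\<le>k. \<Sum>y\<le>k. F x y) =
      (\<Sum>x\<le>k. \<Sum>y\<le>k. (d x * B x * q x) * d y + d x * (d y * B y * q y)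
          - (d x * B x) * (d y * q y) - (d x * q x) * (d y * B y))"
    by (simp add: F_def algebra_simps)
  also have "\<dots> = 2 * ((\<Sum>x\<le>k. d x) * (\<Sum>x\<le>k. d x * B x * q x)
      - (\<Sum>x\<le>k. d x * B x) * (\<Sum>x\<le>k. d x * q x))"
    by (simp add: sum_subtractf sum.distrib flip: sum_product)
  finally show ?thesis by (simp add: B_def)
qed

lemma power4_le_prod:
  assumes "x < y" "x + y + m \<ge> 4" "0 < m"
  shows "(4::nat) ^ m \<le> (\<Prod>a = 1..m. (y + a) * (x + a))"
proof -
  have big: "4 \<le> (y + a) * (x + a)" if "a \<ge> 2 \<or> y \<ge> 3 \<or> x \<ge> 1" "a \<ge> 1" for a
  proof -
    from that assms consider "y + a \<ge> 3" "x + a \<ge> 2" | "y + a \<ge> 4" "x + a \<ge> 1"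
      by linarith
    then show ?thesis
    proof cases
      case 1
      then show ?thesis using mult_le_mono[OF 1] by simp
    next
      case 2
      then show ?thesis using mult_le_mono[OF 2] by simp
    qed
  qed
  have general: "4 ^ (m - j) * (\<Prod>a = 1..j. (y + a) * (x + a)) \<le> (\<Prod>a = 1..m. (y + a) * (x + a))"
    if "j \<le> m" "j \<ge> 1 \<or> y \<ge> 3 \<or> x \<ge> 1" for j
  proof -
    have "{1..m} = {1..j} \<union> {j+1..m}" using that by auto
    then have "(\<Prod>a = 1..m. (y + a) * (x + a)) =
        (\<Prod>a = 1..j. (y + a) * (x + a)) * (\<Prod>a = j+1..m. (y + a) * (x + a))"
      by (simp add: prod.union_disjoint)
    moreover have "(\<Prod>a = j+1..m. 4) \<le> (\<Prod>a = j+1..m. (y + a) * (x + a))"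
      by (intro prod_mono conjI big) (use that in auto)
    ultimately show ?thesis by (simp add: mult.commute)
  qed
  consider "y \<ge> 3 \<or> x \<ge> 1" | "x = 0" "y = 2" | "x = 0" "y = 1" using assms by linarith
  then show ?thesis
  proof cases
    case 1
    then show ?thesis using general[of 0] by simp
  next
    case 2
    then have m: "m \<ge> 2" using assms by simp
    have "(4::nat) ^ m = 4 ^ (m - 2) * 4 ^ 2"
      by (metis m le_add_diff_inverse2 power_add)
    also have "\<dots> \<le> 4 ^ (m - 2) * (\<Prod>a = 1..2. (y + a) * (x + a))"
      using 2 by (intro mult_le_mono) (auto simp: numeral_eq_Suc)
    also have "\<dots> \<le> (\<Prod>a = 1..m. (y + a) * (x + a))" using m by (intro general) auto
    finally show ?thesis .
  next
    case 3
    then have m: "m \<ge> 3" using assms by simp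
    have "(4::nat) ^ m = 4 ^ (m - 3) * 4 ^ 3"
      by (metis m le_add_diff_inverse2 power_add)
    also have "\<dots> \<le> 4 ^ (m - 3) * (\<Prod>a = 1..3. (y + a) * (x + a))"
      using 3 by (intro mult_le_mono) (auto simp: numeral_eq_Suc)
    also have "\<dots> \<le> (\<Prod>a = 1..m. (y + a) * (x + a))" using m by (intro general) auto
    finally show ?thesis .
  qed
qed

lemma iterated_ratio_bound:
  fixes d :: "nat \<Rightarrow> real"
  assumes "\<And>x. real (Suc x) * d (Suc x) \<le> c * d x" "0 \<le> c"
  shows "(\<Prod>a = 1..m. real (y + a)) * d (y + m) \<le> c ^ m * d y"
proof (induction m)
  case (Suc m)
  have "(\<Prod>a = 1..Suc m. real (y + a)) * d (y + Suc m) =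
      (\<Prod>a = 1..m. real (y + a)) * (real (Suc (y + m)) * d (Suc (y + m)))"
    by (simp add: ac_simps)
  also have "\<dots> \<le> (\<Prod>a = 1..m. real (y + a)) * (c * d (y + m))"
    by (intro mult_left_mono assms prod_nonneg) auto
  also have "\<dots> = c * ((\<Prod>a = 1..m. real (y + a)) * d (y + m))" by simp
  also have "\<dots> \<le> c * (c ^ m * d y)"
    using Suc assms(2) by (intro mult_left_mono)
  finally show ?case by simp
qed simp

lemma binomial_square_expansion:
  "(j choose k)\<^sup>2 = (\<Sum>x\<le>k. ((k + x) choose k) * (k choose x) * (j choose (k + x)))"
proof (cases "k \<le> j")
  case True
  have "(j choose k) = (\<Sum>x\<le>k. ((j - k) choose x) * (k choose (k - x)))"
    using vandermonde[of "j - k" k k] True by simp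
  also have "\<dots> = (\<Sum>x\<le>k. ((j - k) choose x) * (k choose x))"
    by (intro sum.cong refl arg_cong2[where f = "(*)"]) (auto simp: binomial_symmetric[symmetric])
  finally have "(j choose k)\<^sup>2 = (\<Sum>x\<le>k. (k choose x) * ((j choose k) * ((j - k) choose x)))"
    by (simp add: power2_eq_square sum_distrib_left ac_simps)
  also have "\<dots> = (\<Sum>x\<le>k. ((k + x) choose k) * (k choose x) * (j choose (k + x)))"
  proof (intro sum.cong refl)
    fix x
    have "(j choose k) * ((j - k) choose x) = (j choose (k + x)) * ((k + x) choose k)"
    proof (cases "k + x \<le> j")
      case True
      then show ?thesis using choose_mult[of k "k + x" j] by simp
    next
      case False
      then have "j < k + x" "j - k < x" using True by auto
      then show ?thesis by (simp add: binomial_eq_0)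
    qed
    then show "(k choose x) * ((j choose k) * ((j - k) choose x)) =
        ((k + x) choose k) * (k choose x) * (j choose (k + x))" by simp
  qed
  finally show ?thesis .
qed (simp add: binomial_eq_0)

(*#PART A2*)
definition complete_moment :: "nat \<Rightarrow> nat \<Rightarrow> real" where
  "complete_moment n i = real (n div 2 choose i) * 2 ^ i * fact (n - i - 1)"

definition size_biased :: "(nat \<Rightarrow> real) \<Rightarrow> nat \<Rightarrow> real" where
  "size_biased m i = real i * m i + real (Suc i) * m (Suc i)"

definition complete_mean :: "nat \<Rightarrow> nat \<Rightarrow> real" where
  "complete_mean n i = real i + 2 - (if even n then real n - 2 else real n - 1) / (real n - 1 - real i)"

lemma Suc_times_binomial_Suc:
  "real (Suc i) * real (r choose Suc i) = (real r - real i) * real (r choose i)"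
proof (cases "i \<le> r")
  case True
  have "Suc i * (r choose Suc i) = (r - i) * (r choose i)"
    by (simp only: binomial_absorption binomial_absorb_comp)
  then show ?thesis using True by (metis of_nat_diff of_nat_mult)
qed (simp add: binomial_eq_0)

lemma fact_pred: "0 < n \<Longrightarrow> fact n = real n * fact (n - 1)"
  by (rule fact_reduce)

lemma complete_moment_Suc:
  assumes "Suc i < n"
  shows "real (Suc i) * complete_moment n (Suc i)
    = complete_moment n i * (2 * (real (n div 2) - real i) / (real n - 1 - real i))"
proof -
  have f: "fact (n - i - 1) = (real n - 1 - real i) * fact (n - Suc i - 1)"
    using assms fact_pred[of "n - i - 1"] by (simp add: of_nat_diff)
  have pos: "real n - 1 - real i > 0" using assms by simp
  have "real (Suc i) * complete_moment n (Suc i)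
      = (real (Suc i) * real (n div 2 choose Suc i)) * (2 * 2 ^ i * fact (n - Suc i - 1))"
    by (simp add: complete_moment_def)
  also have "\<dots> = complete_moment n i * (2 * (real (n div 2) - real i) / (real n - 1 - real i))"
    using pos unfolding Suc_times_binomial_Suc complete_moment_def f by (simp add: field_simps)
  finally show ?thesis .
qed

lemma size_biased_complete_moment:
  assumes "4 \<le> n" "i \<le> n div 2"
  shows "size_biased (complete_moment n) i = complete_moment n i * complete_mean n i"
proof -
  have *: "2 * (real (n div 2) - real i) / (real n - 1 - real i) = complete_mean n i - real i"
  proof -
    have "real n - 1 - real i > 0" using assms by linarith
    moreover have "n = (if even n then 2 * (n div 2) else 2 * (n div 2) + 1)" by simp
    then have "real n = (if even n then 2 * real (n div 2) else 2 * real (n div 2) + 1)"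
      by (metis of_nat_add of_nat_mult of_nat_numeral of_nat_1)
    ultimately show ?thesis by (auto simp: complete_mean_def field_simps)
  qed
  have "Suc i < n" using assms by linarith
  from complete_moment_Suc[OF this] show ?thesis
    unfolding size_biased_def * by (simp add: algebra_simps)
qed

lemma binom_shift2:
  assumes "2 \<le> r"
  shows "binom (r - 2) (int i - 2) = real i * (real i - 1) / (real r * (real r - 1)) * real (r choose i)"
proof -
  consider "i = 0" | "i = 1" | j where "i = Suc (Suc j)"
  proof -
    have "i = 0 \<or> i = 1 \<or> i = Suc (Suc (i - 2))" by arith
    then show thesis using that by blast
  qed
  then show ?thesis
  proof cases
    case (3 j)
    define s where "s = r - 2"
    have r: "r = Suc (Suc s)" using assms by (simp add: s_def)
    have e1: "real i * real (r choose i) = real r * real (Suc s choose Suc j)"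
      using arg_cong[OF Suc_times_binomial[of "Suc j" "Suc s"], of real] unfolding 3 r of_nat_mult .
    have e2: "(real i - 1) * real (Suc s choose Suc j) = (real r - 1) * real (s choose j)"
    proof -
      have "real i - 1 = real (Suc j)" "real r - 1 = real (Suc s)" unfolding 3 r by simp_all
      then show ?thesis
        using arg_cong[OF Suc_times_binomial[of j s], of real] unfolding of_nat_mult by (simp only:)
    qed
    have "real i * (real i - 1) * real (r choose i) = (real i - 1) * (real i * real (r choose i))"
      by (simp only: ac_simps)
    also have "\<dots> = real r * ((real i - 1) * real (Suc s choose Suc j))"
      unfolding e1 by (simp only: ac_simps)
    also have "\<dots> = real r * (real r - 1) * real (s choose j)"
      unfolding e2 by (simp only: ac_simps)
    finally have "real i * (real i - 1) * real (r choose i) = real r * (real r - 1) * real (s choose j)" .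
    moreover have "nat (int i - 2) = j" "int i - 2 \<ge> 0" "r - 2 = s" using 3 r by auto
    moreover have "real r * (real r - 1) \<noteq> 0" using assms by auto
    ultimately show ?thesis unfolding binom_def times_divide_eq_left by (simp only: eq_divide_eq) simp
  qed (auto simp: binom_def)
qed

lemma binom_shift1:
  assumes "1 \<le> r"
  shows "binom (r - 1) (int i) = (real r - real i) / real r * real (r choose i)"
proof (cases "i \<le> r")
  case True
  have "(r - i) * (r choose i) = r * (r - 1 choose i)"
    using binomial_absorb_comp[of r i] .
  then have e: "(real r - real i) * real (r choose i) = real r * real (r - 1 choose i)"
    using True by (metis of_nat_diff of_nat_mult)
  show ?thesis using assms unfolding times_divide_eq_left e by (simp add: binom_def)
qed (use assms in \<open>auto simp: binom_def binomial_eq_0\<close>)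

lemma two_powi: "(2::real) powi (int k - 1) = 2 ^ k / 2" "(2::real) powi (int k - 2) = 2 ^ k / 4"
  by (simp_all add: power_int_diff)

lemma fact_ratio2:
  assumes "2 \<le> r" "i \<le> r"
  shows "fact (r - 2) / (fact i * fact (r - i)) = real (r choose i) / (real r * (real r - 1))"
proof -
  define s where "s = r - 2"
  have "r = Suc (Suc s)" using assms(1) by (simp add: s_def)
  then have f: "fact r = real r * (real r - 1) * fact (r - 2)" by simp
  have "real r > 0" "real r - 1 > 0" using assms by auto
  then show ?thesis unfolding binomial_fact[OF assms(2)] f by simp
qed

lemma tsp_even_identities:
  fixes R K X :: real
  assumes pos: "2 * R - 1 - K > 0" "R > 0" "R - 1 > 0"
  defines "q \<equiv> K + 2 - (2 * R - 2) / (2 * R - 1 - K)"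
  shows "X / 2 * (K * (K - 1) / (R * (R - 1)) + 4 * ((R - K) / R))
      = X * (2 * R - 1 - K) * (2 * (2 * R) - 2 * q) / (4 * R * (R - 1))" (is ?b)
    and "X / 4 * (4 * (K + 2) * R\<^sup>2 - 2 * (K * (K + 7) + 4) * R + 3 * K * (K + 3)) / (R * (R - 1))
        - X * (2 * R - 1 - K) * (2 * (2 * R) - 2 * q) / (4 * R * (R - 1))
      = X * (2 * R - 1 - K) * ((2 * R - 1) * q - 2 * R) / (4 * R * (R - 1))" (is ?a)
proof -
  have e: "(2 * R - 1 - K) * q = (2 * R - 1 - K) * (K + 2) - (2 * R - 2)"
    unfolding q_def using pos by (simp add: field_simps)
  have b: "X * (2 * R - 1 - K) * (2 * (2 * R) - 2 * q) = X * (4 * R * (2 * R - 1 - K) - 2 * ((2 * R - 1 - K) * q))"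
    by (simp add: algebra_simps)
  have a: "X * (2 * R - 1 - K) * ((2 * R - 1) * q - 2 * R) = X * ((2 * R - 1) * ((2 * R - 1 - K) * q) - 2 * R * (2 * R - 1 - K))"
    by (simp add: algebra_simps)
  have "X / 2 * (K * (K - 1) / (R * (R - 1)) + 4 * ((R - K) / R))
      = X * 2 * (K * (K - 1) + 4 * ((R - K) * (R - 1))) / (4 * R * (R - 1))"
    using pos by (simp add: field_simps)
  then show ?b unfolding b e by (simp add: algebra_simps)
  have "X / 4 * (4 * (K + 2) * R\<^sup>2 - 2 * (K * (K + 7) + 4) * R + 3 * K * (K + 3)) / (R * (R - 1))
      = X * (4 * (K + 2) * R\<^sup>2 - 2 * (K * (K + 7) + 4) * R + 3 * K * (K + 3)) / (4 * R * (R - 1))"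
    by (simp add: field_simps)
  then show ?a unfolding a b e
    by (simp only: flip: diff_divide_distrib) (simp add: algebra_simps power2_eq_square)
qed

lemma tsp_odd_identities:
  fixes R K X :: real
  assumes pos: "2 * R - K > 0" "R > 0" "R - 1 > 0"
  defines "q \<equiv> K + 2 - (2 * R) / (2 * R - K)"
  shows "X / 4 * (K\<^sup>2 * (2 * R - 1) - 8 * K * R\<^sup>2 + 6 * K * R + K + 4 * (R - 1) * R * (2 * R + 1)) / (R * (R - 1))
      = X * (2 * R - K) * (2 * (2 * R - 2) + (2 * R - 1)\<^sup>2 - (2 * R - 1) * q) / (4 * R * (R - 1))" (is ?b)
    and "X / 4 * (4 * (K + 2) * R\<^sup>2 - 2 * K * (K + 4) * R + (K - 1) * K + 4 * R) / R
        - X * (2 * R - K) * (2 * (2 * R - 2) + (2 * R - 1)\<^sup>2 - (2 * R - 1) * q) / (4 * R * (R - 1))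
      = X * (2 * R - K) * (R * ((2 * R - 1) * (q - 1))) / (4 * R * (R - 1))" (is ?a)
proof -
  have e: "(2 * R - K) * q = (2 * R - K) * (K + 2) - 2 * R"
    unfolding q_def using pos by (simp add: field_simps)
  have b: "X * (2 * R - K) * (2 * (2 * R - 2) + (2 * R - 1)\<^sup>2 - (2 * R - 1) * q)
      = X * ((2 * R - K) * (2 * (2 * R - 2) + (2 * R - 1)\<^sup>2) - (2 * R - 1) * ((2 * R - K) * q))"
    by (simp add: algebra_simps)
  have a: "X * (2 * R - K) * (R * ((2 * R - 1) * (q - 1))) = X * R * (2 * R - 1) * ((2 * R - K) * q - (2 * R - K))"
    by (simp add: algebra_simps)
  have "X / 4 * (K\<^sup>2 * (2 * R - 1) - 8 * K * R\<^sup>2 + 6 * K * R + K + 4 * (R - 1) * R * (2 * R + 1)) / (R * (R - 1))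
      = X * (K\<^sup>2 * (2 * R - 1) - 8 * K * R\<^sup>2 + 6 * K * R + K + 4 * (R - 1) * R * (2 * R + 1)) / (4 * R * (R - 1))"
    by (simp add: field_simps)
  then show ?b unfolding b e by (simp add: algebra_simps power2_eq_square)
  have "X / 4 * (4 * (K + 2) * R\<^sup>2 - 2 * K * (K + 4) * R + (K - 1) * K + 4 * R) / R
      = X * (4 * (K + 2) * R\<^sup>2 - 2 * K * (K + 4) * R + (K - 1) * K + 4 * R) * (R - 1) / (4 * R * (R - 1))"
    using pos by simp
  then show ?a unfolding a b e
    by (simp only: flip: diff_divide_distrib) (simp add: algebra_simps power2_eq_square)
qed

lemma tsp_even:
  assumes "2 \<le> r" "1 \<le> i" "i \<le> r" and n: "n = 2 * r"
  shows "tsp_beta n i = complete_moment n i * (2 * real n - 2 * complete_mean n i) / (4 * real r * (real r - 1))"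
    and "tsp_alpha n i - tsp_beta n i =
      complete_moment n i * ((real n - 1) * complete_mean n i - real n) / (4 * real r * (real r - 1))"
proof -
  define X where "X = real (r choose i) * 2 ^ i * fact (2 * r - i - 2)"
  have pos: "2 * real r - 1 - real i > 0" "real r > 0" "real r - 1 > 0" using assms by auto
  have f: "fact (2 * r - i - 1) = (2 * real r - 1 - real i) * fact (2 * r - i - 2)"
    using assms(1-3) fact_pred[of "2 * r - i - 1"] by (simp add: of_nat_diff)
  have m: "complete_moment n i = X * (2 * real r - 1 - real i)"
    unfolding complete_moment_def X_def n using f by simp
  have q: "complete_mean n i = real i + 2 - (2 * real r - 2) / (2 * real r - 1 - real i)"
    by (simp add: complete_mean_def n)
  have b: "tsp_beta n i = X / 2 * (real i * (real i - 1) / (real r * (real r - 1)) + 4 * ((real r - real i) / real r))"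
  proof -
    have "tsp_beta n i = 2 ^ i / 2 * (binom (r - 2) (int i - 2) + 4 * binom (r - 1) (int i)) * fact (2 * r - i - 2)"
      by (simp add: tsp_beta_def two_powi n Let_def)
    also have "\<dots> = X / 2 * (real i * (real i - 1) / (real r * (real r - 1)) + 4 * ((real r - real i) / real r))"
    proof -
      have "2 ^ i / 2 * (a * real (r choose i) + 4 * (b * real (r choose i))) * fact (2 * r - i - 2) = X / 2 * (a + 4 * b)"
        for a b by (simp add: X_def algebra_simps)
      moreover have "1 \<le> r" using assms(1) by simp
      ultimately show ?thesis using binom_shift1 binom_shift2 assms(1) by metis
    qed
    finally show ?thesis .
  qed
  have a: "tsp_alpha n i = X / 4 * (4 * (real i + 2) * (real r)\<^sup>2 - 2 * (real i * (real i + 7) + 4) * real r + 3 * real i * (real i + 3))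
      / (real r * (real r - 1))"
  proof -
    have "tsp_alpha n i = 2 ^ i / 4 * (4 * (real i + 2) * (real r)\<^sup>2 - 2 * (real i * (real i + 7) + 4) * real r + 3 * real i * (real i + 3))
      * fact (2 * r - i - 2) * (fact (r - 2) / (fact i * fact (r - i)))"
      by (simp add: tsp_alpha_def two_powi n Let_def)
    then show ?thesis unfolding fact_ratio2[OF assms(1,3)] X_def by simp
  qed
  show "tsp_beta n i = complete_moment n i * (2 * real n - 2 * complete_mean n i) / (4 * real r * (real r - 1))"
    unfolding m q b using tsp_even_identities(1)[OF pos, of X] by (simp add: n)
  show "tsp_alpha n i - tsp_beta n i =
      complete_moment n i * ((real n - 1) * complete_mean n i - real n) / (4 * real r * (real r - 1))"
    unfolding m q b a using tsp_even_identities[OF pos, of X] by (simp add: n)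
qed

lemma tsp_odd:
  assumes "2 \<le> r" "1 \<le> i" "i \<le> r" and n: "n = 2 * r + 1"
  shows "tsp_beta n i = complete_moment n i *
        (2 * (real n - 3) + (real n - 2)\<^sup>2 - (real n - 2) * complete_mean n i) / (4 * real r * (real r - 1))"
    and "tsp_alpha n i - tsp_beta n i =
      complete_moment n i * (real r * ((real n - 2) * (complete_mean n i - 1))) / (4 * real r * (real r - 1))"
proof -
  define X where "X = real (r choose i) * 2 ^ i * fact (2 * r - i - 1)"
  have pos: "2 * real r - real i > 0" "real r > 0" "real r - 1 > 0" using assms by auto
  have f: "fact (2 * r - i) = (2 * real r - real i) * fact (2 * r - i - 1)"
    using assms(1-3) fact_pred[of "2 * r - i"] by (simp add: of_nat_diff)
  have m: "complete_moment n i = X * (2 * real r - real i)"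
    unfolding complete_moment_def X_def n using f by simp
  have q: "complete_mean n i = real i + 2 - (2 * real r) / (2 * real r - real i)"
    by (simp add: complete_mean_def n)
  have b: "tsp_beta n i = X / 4 * ((real i)\<^sup>2 * (2 * real r - 1) - 8 * real i * (real r)\<^sup>2 + 6 * real i * real r + real i
      + 4 * (real r - 1) * real r * (2 * real r + 1)) / (real r * (real r - 1))"
  proof -
    have "tsp_beta n i = 2 ^ i / 4 * ((real i)\<^sup>2 * (2 * real r - 1) - 8 * real i * (real r)\<^sup>2 + 6 * real i * real r + real i
      + 4 * (real r - 1) * real r * (2 * real r + 1)) * fact (2 * r - i - 1) * (fact (r - 2) / (fact i * fact (r - i)))"
      by (simp add: tsp_beta_def two_powi n Let_def)
    then show ?thesis unfolding fact_ratio2[OF assms(1,3)] X_def by simp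
  qed
  have a: "tsp_alpha n i = X / 4 * (4 * (real i + 2) * (real r)\<^sup>2 - 2 * real i * (real i + 4) * real r
      + (real i - 1) * real i + 4 * real r) / real r"
  proof -
    have "fact (r - 1) = (real r - 1) * fact (r - 2)"
      using assms(1) fact_pred[of "r - 1"] by (simp add: of_nat_diff numeral_2_eq_2)
    then have "tsp_alpha n i = 2 ^ i / 4 * (4 * (real i + 2) * (real r)\<^sup>2 - 2 * real i * (real i + 4) * real r
      + (real i - 1) * real i + 4 * real r)
      * fact (2 * r - i - 1) * (real r - 1) * (fact (r - 2) / (fact i * fact (r - i)))"
      by (simp add: tsp_alpha_def two_powi n Let_def)
    then show ?thesis unfolding fact_ratio2[OF assms(1,3)] X_def using pos by simp
  qed
  show "tsp_beta n i = complete_moment n i *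
        (2 * (real n - 3) + (real n - 2)\<^sup>2 - (real n - 2) * complete_mean n i) / (4 * real r * (real r - 1))"
    unfolding m q b using tsp_odd_identities(1)[OF pos, of X] by (simp add: n)
  show "tsp_alpha n i - tsp_beta n i =
      complete_moment n i * (real r * ((real n - 2) * (complete_mean n i - 1))) / (4 * real r * (real r - 1))"
    unfolding m q b a using tsp_odd_identities[OF pos, of X] by (simp add: n)
qed

(*#PART A3*)
lemma hyperbolic_gap:
  fixes i j C D a :: real
  assumes "i < D" "j < D"
  shows "(j + a - C / (D - j)) - (i + a - C / (D - i)) = (j - i) * (1 - C / ((D - i) * (D - j)))"
proof -
  have "C / (D - j) - C / (D - i) = (j - i) * (C / ((D - i) * (D - j)))"
    using assms by (simp add: field_simps)
  then show ?thesis by (simp add: algebra_simps)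
qed

lemma hyperbolic_gap_antimono:
  fixes i j i' j' C D a :: real
  assumes "i \<le> j" "i \<le> i'" "j \<le> j'" "i' < D" "j' < D" "j' - i' = j - i" "0 \<le> C"
  shows "(j' + a - C / (D - j')) - (i' + a - C / (D - i')) \<le> (j + a - C / (D - j)) - (i + a - C / (D - i))"
proof -
  have "C / ((D - i) * (D - j)) \<le> C / ((D - i') * (D - j'))"
    using assms by (intro divide_left_mono mult_mono mult_pos_pos) auto
  then have "(j - i) * (1 - C / ((D - i') * (D - j'))) \<le> (j - i) * (1 - C / ((D - i) * (D - j)))"
    using assms by (intro mult_left_mono) auto
  then show ?thesis
    using assms hyperbolic_gap[of i' D j' a C] hyperbolic_gap[of i D j a C] by simp
qed

lemma sum_shift_to_zero:
  fixes f :: "nat \<Rightarrow> 'a::comm_monoid_add"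
  shows "(\<Sum>i = k..2 * k. f i) = (\<Sum>x\<le>k. f (k + x))"
  by (rule sum.reindex_bij_witness[where i = "\<lambda>x. k + x" and j = "\<lambda>i. i - k"]) auto

lemma shifted_weight_ratio:
  fixes m :: "nat \<Rightarrow> real"
  shows "real (Suc x) * (real (k + Suc x choose k) * m (k + Suc x))
      = real (k + x choose k) * (real (Suc (k + x)) * m (Suc (k + x)))"
proof -
  have "Suc x * (k + Suc x choose k) = Suc (k + x) * (k + x choose k)"
    using binomial_absorb_comp[of "Suc (k + x)" k] by (simp only: add_Suc_right diff_Suc_1) (simp add: Suc_diff_le)
  then have "real (Suc x) * real (k + Suc x choose k) = real (Suc (k + x)) * real (k + x choose k)"
    by (metis of_nat_mult)
  then show ?thesis by (simp only: add_Suc_right mult.assoc[symmetric]) (simp only: ac_simps)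
qed

lemma half_bounds: "2 * (n div 2) \<le> n" "n \<le> 2 * (n div 2) + 1" for n :: nat
  by auto

lemma real_half: "real n = (if even n then 2 * real (n div 2) else 2 * real (n div 2) + 1)"
proof -
  have "n = (if even n then 2 * (n div 2) else 2 * (n div 2) + 1)" by simp
  then show ?thesis by (metis of_nat_add of_nat_mult of_nat_numeral of_nat_1)
qed

lemma complete_moment_nonneg: "0 \<le> complete_moment n i"
  by (simp add: complete_moment_def)

lemma complete_moment_eq_0: "n div 2 < i \<Longrightarrow> complete_moment n i = 0"
  by (simp add: complete_moment_def binomial_eq_0)

lemma complete_moment_pos: "i \<le> n div 2 \<Longrightarrow> 0 < complete_moment n i"
  by (simp add: complete_moment_def)

lemma complete_moment_step:
  assumes "4 \<le> n" "1 \<le> i"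
  shows "real (Suc i) * complete_moment n (Suc i) \<le> complete_moment n i"
proof (cases "Suc i \<le> n div 2")
  case True
  then have i: "real i + 1 \<le> real (n div 2)" by linarith
  have n: "2 * real (n div 2) \<le> real n" using half_bounds(1)[of n] by linarith
  have "2 * (real (n div 2) - real i) / (real n - 1 - real i) \<le> 1"
    using i n assms by (subst divide_le_eq) auto
  from mult_left_mono[OF this complete_moment_nonneg[of n i]] show ?thesis
    using complete_moment_Suc[of i n] True by simp
next
  case False
  then show ?thesis using complete_moment_eq_0[of n "Suc i"] complete_moment_nonneg[of n i] by simp
qed

lemma complete_mean_mono:
  assumes "4 \<le> n" "i \<le> j" "j \<le> n div 2"
  shows "complete_mean n i \<le> complete_mean n j"
proof (cases "i = j")
  case False
  define C where "C = (if even n then real n - 2 else real n - 1)"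
  define R where "R = real (n div 2)"
  have "2 \<le> n div 2" using assms(1) by simp
  then have R: "R \<ge> 2" by (simp add: R_def)
  have ij: "real i + 1 \<le> real j" "real j \<le> R" using assms False unfolding R_def by linarith+
  have N: "real n = (if even n then 2 * R else 2 * R + 1)" unfolding R_def by (rule real_half)
  have lt: "real i < real n - 1" "real j < real n - 1" using R ij N by (auto split: if_splits)
  have "C \<le> (real n - 1 - real i) * (real n - 1 - real j)"
  proof (cases "even n")
    case True
    then have "C = 2 * (R - 1)" using N by (simp add: C_def)
    also have "\<dots> \<le> (real n - 1 - real i) * (real n - 1 - real j)"
      using ij R N True by (intro mult_mono) auto
    finally show ?thesis .
  next
    case False
    then have "C = 2 * R" using N by (simp add: C_def)
    also have "\<dots> \<le> (real n - 1 - real i) * (real n - 1 - real j)"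
      using ij R N False by (intro mult_mono) auto
    finally show ?thesis .
  qed
  then have "C / ((real n - 1 - real i) * (real n - 1 - real j)) \<le> 1"
    using lt by (subst divide_le_eq_1_pos) (auto intro: mult_pos_pos)
  then have "0 \<le> (real j - real i) * (1 - C / ((real n - 1 - real i) * (real n - 1 - real j)))"
    using ij by (intro mult_nonneg_nonneg) auto
  then show ?thesis
    using hyperbolic_gap[OF lt, of 2 C] unfolding complete_mean_def C_def[symmetric] by linarith
qed simp

lemma complete_reweighting:
  assumes n: "4 \<le> n" and k: "1 \<le> k"
  defines "m \<equiv> complete_moment n"
  shows "(\<Sum>i = k..2 * k. real (i choose k) * real (k choose (i - k)) * m i)
          * (\<Sum>i = k..2 * k. real (i choose k) * size_biased m i)
      \<le> (\<Sum>i = k..2 * k. real (i choose k) * m i)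
          * (\<Sum>i = k..2 * k. real (i choose k) * real (k choose (i - k)) * size_biased m i)"
proof -
  define d where "d x = real (k + x choose k) * m (k + x)" for x
  define q where "q x = complete_mean n (k + x)" for x
  have d0: "0 \<le> d x" for x by (simp add: d_def m_def complete_moment_nonneg)
  have dz: "d x = 0" if "n div 2 < k + x" for x
    using that by (simp add: d_def m_def complete_moment_eq_0)
  have step: "d (Suc x) \<le> d x" for x
  proof -
    have "d (Suc x) \<le> real (Suc x) * d (Suc x)"
      using d0[of "Suc x"] by (simp add: mult_le_cancel_right1)
    also have "\<dots> = real (k + x choose k) * (real (Suc (k + x)) * m (Suc (k + x)))"
      unfolding d_def by (rule shifted_weight_ratio)
    also have "\<dots> \<le> d x"
      unfolding d_def m_def by (intro mult_left_mono complete_moment_step n) (use k in auto)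
    finally show ?thesis .
  qed
  have anti: "d y \<le> d x" if "x \<le> y" for x y
    using lift_Suc_antimono_le[of d, OF step that] .
  have sb: "size_biased m (k + x) = m (k + x) * q x" for x
  proof (cases "k + x \<le> n div 2")
    case True
    then show ?thesis using size_biased_complete_moment[OF n True] by (simp add: m_def q_def)
  next
    case False
    then show ?thesis by (simp add: m_def size_biased_def complete_moment_eq_0)
  qed
  have "d (k - x) * d (k - y) * (q (k - x) - q (k - y)) \<le> d x * d y * (q y - q x)"
    if xy: "x < y" "x + y < k" for x y
  proof (cases "k + (k - x) \<le> n div 2")
    case True
    have "q (k - x) - q (k - y) \<le> q y - q x"
      unfolding q_def complete_mean_def
      by (rule hyperbolic_gap_antimono) (use xy n True half_bounds[of n] in auto)
    moreover have "0 \<le> q (k - x) - q (k - y)"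
      using complete_mean_mono[OF n, of "k + (k - y)" "k + (k - x)"] True xy by (simp add: q_def)
    moreover have "d (k - x) * d (k - y) \<le> d y * d x"
      using xy by (intro mult_mono anti d0) auto
    ultimately show ?thesis
      using mult_mono[of "d (k - x) * d (k - y)" "d y * d x"] d0 by (simp add: mult.commute)
  next
    case False
    then have "d (k - x) = 0" by (intro dz) simp
    moreover have "0 \<le> d x * d y * (q y - q x)"
    proof (cases "k + y \<le> n div 2")
      case True
      then show ?thesis using complete_mean_mono[OF n, of "k + x" "k + y"] xy d0 by (simp add: q_def)
    qed (simp add: dz)
    ultimately show ?thesis by simp
  qed
  from reweighting_by_binomials[of k d q, OF this] show ?thesis
    unfolding sum_shift_to_zero by (simp add: sb d_def mult_ac)
qed


definition complete_ratio :: "nat \<Rightarrow> real \<Rightarrow> real \<Rightarrow> real" where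
  "complete_ratio n Z Y = (if even n
     then real n * (real n - 2) * Z / ((real n - 1) * Y - real n * Z)
     else real n * (real n - 3) * Z / ((real n - 2) * (Y - Z)))"

lemma complete_mean_even:
  assumes "even n" "k < n - 1"
  shows "(real n - 1) * complete_mean n k - real n
    = real k * ((real n - 2) - (real k - 1) / (real n - 1 - real k))"
proof -
  have "real n - 1 - real k > 0" using assms by linarith
  then show ?thesis using assms by (simp add: complete_mean_def field_simps)
qed

lemma complete_mean_odd:
  assumes "odd n" "k < n - 1"
  shows "complete_mean n k - 1 = real k * ((real n - 2 - real k) / (real n - 1 - real k))"
proof -
  have "real n - 1 - real k > 0" using assms by linarith
  then show ?thesis using assms by (simp add: complete_mean_def field_simps)
qed

lemma complete_mean_pos:
  assumes "4 \<le> n" "1 \<le> k" "k \<le> n div 2"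
  shows "even n \<Longrightarrow> 0 < (real n - 1) * complete_mean n k - real n"
    and "odd n \<Longrightarrow> 1 < complete_mean n k"
proof -
  have k: "2 * real k \<le> real n" "real k \<ge> 1" "real n \<ge> 4" using assms by linarith+
  have "(real k - 1) / (real n - 1 - real k) \<le> 1"
    using k by (subst divide_le_eq_1_pos) auto
  then have "0 < (real n - 2) - (real k - 1) / (real n - 1 - real k)" using k by linarith
  then have "0 < real k * ((real n - 2) - (real k - 1) / (real n - 1 - real k))"
    using k by (intro mult_pos_pos) auto
  then show "even n \<Longrightarrow> 0 < (real n - 1) * complete_mean n k - real n"
    using complete_mean_even[of n k] assms by simp
  assume odd: "odd n"
  then have "2 * real k \<le> real n - 1" using assms real_half[of n] by auto
  then have "0 < real k * ((real n - 2 - real k) / (real n - 1 - real k))"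
    using k by (intro mult_pos_pos divide_pos_pos) auto
  then show "1 < complete_mean n k"
    using complete_mean_odd[OF odd, of k] assms(1,3) by fastforce
qed

lemma complete_mean_bound:
  assumes "4 \<le> n" "1 \<le> k" "k \<le> n div 2"
  shows "complete_ratio n 1 (complete_mean n k) \<le> real n / real k + 10 / real n"
proof -
  define N K where "N = real n" and "K = real k"
  have k: "2 * K \<le> N" "1 \<le> K" "4 \<le> N" using assms unfolding N_def K_def by linarith+
  have "N\<^sup>2 * (K - 1) = N * (N * K - N)" by (simp add: power2_eq_square algebra_simps)
  also have "\<dots> \<le> N * (N * K - 2 * K)" using k by (intro mult_left_mono) auto
  also have "\<dots> = K * (N - 2) * N" by (simp add: algebra_simps)
  also have "\<dots> \<le> K * (N - 2) * (5 * (N - 3))" using k by (intro mult_left_mono) auto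
  finally have key: "N\<^sup>2 * (K - 1) \<le> 5 * K * (N - 2) * (N - 3)" by (simp add: algebra_simps)
  show ?thesis
  proof (cases "even n")
    case True
    define e where "e = (K - 1) / (N - 1 - K)"
    have e1: "e \<le> 1" unfolding e_def using k by (subst divide_le_eq_1_pos) auto
    have e2: "e \<le> (K - 1) / ((N - 2) / 2)"
      unfolding e_def using k by (intro divide_left_mono mult_pos_pos) auto
    have "N\<^sup>2 * e \<le> N\<^sup>2 * ((K - 1) / ((N - 2) / 2))" using e2 by (intro mult_left_mono) auto
    also have "\<dots> = 2 * (N\<^sup>2 * (K - 1)) / (N - 2)" by simp
    also have "\<dots> \<le> 2 * (5 * K * (N - 2) * (N - 3)) / (N - 2)"
      using k by (intro divide_right_mono) (use key in linarith, simp)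
    also have "\<dots> = 10 * K * (N - 3)" using k by simp
    also have "\<dots> \<le> 10 * K * (N - 2 - e)" using k e1 by (intro mult_left_mono) auto
    finally have "N * N * e \<le> 10 * K * (N - 2 - e)" by (simp add: power2_eq_square)
    then have "N * e \<le> 10 * K * (N - 2 - e) / N" using k by (simp add: field_simps)
    moreover have "(N / K + 10 / N) * (K * (N - 2 - e)) = N * (N - 2 - e) + 10 * K * (N - 2 - e) / N"
      using k by (simp add: field_simps)
    ultimately have "N * (N - 2) \<le> (N / K + 10 / N) * (K * (N - 2 - e))"
      by (simp add: algebra_simps)
    moreover have "0 < K * (N - 2 - e)" using k e1 by (intro mult_pos_pos) auto
    ultimately have "N * (N - 2) / (K * (N - 2 - e)) \<le> N / K + 10 / N"
      by (simp only: pos_divide_le_eq)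
    then show ?thesis
      using True complete_mean_even[of n k] assms
      by (simp add: complete_ratio_def e_def N_def K_def)
  next
    case False
    have K: "2 * K \<le> N - 1" using assms False real_half[of n] unfolding N_def K_def by auto
    then have "5 * K * (N - 2) * (N - 3) \<le> 5 * K * (N - 2) * (2 * (N - 2 - K))"
      using k by (intro mult_left_mono) auto
    with key have "N * N * (K - 1) \<le> 10 * K * ((N - 2) * (N - 2 - K))"
      by (simp add: power2_eq_square algebra_simps)
    then have "N * (K - 1) \<le> 10 * K * ((N - 2) * (N - 2 - K)) / N" using k by (simp add: field_simps)
    moreover have "(N / K + 10 / N) * (K * ((N - 2) * (N - 2 - K)))
        = N * ((N - 2) * (N - 2 - K)) + 10 * K * ((N - 2) * (N - 2 - K)) / N"
      using k by (simp add: field_simps)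
    ultimately have "N * (N - 3) * (N - 1 - K) \<le> (N / K + 10 / N) * (K * ((N - 2) * (N - 2 - K)))"
      by (simp add: algebra_simps)
    moreover have "0 < K * ((N - 2) * (N - 2 - K))" using k K by (intro mult_pos_pos) auto
    ultimately have "N * (N - 3) * (N - 1 - K) / (K * ((N - 2) * (N - 2 - K))) \<le> N / K + 10 / N"
      by (simp only: pos_divide_le_eq)
    then show ?thesis
      using False complete_mean_odd[of n k] assms
      by (simp add: complete_ratio_def N_def K_def mult_ac)
  qed
qed

lemma complete_ratio_antimono:
  assumes n: "4 \<le> n" and k: "1 \<le> k" "k \<le> n div 2"
    and pos: "0 < Z" "0 < Z'"
    and le: "complete_mean n k * Z \<le> Y" "Z' * Y \<le> Z * Y'"
  shows "complete_ratio n Z' Y' \<le> complete_ratio n Z Y"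
proof (cases "even n")
  case True
  have "0 < ((real n - 1) * complete_mean n k - real n) * Z"
    using complete_mean_pos(1)[OF n k True] pos by simp
  also have "\<dots> = (real n - 1) * (complete_mean n k * Z) - real n * Z" by (simp add: algebra_simps)
  also have "\<dots> \<le> (real n - 1) * Y - real n * Z" using le n by (intro diff_right_mono mult_left_mono) auto
  finally have D: "0 < (real n - 1) * Y - real n * Z" .
  have "Z' * ((real n - 1) * Y - real n * Z) \<le> Z * ((real n - 1) * Y' - real n * Z')"
    using mult_left_mono[OF le(2), of "real n - 1"] n by (simp add: algebra_simps)
  moreover from this have D': "0 < (real n - 1) * Y' - real n * Z'"
    using D pos by (smt (verit) mult_pos_pos zero_less_mult_pos)
  ultimately have "Z' / ((real n - 1) * Y' - real n * Z') \<le> Z / ((real n - 1) * Y - real n * Z)"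
    using D by (simp add: frac_le_eq divide_simps mult.commute)
  from mult_left_mono[OF this, of "real n * (real n - 2)"] show ?thesis
    using True n by (simp add: complete_ratio_def)
next
  case False
  have "0 < (complete_mean n k - 1) * Z"
    using complete_mean_pos(2)[OF n k False] pos by simp
  also have "\<dots> \<le> Y - Z" using le by (simp add: algebra_simps)
  finally have D: "0 < Y - Z" .
  have "Z' * (Y - Z) \<le> Z * (Y' - Z')"
    using le(2) by (simp add: algebra_simps)
  moreover from this have D': "0 < Y' - Z'"
    using D pos by (smt (verit) mult_pos_pos zero_less_mult_pos)
  ultimately have "Z' / (Y' - Z') \<le> Z / (Y - Z)"
    using D by (simp add: divide_simps mult.commute)
  from mult_left_mono[OF this, of "real n * (real n - 3) / (real n - 2)"] show ?thesis
    using False n by (simp add: complete_ratio_def mult_ac)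
qed

lemma complete_mean_le_weighted:
  assumes n: "4 \<le> n" and w: "\<And>i. 0 \<le> w i"
  shows "complete_mean n k * (\<Sum>i = k..2 * k. w i * complete_moment n i)
    \<le> (\<Sum>i = k..2 * k. w i * size_biased (complete_moment n) i)"
  unfolding sum_distrib_left
proof (intro sum_mono)
  fix i assume i: "i \<in> {k..2 * k}"
  show "complete_mean n k * (w i * complete_moment n i) \<le> w i * size_biased (complete_moment n) i"
  proof (cases "i \<le> n div 2")
    case True
    have "w i * complete_moment n i * complete_mean n k \<le> w i * complete_moment n i * complete_mean n i"
      using complete_mean_mono[OF n _ True, of k] i w complete_moment_nonneg by (intro mult_left_mono) auto
    then show ?thesis using size_biased_complete_moment[OF n True] by (simp add: mult_ac)
  qed (simp add: size_biased_def complete_moment_eq_0)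
qed

lemma complete_bound_eq_ratio:
  assumes n: "4 \<le> n" and k: "1 \<le> k" "k \<le> n div 2"
  shows "complete_bound n k = complete_ratio n
      (\<Sum>i = k..2 * k. real (i choose k) * complete_moment n i)
      (\<Sum>i = k..2 * k. real (i choose k) * size_biased (complete_moment n) i)"
proof -
  define r where "r = n div 2"
  define m where "m = complete_moment n"
  define q where "q = complete_mean n"
  define Z where "Z = (\<Sum>i = k..2 * k. real (i choose k) * m i)"
  define Y where "Y = (\<Sum>i = k..2 * k. real (i choose k) * size_biased m i)"
  define J where "J = {k..min r (2 * k)}"
  define s where "s = 1 / (4 * real r * (real r - 1))"
  have r: "2 \<le> r" using n by (simp add: r_def)
  have s: "s \<noteq> 0" using r by (simp add: s_def)
  have ZJ: "Z = (\<Sum>i\<in>J. real (i choose k) * m i)"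
    unfolding Z_def J_def
    by (rule sum.mono_neutral_right) (auto simp: m_def complete_moment_eq_0 r_def)
  have "Y = (\<Sum>i\<in>J. real (i choose k) * size_biased m i)"
    unfolding Y_def J_def
    by (rule sum.mono_neutral_right) (auto simp: m_def size_biased_def complete_moment_eq_0 r_def)
  also have "\<dots> = (\<Sum>i\<in>J. real (i choose k) * (m i * q i))"
    unfolding J_def m_def q_def by (intro sum.cong refl) (auto simp: size_biased_complete_moment n r_def)
  finally have YJ: "Y = (\<Sum>i\<in>J. real (i choose k) * (m i * q i))" .
  have lin: "(\<Sum>i\<in>J. real (i choose k) * (m i * (a + b * q i) * s)) = s * (a * Z + b * Y)" for a b
    unfolding ZJ YJ by (simp add: sum_distrib_left sum.distrib algebra_simps)
  have Zpos: "0 < Z"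
  proof -
    have "0 < m k" unfolding m_def by (rule complete_moment_pos[OF k(2)])
    also have "\<dots> = real (k choose k) * m k" by simp
    also have "\<dots> \<le> Z" unfolding Z_def
      by (rule member_le_sum) (auto simp: m_def complete_moment_nonneg)
    finally show ?thesis .
  qed
  have qZ: "q k * Z \<le> Y" unfolding q_def Z_def Y_def m_def by (rule complete_mean_le_weighted[OF n]) simp
  show ?thesis
  proof (cases "even n")
    case True
    then have nr: "n = 2 * r" by (simp add: r_def)
    have b: "(\<Sum>i\<in>J. real (i choose k) * tsp_beta n i) = s * (2 * real n * Z + (- 2) * Y)"
      unfolding lin[symmetric]
      by (intro sum.cong refl) (use tsp_even(1)[OF r _ _ nr] k in \<open>auto simp: J_def s_def m_def q_def\<close>)
    have a: "(\<Sum>i\<in>J. real (i choose k) * (tsp_alpha n i - tsp_beta n i)) = s * (- real n * Z + (real n - 1) * Y)"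
      unfolding lin[symmetric]
      by (intro sum.cong refl) (use tsp_even(2)[OF r _ _ nr] k in \<open>auto simp: J_def s_def m_def q_def\<close>)
    have "0 < ((real n - 1) * q k - real n) * Z"
      using complete_mean_pos(1)[OF n k True] Zpos by (simp add: q_def)
    also have "\<dots> = (real n - 1) * (q k * Z) - real n * Z" by (simp add: algebra_simps)
    also have "\<dots> \<le> (real n - 1) * Y - real n * Z" using qZ n by (intro diff_right_mono mult_left_mono) auto
    finally have D: "0 < (real n - 1) * Y - real n * Z" .
    have "complete_bound n k = 1 + (real n - 1) / 2 * ((2 * real n * Z - 2 * Y) / ((real n - 1) * Y - real n * Z))"
      unfolding complete_bound_def r_def[symmetric] J_def[symmetric] a b using s by simp
    also have "\<dots> = real n * (real n - 2) * Z / ((real n - 1) * Y - real n * Z)"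
      using D by (simp add: field_simps)
    finally show ?thesis using True by (simp add: complete_ratio_def Z_def Y_def m_def)
  next
    case False
    then have nr: "n = 2 * r + 1" by (simp add: r_def)
    have b: "(\<Sum>i\<in>J. real (i choose k) * tsp_beta n i)
        = s * ((2 * (real n - 3) + (real n - 2)\<^sup>2) * Z + (- (real n - 2)) * Y)"
      unfolding lin[symmetric]
    proof (intro sum.cong refl arg_cong2[where f = "(*)"])
      fix i assume "i \<in> J"
      then have i: "1 \<le> i" "i \<le> r" using k by (auto simp: J_def)
      have "tsp_beta n i = m i * (2 * (real n - 3) + (real n - 2)\<^sup>2 - (real n - 2) * q i) * s"
        unfolding tsp_odd(1)[OF r i nr] by (simp add: s_def m_def q_def)
      then show "tsp_beta n i = m i * (2 * (real n - 3) + (real n - 2)\<^sup>2 + - (real n - 2) * q i) * s"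
        by (simp only: mult_minus_left add_uminus_conv_diff)
    qed
    have a: "(\<Sum>i\<in>J. real (i choose k) * (tsp_alpha n i - tsp_beta n i))
        = s * (- (real r * (real n - 2)) * Z + (real r * (real n - 2)) * Y)"
      unfolding lin[symmetric]
    proof (intro sum.cong refl arg_cong2[where f = "(*)"])
      fix i assume "i \<in> J"
      then have i: "1 \<le> i" "i \<le> r" using k by (auto simp: J_def)
      have "real r * ((real n - 2) * (q i - 1)) = - (real r * (real n - 2)) + real r * (real n - 2) * q i"
        by (simp add: algebra_simps)
      moreover have "tsp_alpha n i - tsp_beta n i = m i * (real r * ((real n - 2) * (q i - 1))) * s"
        unfolding tsp_odd(2)[OF r i nr] by (simp add: s_def m_def q_def)
      ultimately show "tsp_alpha n i - tsp_beta n i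
          = m i * (- (real r * (real n - 2)) + real r * (real n - 2) * q i) * s"
        by simp
    qed
    have "0 < (q k - 1) * Z"
      using complete_mean_pos(2)[OF n k False] Zpos by (simp add: q_def)
    also have "\<dots> \<le> Y - Z" using qZ by (simp add: algebra_simps)
    finally have D: "0 < Y - Z" .
    have "complete_bound n k = 1 + (real n - 1) / 2 *
        (((2 * (real n - 3) + (real n - 2)\<^sup>2) * Z - (real n - 2) * Y) / (real r * ((real n - 2) * (Y - Z))))"
    proof -
      have "- (real r * (real n - 2)) * Z + real r * (real n - 2) * Y = real r * ((real n - 2) * (Y - Z))"
        by (simp add: algebra_simps)
      then show ?thesis
        unfolding complete_bound_def r_def[symmetric] J_def[symmetric] a b using s
        by (simp only: mult_divide_mult_cancel_left[OF s] mult_minus_left add_uminus_conv_diff)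
    qed
    also have "\<dots> = real n * (real n - 3) * Z / ((real n - 2) * (Y - Z))"
    proof -
      have "(real n - 1) / 2 = real r" using nr by simp
      moreover have "1 + real r * (A / (real r * X)) = (X + A) / X" if "X \<noteq> 0" for A X
        using that r by (simp add: field_simps)
      moreover have "(real n - 2) * (Y - Z) \<noteq> 0" using r nr D by auto
      moreover have "(real n - 2) * (Y - Z) + ((2 * (real n - 3) + (real n - 2)\<^sup>2) * Z - (real n - 2) * Y)
          = real n * (real n - 3) * Z"
        by (simp add: power2_eq_square algebra_simps)
      ultimately show ?thesis by presburger
    qed
    finally show ?thesis using False by (simp add: complete_ratio_def Z_def Y_def m_def)
  qed
qed

(*#PART A4*)
definition bipartite_moment :: "nat \<Rightarrow> nat \<Rightarrow> real" where
  "bipartite_moment n i = real (n choose i) * (fact (2 * n - i - 1) * (fact (n - i))\<^sup>2 / fact (2 * n - 2 * i))"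

definition bipartite_mean :: "nat \<Rightarrow> nat \<Rightarrow> real" where
  "bipartite_mean n i = (if i < n
     then real i + 4 - (4 * real n - 2) / (2 * real n - 1 - real i) else real i)"

definition bipartite_step :: "nat \<Rightarrow> nat \<Rightarrow> real" where
  "bipartite_step n i = (if i < n
     then 2 * (2 * real n - 2 * real i - 1) / (2 * real n - 1 - real i) else 0)"

lemma central_ratio:
  assumes "i < n"
  shows "(fact (n - Suc i))\<^sup>2 / fact (2 * n - 2 * Suc i)
    = (fact (n - i))\<^sup>2 / fact (2 * n - 2 * i) * (2 * (2 * real n - 2 * real i - 1) / (real n - real i))"
proof -
  define s where "s = n - Suc i"
  have s: "n - i = Suc s" "2 * n - 2 * i = Suc (Suc (2 * s))" "2 * n - 2 * Suc i = 2 * s"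
    "real n = real i + real s + 1"
    using assms by (auto simp: s_def)
  have "(fact s)\<^sup>2 / fact (2 * s) = ((real s + 1) * fact s)\<^sup>2 / ((2 * real s + 2) * ((2 * real s + 1) * fact (2 * s)))
      * (2 * (2 * real s + 1) / (real s + 1))"
    by (simp add: divide_simps power2_eq_square) (simp add: algebra_simps)
  then show ?thesis unfolding s s_def[symmetric] fact_Suc by (simp add: algebra_simps)
qed

lemma bipartite_moment_Suc:
  assumes "2 \<le> n"
  shows "real (Suc i) * bipartite_moment n (Suc i) = bipartite_moment n i * bipartite_step n i"
proof (cases "i < n")
  case True
  define c where "c = (fact (n - i))\<^sup>2 / (fact (2 * n - 2 * i) :: real)"
  have f: "fact (2 * n - i - 1) = (2 * real n - 1 - real i) * fact (2 * n - Suc i - 1)"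
    using assms True fact_pred[of "2 * n - i - 1"] by (simp add: of_nat_diff)
  have pos: "2 * real n - 1 - real i > 0" "real n - real i > 0" using True by auto
  have "real (Suc i) * bipartite_moment n (Suc i) = (real (Suc i) * real (n choose Suc i)) * fact (2 * n - Suc i - 1)
      * (c * (2 * (2 * real n - 2 * real i - 1) / (real n - real i)))"
    unfolding bipartite_moment_def times_divide_eq_right[symmetric] central_ratio[OF True] c_def[symmetric]
    by (simp only: mult_ac)
  also have "\<dots> = (real (n choose i) * (fact (2 * n - i - 1) * c)) * bipartite_step n i"
    unfolding Suc_times_binomial_Suc f using pos True by (simp add: bipartite_step_def)
  finally show ?thesis unfolding bipartite_moment_def c_def by simp
next
  case False
  then show ?thesis by (simp add: bipartite_moment_def bipartite_step_def binomial_eq_0)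
qed

lemma bipartite_mean_step: "bipartite_mean n i = real i + bipartite_step n i"
proof (cases "i < n")
  case True
  then have "2 * real n - 1 - real i > 0" by linarith
  then show ?thesis using True by (simp add: bipartite_mean_def bipartite_step_def field_simps)
qed (simp add: bipartite_mean_def bipartite_step_def)

lemma size_biased_bipartite_moment:
  assumes "2 \<le> n"
  shows "size_biased (bipartite_moment n) i = bipartite_moment n i * bipartite_mean n i"
  unfolding size_biased_def bipartite_moment_Suc[OF assms] bipartite_mean_step
  by (simp add: algebra_simps)

lemma bipartite_moment_nonneg: "0 \<le> bipartite_moment n i"
  by (simp add: bipartite_moment_def)

lemma bipartite_moment_eq_0: "n < i \<Longrightarrow> bipartite_moment n i = 0"
  by (simp add: bipartite_moment_def binomial_eq_0)

lemma bipartite_moment_pos: "i \<le> n \<Longrightarrow> 0 < bipartite_moment n i"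
  by (simp add: bipartite_moment_def)

lemma bipartite_step_bounds: "0 \<le> bipartite_step n i" "bipartite_step n i \<le> 2"
  by (auto simp: bipartite_step_def divide_simps)

lemma bipartite_mean_le:
  assumes "i \<le> n" "2 \<le> n"
  shows "bipartite_mean n i \<le> real n"
proof (cases "i = n")
  case False
  define s where "s = real n - real i"
  have s: "1 \<le> s" "s \<le> real n" using assms False by (auto simp: s_def)
  have "2 * (2 * s - 1) \<le> s * (real n + s - 1)"
  proof (cases "s < 2")
    case True
    have "n < i + 2" using True unfolding s_def by linarith
    then have "n = i + 1" using assms False by linarith
    then have "s = 1" by (simp add: s_def)
    then show ?thesis using assms by simp
  next
    case False
    have "2 * (2 * s - 1) \<le> s * (2 * s - 1)" using False by (intro mult_right_mono) auto
    also have "\<dots> \<le> s * (real n + s - 1)" using s by (intro mult_left_mono) auto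
    finally show ?thesis .
  qed
  then have "2 * (2 * s - 1) / (real n + s - 1) \<le> s"
    using s assms by (subst pos_divide_le_eq) auto
  then show ?thesis using False assms
    unfolding bipartite_mean_step bipartite_step_def s_def by (simp add: algebra_simps)
qed (simp add: bipartite_mean_def)

lemma bipartite_mean_mono:
  assumes n: "2 \<le> n" and ij: "i \<le> j" "j \<le> n"
  shows "bipartite_mean n i \<le> bipartite_mean n j"
proof -
  consider "i = j" | "j = n" | "i < j" "j < n" using ij by linarith
  then show ?thesis
  proof cases
    case 2
    then show ?thesis using bipartite_mean_le[of i n] ij n by (simp add: bipartite_mean_def)
  next
    case 3
    then have r: "real i + 1 \<le> real j" "real j + 1 \<le> real n" by linarith+
    have "4 * real n - 2 \<le> (real n + 1) * real n"
    proof -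
      have "0 \<le> (real n - 1) * (real n - 2)" using n by (intro mult_nonneg_nonneg) auto
      then show ?thesis by (simp add: algebra_simps)
    qed
    also have "\<dots> \<le> (2 * real n - 1 - real i) * (2 * real n - 1 - real j)"
      using r by (intro mult_mono) auto
    finally have "(4 * real n - 2) / ((2 * real n - 1 - real i) * (2 * real n - 1 - real j)) \<le> 1"
      using r by (subst divide_le_eq_1_pos) (auto intro: mult_pos_pos)
    then have "0 \<le> (real j - real i) * (1 - (4 * real n - 2) / ((2 * real n - 1 - real i) * (2 * real n - 1 - real j)))"
      using r by (intro mult_nonneg_nonneg) auto
    then show ?thesis
      using hyperbolic_gap[of "real i" "2 * real n - 1" "real j" 4 "4 * real n - 2"] r 3
      by (simp add: bipartite_mean_def)
  qed simp
qed

lemma bipartite_reweighting: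
  assumes n: "2 \<le> n" and k: "1 \<le> k" and large: "4 \<le> k \<or> n < 2 * k \<or> k = 1"
  defines "m \<equiv> bipartite_moment n"
  shows "(\<Sum>i = k..2 * k. real (i choose k) * real (k choose (i - k)) * m i)
          * (\<Sum>i = k..2 * k. real (i choose k) * size_biased m i)
      \<le> (\<Sum>i = k..2 * k. real (i choose k) * m i)
          * (\<Sum>i = k..2 * k. real (i choose k) * real (k choose (i - k)) * size_biased m i)"
proof -
  define d where "d x = real (k + x choose k) * m (k + x)" for x
  define q where "q x = bipartite_mean n (k + x)" for x
  have d0: "0 \<le> d x" for x by (simp add: d_def m_def bipartite_moment_nonneg)
  have dz: "d x = 0" if "n < k + x" for x
    using that by (simp add: d_def m_def bipartite_moment_eq_0)
  have step: "real (Suc x) * d (Suc x) = d x * bipartite_step n (k + x)" for x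
    unfolding d_def m_def shifted_weight_ratio bipartite_moment_Suc[OF n] by simp
  have step2: "real (Suc x) * d (Suc x) \<le> 2 * d x" for x
    unfolding step using mult_left_mono[OF bipartite_step_bounds(2) d0] by (simp add: mult.commute)
  note decay = iterated_ratio_bound[of d 2, OF step2, simplified]
  have qmono: "q x \<le> q y" if "x \<le> y" "k + y \<le> n" for x y
    using bipartite_mean_mono[OF n, of "k + x" "k + y"] that by (simp add: q_def)
  have rhs: "0 \<le> d x * d y * (q y - q x)" if "x < y" for x y
  proof (cases "k + y \<le> n")
    case True
    then show ?thesis using qmono that d0 by simp
  qed (simp add: dz)
  have "d (k - x) * d (k - y) * (q (k - x) - q (k - y)) \<le> d x * d y * (q y - q x)"
    if xy: "x < y" "x + y < k" for x y
  proof (cases "k + (k - x) \<le> n")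
    case False
    then have "d (k - x) = 0" by (intro dz) simp
    then show ?thesis using rhs[OF xy(1)] by simp
  next
    case True
    define r where "r = k - x - y"
    define P Q where "P = (\<Prod>a = 1..r. real (y + a))" and "Q = (\<Prod>a = 1..r. real (x + a))"
    have r: "1 \<le> r" "k - x = y + r" "k - y = x + r" using xy by (auto simp: r_def)
    have k4: "4 \<le> k" using large True xy by auto
    have "real (4 ^ r) \<le> real (\<Prod>a = 1..r. (y + a) * (x + a))"
      using power4_le_prod[of x y r] xy k4 r by (intro of_nat_mono) auto
    then have PQ: "4 ^ r \<le> P * Q" unfolding P_def Q_def by (simp add: prod.distrib)
    have P0: "0 \<le> P" and Q0: "0 \<le> Q" by (auto simp: P_def Q_def intro: prod_nonneg)
    have Qd: "Q * d (k - y) \<le> 2 ^ r * d x"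
      using decay[where y = x and m = r] by (simp add: Q_def r)
    have combine: "c * (d (k - x) * d (k - y)) \<le> d x * d y" if "0 \<le> c" "c * (P * d (k - x)) \<le> 2 ^ r * d y" for c
    proof -
      have "4 ^ r * (c * (d (k - x) * d (k - y))) \<le> P * Q * (c * (d (k - x) * d (k - y)))"
        using that d0 by (intro mult_right_mono PQ) auto
      also have "\<dots> = (c * (P * d (k - x))) * (Q * d (k - y))" by simp
      also have "\<dots> \<le> (2 ^ r * d y) * (2 ^ r * d x)"
        by (rule mult_mono[OF that(2) Qd]) (use d0 Q0 in auto)
      also have "\<dots> = 4 ^ r * (d x * d y)"
        by (simp add: power_mult_distrib[symmetric])
      finally show ?thesis by simp
    qed
    have Pd: "P * d (k - x) \<le> 2 ^ r * d y"
      using decay[where y = y and m = r] by (simp add: P_def r)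
    have gap0: "0 \<le> q (k - x) - q (k - y)" using qmono[of "k - y" "k - x"] xy True by simp
    show ?thesis
    proof (cases "k + (k - x) = n")
      case False
      have gap: "q (k - x) - q (k - y) \<le> q y - q x"
      proof -
        have "k + (k - x) < n" "k + (k - y) < n" "k + x < n" "k + y < n" using True False xy by auto
        then show ?thesis
          unfolding q_def bipartite_mean_def
          by (simp only: if_True) (rule hyperbolic_gap_antimono, use xy n in auto)
      qed
      have "d (k - x) * d (k - y) \<le> d x * d y"
        using combine[of 1] Pd by simp
      from mult_mono[OF this gap] show ?thesis using gap0 d0 by simp
    next
      case top: True
      define s where "s = r - 1"
      have s: "r = Suc s" using r by (simp add: s_def)
      have ps: "bipartite_step n (k + (y + s)) = 2 / real n"
      proof -
        have e: "k + (y + s) = n - 1" using top r s xy by linarith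
        show ?thesis unfolding e using n by (simp add: bipartite_step_def of_nat_diff)
      qed
      have Ps: "P = (\<Prod>a = 1..s. real (y + a)) * real (Suc (y + s))"
        unfolding P_def s by (simp add: mult.commute)
      have "real n * (P * d (k - x)) = real n * ((\<Prod>a = 1..s. real (y + a)) * (real (Suc (y + s)) * d (Suc (y + s))))"
        unfolding Ps r s by simp
      also have "\<dots> = 2 * ((\<Prod>a = 1..s. real (y + a)) * d (y + s))"
        unfolding step ps using n by simp
      also have "\<dots> \<le> 2 * (2 ^ s * d y)"
        using decay[where y = y and m = s] by simp
      finally have "real n * (P * d (k - x)) \<le> 2 ^ r * d y" by (simp add: s)
      then have nd: "real n * (d (k - x) * d (k - y)) \<le> d x * d y" by (intro combine) auto
      have yx: "real y - real x \<ge> 0" using xy by simp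
      have "q (k - x) - q (k - y) \<le> real y - real x"
      proof -
        have "q (k - x) = real n" using top by (simp add: q_def bipartite_mean_def)
        moreover have "real (k + (k - y)) \<le> q (k - y)"
          unfolding q_def bipartite_mean_step using bipartite_step_bounds(1) by simp
        moreover have "real n - real (k + (k - y)) = real y - real x"
          using top xy by (simp add: of_nat_diff flip: top)
        ultimately show ?thesis by linarith
      qed
      then have "d (k - x) * d (k - y) * (q (k - x) - q (k - y)) \<le> d (k - x) * d (k - y) * (real y - real x)"
        using d0 by (intro mult_left_mono) auto
      also have "\<dots> \<le> (d x * d y / real n) * (real y - real x)"
        using nd n yx by (intro mult_right_mono) (auto simp: field_simps)
      also have "\<dots> = d x * d y * ((real y - real x) * (1 / real n))" by simp
      also have "\<dots> \<le> d x * d y * (q y - q x)"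
      proof (intro mult_left_mono)
        define N where "N = real n"
        have l: "k + x < n" "k + y < n" using top xy by auto
        have N: "real (k + x) + 2 \<le> N" "real (k + y) + 1 \<le> N" "5 \<le> N"
          using l xy k4 unfolding N_def by linarith+
        have "(4 * N - 2) / ((2 * N - 1 - real (k + x)) * (2 * N - 1 - real (k + y)))
            \<le> (4 * N - 2) / ((N + 1) * N)"
          using N by (intro divide_left_mono mult_mono mult_pos_pos) auto
        moreover have "(4 * N - 2) / ((N + 1) * N) \<le> 1 - 1 / N"
        proof -
          have "5 * N \<le> N * N" using N by (intro mult_right_mono) auto
          moreover have "(N - 1) * (N + 1) = N * N - 1" by (simp add: algebra_simps)
          ultimately have "4 * N - 2 \<le> (N - 1) * (N + 1)" using N by linarith
          then have "(4 * N - 2) / ((N + 1) * N) \<le> ((N - 1) * (N + 1)) / ((N + 1) * N)"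
            using N by (intro divide_right_mono) auto
          also have "\<dots> = (N - 1) / N" using N by (simp add: mult.commute[of _ "N + 1"])
          also have "\<dots> = 1 - 1 / N" using N by (simp add: diff_divide_distrib)
          finally show ?thesis .
        qed
        ultimately have "(real y - real x) * (1 / N) \<le> (real y - real x) *
            (1 - (4 * N - 2) / ((2 * N - 1 - real (k + x)) * (2 * N - 1 - real (k + y))))"
          using yx by (intro mult_left_mono) auto
        then show "(real y - real x) * (1 / real n) \<le> q y - q x"
          using hyperbolic_gap[of "real (k + x)" "2 * N - 1" "real (k + y)" 4 "4 * N - 2"] N l
          unfolding q_def bipartite_mean_def N_def by simp
      qed (use d0 in auto)
      finally show ?thesis .
    qed
  qed
  from reweighting_by_binomials[of k d q, OF this] show ?thesis
    unfolding sum_shift_to_zero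
    by (simp add: m_def size_biased_bipartite_moment[OF n] d_def q_def mult_ac)
qed

(*#PART A5*)
lemma small_binomials:
  "real (j choose 1) = real j"
  "real (j choose 2) = real j * (real j - 1) / 2"
  "real (j choose 3) = real j * (real j - 1) * (real j - 2) / 6"
  "real (j choose 4) = real j * (real j - 1) * (real j - 2) * (real j - 3) / 24"
  "real (j choose 5) = real j * (real j - 1) * (real j - 2) * (real j - 3) * (real j - 4) / 120"
  "real (j choose 6) = real j * (real j - 1) * (real j - 2) * (real j - 3) * (real j - 4) * (real j - 5) / 720"
proof -
  show 1: "real (j choose 1) = real j" by simp
  show 2: "real (j choose 2) = real j * (real j - 1) / 2"
    using Suc_times_binomial_Suc[of 1 j] 1 by (simp add: numeral_2_eq_2 field_simps)
  show 3: "real (j choose 3) = real j * (real j - 1) * (real j - 2) / 6"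
    using Suc_times_binomial_Suc[of 2 j] 2 by (simp add: field_simps)
  show 4: "real (j choose 4) = real j * (real j - 1) * (real j - 2) * (real j - 3) / 24"
    using Suc_times_binomial_Suc[of 3 j] 3 by (simp add: field_simps)
  show 5: "real (j choose 5) = real j * (real j - 1) * (real j - 2) * (real j - 3) * (real j - 4) / 120"
    using Suc_times_binomial_Suc[of 4 j] 4 by (simp add: field_simps)
  show 6: "real (j choose 6) = real j * (real j - 1) * (real j - 2) * (real j - 3) * (real j - 4) * (real j - 5) / 720"
    using Suc_times_binomial_Suc[of 5 j] 5 by (simp add: field_simps)
qed

definition test_weight2 :: "nat \<Rightarrow> real" where
  "test_weight2 = (\<lambda>i. 0)(1 := 1/4, 2 := - 1/2, 3 := 3, 4 := 6)"

definition test_weight3 :: "nat \<Rightarrow> real" where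
  "test_weight3 = (\<lambda>i. 0)(2 := 1/4, 3 := - 1/2, 4 := 3/2, 5 := 20, 6 := 20)"

lemma sum_1_4: "(\<Sum>i = 1..4. f i) = f 1 + f 2 + f 3 + f (4::nat)" for f :: "nat \<Rightarrow> real"
  by (simp add: numeral_eq_Suc)

lemma sum_1_6: "(\<Sum>i = 1..6. f i) = f 1 + f 2 + f 3 + f 4 + f 5 + f (6::nat)" for f :: "nat \<Rightarrow> real"
  by (simp add: numeral_eq_Suc)

lemma sum_2_4: "(\<Sum>i = 2..4. f i) = f 2 + f 3 + f (4::nat)" for f :: "nat \<Rightarrow> real"
  by (simp add: numeral_eq_Suc)

lemma sum_3_6: "(\<Sum>i = 3..6. f i) = f 3 + f 4 + f 5 + f (6::nat)" for f :: "nat \<Rightarrow> real"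
  by (simp add: numeral_eq_Suc)

lemma test_square2:
  "(real (j choose 2) + (- 1/2) * real (j choose (2 - 1)))\<^sup>2 = (\<Sum>i = 1..2 * 2. test_weight2 i * real (j choose i))"
proof -
  have "(real (j choose 2) + (- 1/2) * real (j choose 1))\<^sup>2
      = 1/4 * real (j choose 1) - 1/2 * real (j choose 2) + 3 * real (j choose 3) + 6 * real (j choose 4)"
    unfolding small_binomials by (simp add: field_simps power2_eq_square)
  moreover have "2 * 2 = (4::nat)" by simp
  ultimately show ?thesis unfolding \<open>2 * 2 = 4\<close> sum_1_4 by (simp add: test_weight2_def)
qed

lemma test_square3:
  "(real (j choose 3) + (- 1/2) * real (j choose (3 - 1)))\<^sup>2 = (\<Sum>i = 1..2 * 3. test_weight3 i * real (j choose i))"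
proof -
  have "(real (j choose 3) + (- 1/2) * real (j choose 2))\<^sup>2
      = 1/4 * real (j choose 2) - 1/2 * real (j choose 3) + 3/2 * real (j choose 4) + 20 * real (j choose 5)
        + 20 * real (j choose 6)"
    unfolding small_binomials by (simp add: field_simps power2_eq_square)
  moreover have "2 * 3 = (6::nat)" by simp
  ultimately show ?thesis unfolding \<open>2 * 3 = 6\<close> sum_1_6 by (simp add: test_weight3_def)
qed

lemma binomial_values:
  "(2::nat) choose 2 = 1" "(3::nat) choose 2 = 3" "(4::nat) choose 2 = 6"
  "(3::nat) choose 3 = 1" "(4::nat) choose 3 = 4" "(5::nat) choose 3 = 10" "(6::nat) choose 3 = 20"
  by (simp_all add: numeral_eq_Suc)

lemma bipartite_gap:
  assumes "Suc i < n"
  shows "bipartite_mean n (Suc i) - bipartite_mean n i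
    = 1 - (4 * real n - 2) / ((2 * real n - 1 - real i) * (2 * real n - 2 - real i))"
  using assms hyperbolic_gap[of "real i" "2 * real n - 1" "real (Suc i)" 4 "4 * real n - 2"]
  by (simp add: bipartite_mean_def algebra_simps)

lemma bipartite_reweighting2:
  assumes n: "4 \<le> n"
  defines "m \<equiv> bipartite_moment n"
  shows "(\<Sum>i = 1..4. test_weight2 i * m i) * (\<Sum>i = 2..4. real (i choose 2) * size_biased m i)
      \<le> (\<Sum>i = 2..4. real (i choose 2) * m i) * (\<Sum>i = 1..4. test_weight2 i * size_biased m i)"
proof -
  define q where "q = bipartite_mean n"
  have sb: "size_biased m i = m i * q i" for i
    using size_biased_bipartite_moment[of n i] n by (simp add: m_def q_def)
  have nn: "0 \<le> m i" for i by (simp add: m_def bipartite_moment_nonneg)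
  have qmono: "q i \<le> q j" if "i \<le> j" "j \<le> n" for i j
    using bipartite_mean_mono[of n i j] that n by (simp add: q_def)
  define N where "N = real n"
  have N: "4 \<le> N" using n by (simp add: N_def)
  have st: "real (Suc i) * m (Suc i) = m i * (2 * (2 * N - 2 * real i - 1) / (2 * N - 1 - real i))" if "i < n" for i
    using bipartite_moment_Suc[of n i] that n by (simp add: m_def bipartite_step_def N_def)
  have m12: "m 1 \<le> 6/5 * m 2"
  proof -
    have "2 * m 2 = m 1 * (2 * (2 * N - 3) / (2 * N - 2))" using st[of 1] n by (simp add: numeral_2_eq_2)
    moreover have "5/3 \<le> 2 * (2 * N - 3) / (2 * N - 2)" using N by (simp add: field_simps)
    from mult_left_mono[OF this nn[of 1]] have "m 1 * (5/3) \<le> m 1 * (2 * (2 * N - 3) / (2 * N - 2))" .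
    ultimately show ?thesis by linarith
  qed
  have m23: "6/5 * m 2 \<le> 3 * m 3"
  proof -
    have "3 * m 3 = m 2 * (2 * (2 * N - 5) / (2 * N - 3))" using st[of 2] n by (simp add: numeral_3_eq_3)
    moreover have "6/5 \<le> 2 * (2 * N - 5) / (2 * N - 3)" using N by (simp add: field_simps)
    from mult_left_mono[OF this nn[of 2]] have "m 2 * (6/5) \<le> m 2 * (2 * (2 * N - 5) / (2 * N - 3))" .
    ultimately show ?thesis by linarith
  qed
  define s1 s2 where "s1 = q 2 - q 1" and "s2 = q 3 - q 2"
  have s1: "0 \<le> s1" using qmono[of 1 2] n by (simp add: s1_def)
  have s2: "0 \<le> s2" using qmono[of 2 3] n by (simp add: s2_def)
  have s4: "s2 \<le> q 4 - q 2" using qmono[of 3 4] n by (simp add: s2_def)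
  have s12: "s1 \<le> 2 * s2"
  proof -
    have e1: "s1 = 1 - (4 * N - 2) / ((2 * N - 2) * (2 * N - 3))"
      using bipartite_gap[of 1 n] n by (simp add: s1_def q_def N_def numeral_2_eq_2)
    have e2: "s2 = 1 - (4 * N - 2) / ((2 * N - 3) * (2 * N - 4))"
      using bipartite_gap[of 2 n] n by (simp add: s2_def q_def N_def numeral_3_eq_3)
    define t where "t = N - 4"
    have t: "0 \<le> t" "N = t + 4" using N by (auto simp: t_def)
    have "2 * (4 * N - 2) * (2 * N - 2) \<le> (2 * N - 2) * (2 * N - 3) * (2 * N - 4) + (4 * N - 2) * (2 * N - 4)"
    proof -
      have "(2 * N - 2) * (2 * N - 3) * (2 * N - 4) + (4 * N - 2) * (2 * N - 4) - 2 * (4 * N - 2) * (2 * N - 2)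
          = 8 * t^3 + 52 * t^2 + 88 * t + 8"
        unfolding t(2) by (simp add: algebra_simps power2_eq_square power3_eq_cube)
      moreover have "0 \<le> 8 * t^3 + 52 * t^2 + 88 * t + 8" using t by simp
      ultimately show ?thesis by linarith
    qed
    then have "2 * ((4 * N - 2) / ((2 * N - 3) * (2 * N - 4))) \<le> 1 + (4 * N - 2) / ((2 * N - 2) * (2 * N - 3))"
      using N by (simp add: divide_simps) (simp add: algebra_simps)
    moreover have "1 - a \<le> 2 * (1 - b)" if "2 * b \<le> 1 + a" for a b :: real using that by (simp add: field_simps)
    ultimately show ?thesis unfolding e1 e2 by blast
  qed
  define V where "V = 3 * m 3 + 6 * m 4"
  define Z where "Z = m 2 + V"
  define Y where "Y = m 2 * q 2 + 3 * (m 3 * q 3) + 6 * (m 4 * q 4)"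
  have V: "6/5 * m 2 \<le> V" using m23 nn[of 4] by (simp add: V_def)
  have U: "s2 * V \<le> Y - q 2 * Z"
  proof -
    have "Y - q 2 * Z = 3 * m 3 * s2 + 6 * m 4 * (q 4 - q 2)"
      by (simp add: Y_def Z_def V_def s2_def algebra_simps)
    moreover have "6 * m 4 * s2 \<le> 6 * m 4 * (q 4 - q 2)" using s4 nn by (intro mult_left_mono) auto
    ultimately show ?thesis by (simp add: V_def algebra_simps)
  qed
  have "s1 * Z \<le> 4 * (s2 * V)"
  proof -
    have "s1 * Z \<le> s1 * (2 * V)" using V s1 nn[of 2] by (intro mult_left_mono) (auto simp: Z_def)
    also have "\<dots> \<le> 2 * s2 * (2 * V)" using s12 V nn[of 2] by (intro mult_right_mono) auto
    finally show ?thesis by simp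
  qed
  then have sZ: "s1 * Z \<le> 4 * (Y - q 2 * Z)" by (rule order_trans) (rule mult_left_mono[OF U], simp)
  have YZ0: "0 \<le> Y - q 2 * Z" proof -
    have "0 \<le> V" using V nn[of 2] by linarith
    then have "0 \<le> s2 * V" using s2 by simp
    then show ?thesis using U by linarith
  qed
  have "0 \<le> Z" unfolding Z_def using V nn[of 2] by linarith
  then have "0 \<le> s1 * Z" using s1 by simp
  moreover have "1/4 * m 1 \<le> 1/4 * (6/5 * m 2)" using m12 by linarith
  ultimately have "1/4 * m 1 * (s1 * Z) \<le> 1/4 * (6/5 * m 2) * (4 * (Y - q 2 * Z))"
    using sZ nn[of 2] by (intro mult_mono[OF _ sZ]) auto
  also have "\<dots> = (3/2 * m 2 - 1/4 * (6/5 * m 2)) * (Y - q 2 * Z)" by (simp add: algebra_simps)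
  also have "\<dots> \<le> (3/2 * m 2 - 1/4 * m 1) * (Y - q 2 * Z)"
    using m12 YZ0 by (intro mult_right_mono) auto
  finally have "0 \<le> (3/2 * m 2 - 1/4 * m 1) * (Y - q 2 * Z) - 1/4 * m 1 * (s1 * Z)" by simp
  also have "\<dots> = Z * (1/4 * (m 1 * q 1) - 1/2 * (m 2 * q 2) + 3 * (m 3 * q 3) + 6 * (m 4 * q 4))
      - (1/4 * m 1 - 1/2 * m 2 + 3 * m 3 + 6 * m 4) * Y"
    by (simp add: Z_def V_def Y_def s1_def algebra_simps)
  finally show ?thesis
    unfolding sum_1_4 sum_2_4 sb binomial_values
    by (simp add: test_weight2_def Z_def V_def Y_def add.assoc)
qed

lemma test_weight3_slack:
  fixes m2 m3 m4 m5 :: real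
  assumes "m2 \<le> 2 * m3" "4 * m4 \<le> 2 * m3" "6/7 * m4 \<le> 5 * m5"
    and "0 \<le> m3"
  shows "19/50 * m3 \<le> 5/9 * (3/2 * m3 + 5/2 * m4 - 10 * m5 - 1/4 * m2) + 10 * m5 - 5/2 * m4"
proof -
  have "5/9 * (3/2 * m3 + 5/2 * m4 - 10 * m5 - 1/4 * m2) + 10 * m5 - 5/2 * m4
    = 5/6 * m3 - 10/9 * m4 + 8/9 * (5 * m5) - 5/36 * m2" by (simp add: field_simps)
  also have "\<dots> \<ge> 5/6 * m3 - 10/9 * m4 + 8/9 * (6/7 * m4) - 5/36 * (2 * m3)"
    using assms by (intro add_mono diff_mono mult_left_mono) auto
  finally have "5/6 * m3 - 10/9 * m4 + 8/9 * (6/7 * m4) - 5/36 * (2 * m3) \<le> 5/9 * (3/2 * m3 + 5/2 * m4 - 10 * m5 - 1/4 * m2) + 10 * m5 - 5/2 * m4" .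
  moreover have "5/6 * m3 - 10/9 * m4 + 8/9 * (6/7 * m4) - 5/36 * (2 * m3) = 5/9 * m3 - 22/63 * m4" by (simp add: field_simps)
  moreover have "22/63 * m4 \<le> 22/63 * (1/2 * m3)" using assms(2) by (intro mult_left_mono) auto
  moreover have "19/50 * m3 \<le> 24/63 * m3" using assms(4) by (intro mult_right_mono) auto
  moreover have "24/63 * m3 = 5/9 * m3 - 22/63 * (1/2 * m3)" by (simp add: field_simps)
  ultimately show ?thesis by linarith
qed
lemma bipartite_reweighting3:
  assumes n: "6 \<le> n"
  defines "m \<equiv> bipartite_moment n"
  shows "(\<Sum>i = 1..6. test_weight3 i * m i) * (\<Sum>i = 3..6. real (i choose 3) * size_biased m i)
      \<le> (\<Sum>i = 3..6. real (i choose 3) * m i) * (\<Sum>i = 1..6. test_weight3 i * size_biased m i)"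
proof -
  define q where "q = bipartite_mean n"
  have sb: "size_biased m i = m i * q i" for i
    using size_biased_bipartite_moment[of n i] n by (simp add: m_def q_def)
  have nn: "0 \<le> m i" for i by (simp add: m_def bipartite_moment_nonneg)
  have qmono: "q i \<le> q j" if "i \<le> j" "j \<le> n" for i j
    using bipartite_mean_mono[of n i j] that n by (simp add: q_def)
  define N where "N = real n"
  have N: "6 \<le> N" using n by (simp add: N_def)
  have st: "real (Suc i) * m (Suc i) = m i * (2 * (2 * N - 2 * real i - 1) / (2 * N - 1 - real i))" if "i < n" for i
    using bipartite_moment_Suc[of n i] that n by (simp add: m_def bipartite_step_def N_def)
  have m23: "m 2 \<le> 2 * m 3"
  proof -
    have "3 * m 3 = m 2 * (2 * (2 * N - 5) / (2 * N - 3))" using st[of 2] n by (simp add: numeral_3_eq_3)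
    moreover have "3/2 \<le> 2 * (2 * N - 5) / (2 * N - 3)" using N by (simp add: field_simps)
    from mult_left_mono[OF this nn[of 2]] have "m 2 * (3/2) \<le> m 2 * (2 * (2 * N - 5) / (2 * N - 3))" .
    ultimately show ?thesis by linarith
  qed
  have m34: "5/4 * m 3 \<le> 4 * m 4" "4 * m 4 \<le> 2 * m 3"
  proof -
    have e: "4 * m 4 = m 3 * (2 * (2 * N - 7) / (2 * N - 4))" using st[of 3] n by (simp add: numeral_eq_Suc)
    have "5/4 \<le> 2 * (2 * N - 7) / (2 * N - 4)" using N by (simp add: field_simps)
    from mult_left_mono[OF this nn[of 3]] show "5/4 * m 3 \<le> 4 * m 4" unfolding e by (simp add: mult.commute)
    have "2 * (2 * N - 7) / (2 * N - 4) \<le> 2" using N by (simp add: field_simps)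
    from mult_left_mono[OF this nn[of 3]] show "4 * m 4 \<le> 2 * m 3" unfolding e by (simp add: mult.commute)
  qed
  have m45: "6/7 * m 4 \<le> 5 * m 5" "5 * m 5 \<le> 2 * m 4"
  proof -
    have e: "5 * m 5 = m 4 * (2 * (2 * N - 9) / (2 * N - 5))" using st[of 4] n by (simp add: numeral_eq_Suc)
    have "6/7 \<le> 2 * (2 * N - 9) / (2 * N - 5)" using N by (simp add: field_simps)
    from mult_left_mono[OF this nn[of 4]] show "6/7 * m 4 \<le> 5 * m 5" unfolding e by (simp add: mult.commute)
    have "2 * (2 * N - 9) / (2 * N - 5) \<le> 2" using N by (simp add: field_simps)
    from mult_left_mono[OF this nn[of 4]] show "5 * m 5 \<le> 2 * m 4" unfolding e by (simp add: mult.commute)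
  qed
  define s2 s3 s4 where "s2 = q 3 - q 2" and "s3 = q 4 - q 3" and "s4 = q 5 - q 4"
  have s0: "0 \<le> s2" "0 \<le> s3" "0 \<le> s4"
    using qmono[of 2 3] qmono[of 3 4] qmono[of 4 5] n by (simp_all add: s2_def s3_def s4_def)
  have e2: "s2 = 1 - (4 * N - 2) / ((2 * N - 3) * (2 * N - 4))"
    using bipartite_gap[of 2 n] n by (simp add: s2_def q_def N_def numeral_3_eq_3)
  have e3: "s3 = 1 - (4 * N - 2) / ((2 * N - 4) * (2 * N - 5))"
    using bipartite_gap[of 3 n] n by (simp add: s3_def q_def N_def numeral_eq_Suc)
  have e4: "s4 = 1 - (4 * N - 2) / ((2 * N - 5) * (2 * N - 6))"
    using bipartite_gap[of 4 n] n by (simp add: s4_def q_def N_def numeral_eq_Suc)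
  define t where "t = N - 6"
  have t: "0 \<le> t" "N = t + 6" using N by (auto simp: t_def)
  have s32: "4/5 * s2 \<le> s3"
  proof -
    have "5 * (4 * N - 2) * (2 * N - 3) \<le> (2 * N - 3) * (2 * N - 4) * (2 * N - 5) + 4 * (4 * N - 2) * (2 * N - 5)"
    proof -
      have "(2 * N - 3) * (2 * N - 4) * (2 * N - 5) + 4 * (4 * N - 2) * (2 * N - 5) - 5 * (4 * N - 2) * (2 * N - 3)
          = 8 * t^3 + 88 * t^2 + 270 * t + 130"
        unfolding t(2) by (simp add: algebra_simps power2_eq_square power3_eq_cube)
      moreover have "0 \<le> 8 * t^3 + 88 * t^2 + 270 * t + 130" using t by simp
      ultimately show ?thesis by linarith
    qed
    then have "(4 * N - 2) / ((2 * N - 4) * (2 * N - 5)) \<le> 1/5 + 4/5 * ((4 * N - 2) / ((2 * N - 3) * (2 * N - 4)))"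
      using N by (simp add: divide_simps) (simp add: algebra_simps)
    moreover have "4/5 * (1 - a) \<le> 1 - b" if "b \<le> 1/5 + 4/5 * a" for a b :: real using that by (simp add: field_simps)
    ultimately show ?thesis unfolding e2 e3 by blast
  qed
  have s42: "3/5 * s2 \<le> s4"
  proof -
    have "5 * (4 * N - 2) * ((2 * N - 3) * (2 * N - 4)) \<le>
        2 * (2 * N - 3) * (2 * N - 4) * (2 * N - 5) * (2 * N - 6) + 3 * (4 * N - 2) * ((2 * N - 5) * (2 * N - 6))"
    proof -
      have "2 * (2 * N - 3) * (2 * N - 4) * (2 * N - 5) * (2 * N - 6) + 3 * (4 * N - 2) * ((2 * N - 5) * (2 * N - 6))
          - 5 * (4 * N - 2) * ((2 * N - 3) * (2 * N - 4))
          = 32 * t^4 + 448 * t^3 + 2136 * t^2 + 3640 * t + 900"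
        unfolding t(2) by (simp add: algebra_simps power2_eq_square power3_eq_cube power4_eq_xxxx)
      moreover have "0 \<le> 32 * t^4 + 448 * t^3 + 2136 * t^2 + 3640 * t + 900" using t by simp
      ultimately show ?thesis by linarith
    qed
    then have "(4 * N - 2) / ((2 * N - 5) * (2 * N - 6)) \<le> 2/5 + 3/5 * ((4 * N - 2) / ((2 * N - 3) * (2 * N - 4)))"
      using N by (simp add: divide_simps) (simp add: algebra_simps)
    moreover have "3/5 * (1 - a) \<le> 1 - b" if "b \<le> 2/5 + 3/5 * a" for a b :: real using that by (simp add: field_simps)
    ultimately show ?thesis unfolding e2 e4 by blast
  qed
  define V where "V = 4 * m 4 + 10 * m 5 + 20 * m 6"
  define Z where "Z = m 3 + V"
  define Y where "Y = m 3 * q 3 + 4 * (m 4 * q 4) + 10 * (m 5 * q 5) + 20 * (m 6 * q 6)"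
  define d where "d = Y - q 3 * Z"
  have V: "5/4 * m 3 \<le> V" using m34 nn[of 5] nn[of 6] by (simp add: V_def)
  have Z0: "0 \<le> Z" using V nn[of 3] by (simp add: Z_def)
  have dZ: "5/9 * s3 * Z \<le> d"
  proof -
    have "d = 4 * m 4 * s3 + 10 * m 5 * (q 5 - q 3) + 20 * m 6 * (q 6 - q 3)"
      by (simp add: d_def Y_def Z_def V_def s3_def algebra_simps)
    moreover have "10 * m 5 * s3 \<le> 10 * m 5 * (q 5 - q 3)" "20 * m 6 * s3 \<le> 20 * m 6 * (q 6 - q 3)"
      using qmono[of 4 5] qmono[of 4 6] n nn[of 5] nn[of 6] by (auto intro!: mult_left_mono simp: s3_def)
    ultimately have "s3 * V \<le> d" by (simp add: V_def algebra_simps)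
    moreover have "s3 * (5/9 * Z) \<le> s3 * V" using V s0 by (intro mult_left_mono) (auto simp: Z_def)
    ultimately show ?thesis by simp
  qed
  define A where "A = 3/2 * m 3 + 5/2 * m 4 - 10 * m 5 - 1/4 * m 2"
  have A0: "0 \<le> A" using m23 m34 m45 nn[of 3] nn[of 4] by (simp add: A_def)
  have key: "0 \<le> 5/9 * s3 * A + 10 * m 5 * (s3 + s4) - 5/2 * m 4 * s3 - 1/4 * m 2 * s2"
  proof -
    have "s3 * (19/50 * m 3) \<le> s3 * (5/9 * A + 10 * m 5 - 5/2 * m 4)"
    proof (rule mult_left_mono[OF _ s0(2)])
      show "19/50 * m 3 \<le> 5/9 * A + 10 * m 5 - 5/2 * m 4"
        unfolding A_def by (rule test_weight3_slack[OF m23 m34(2) m45(1) nn])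
    qed
    moreover have "s4 * (1/2 * m 3) \<le> s4 * (10 * m 5)"
      using m34 m45 s0 nn[of 3] by (intro mult_left_mono) auto
    moreover have "s2 * (1/4 * m 2) \<le> s2 * (1/2 * m 3)"
      using m23 s0 by (intro mult_left_mono) auto
    moreover have "4/5 * s2 * (19/50 * m 3) \<le> s3 * (19/50 * m 3)"
      using s32 nn[of 3] by (intro mult_right_mono) auto
    moreover have "3/5 * s2 * (1/2 * m 3) \<le> s4 * (1/2 * m 3)"
      using s42 nn[of 3] by (intro mult_right_mono) auto
    moreover have "0 \<le> s2 * m 3" using s0 nn by simp
    ultimately show ?thesis by (simp add: algebra_simps)
  qed
  have "0 \<le> Z * (5/9 * s3 * A + 10 * m 5 * (s3 + s4) - 5/2 * m 4 * s3 - 1/4 * m 2 * s2)"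
    using key Z0 by (rule mult_nonneg_nonneg[rotated])
  also have "\<dots> = (5/9 * s3 * Z) * A + Z * (10 * m 5 * (s3 + s4) - 5/2 * m 4 * s3 - 1/4 * m 2 * s2)"
    by (simp add: algebra_simps)
  also have "\<dots> \<le> d * A + Z * (10 * m 5 * (s3 + s4) - 5/2 * m 4 * s3 - 1/4 * m 2 * s2)"
    using dZ A0 by (intro add_right_mono mult_right_mono)
  also have "\<dots> = Z * (1/4 * (m 2 * q 2) - 1/2 * (m 3 * q 3) + 3/2 * (m 4 * q 4) + 20 * (m 5 * q 5) + 20 * (m 6 * q 6))
      - (1/4 * m 2 - 1/2 * m 3 + 3/2 * m 4 + 20 * m 5 + 20 * m 6) * Y"
    by (simp add: A_def d_def Z_def V_def Y_def s2_def s3_def s4_def field_simps)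
  finally show ?thesis
    unfolding sum_1_6 sum_3_6 sb binomial_values
    by (simp add: test_weight3_def Z_def V_def Y_def add.assoc)
qed

(*#PART A6*)
lemma binom_shift_both:
  assumes "1 \<le> r"
  shows "binom (r - 1) (int i - 1) = real i / real r * real (r choose i)"
proof (cases i)
  case (Suc j)
  define s where "s = r - 1"
  have r: "r = Suc s" using assms by (simp add: s_def)
  have "real i * real (r choose i) = real r * real (s choose j)"
    using arg_cong[OF Suc_times_binomial[of j s], of real] unfolding Suc r of_nat_mult .
  moreover have "binom (r - 1) (int i - 1) = real (s choose j)" using Suc by (simp add: binom_def s_def)
  moreover have "real r \<noteq> 0" using assms by simp
  ultimately show ?thesis by (simp only: times_divide_eq_left eq_divide_eq) simp
qed (simp add: binom_def)

lemma binom_nat: "binom n (int i) = real (n choose i)"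
  by (simp add: binom_def)

lemma binom_two_below:
  assumes "2 \<le> r"
  shows "binom (r - 2) (int i) = (real r - real i) * (real r - 1 - real i) / (real r * (real r - 1)) * real (r choose i)"
    and "binom (r - 2) (int i - 1) = real i * (real r - real i) / (real r * (real r - 1)) * real (r choose i)"
proof -
  have r: "r - 2 = r - 1 - 1" "real (r - 1) = real r - 1" "real r \<noteq> 0" "real r - 1 \<noteq> 0"
    using assms by (auto simp: of_nat_diff)
  have c: "real (r - 1 choose i) = (real r - real i) / real r * real (r choose i)"
    using binom_shift1[of r i] assms by (simp add: binom_nat)
  show "binom (r - 2) (int i) = (real r - real i) * (real r - 1 - real i) / (real r * (real r - 1)) * real (r choose i)"
    unfolding r(1) using assms binom_shift1[of "r - 1" i] unfolding c r(2) by (simp add: mult_ac)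
  show "binom (r - 2) (int i - 1) = real i * (real r - real i) / (real r * (real r - 1)) * real (r choose i)"
    unfolding r(1) using assms binom_shift_both[of "r - 1" i] unfolding c r(2) by (simp add: mult_ac)
qed

lemma inverse_central_binom:
  assumes "i \<le> n"
  shows "inverse (binom (2 * n - 2 * i) (int n - int i)) = (fact (n - i))\<^sup>2 / fact (2 * n - 2 * i)"
proof -
  have e: "2 * n - 2 * i - (n - i) = n - i" "n - i \<le> 2 * n - 2 * i" using assms by auto
  have "binom (2 * n - 2 * i) (int n - int i) = real ((2 * n - 2 * i) choose (n - i))"
    using assms by (simp add: binom_def nat_diff_distrib)
  also have "\<dots> = fact (2 * n - 2 * i) / (fact (n - i) * fact (n - i))"
    using binomial_fact[OF e(2), where 'a = real] unfolding e(1) .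
  finally show ?thesis by (simp add: power2_eq_square)
qed

lemma tsp_bipartite_identities:
  fixes R K X :: real
  assumes pos: "2 * R - 1 - K > 0" "R > 0" "R - 1 > 0"
  defines "q \<equiv> K + 4 - (4 * R - 2) / (2 * R - 1 - K)"
  shows "2 * (2 * (R - 1 - K) * (2 * (R - K) - 1) + 4 * (K * (R - K)) + K * (K - 1)) / (R * (R - 1)) * X
      = X * (2 * R - 1 - K) * (2 * (2 * R - q)) / (R * (R - 1))" (is ?b)
    and "(K / R * (2 * R - 1 - K) + 2 * (2 * (R - K) - 1) / R
          + (2 * (R - 1 - K) * (2 * (R - K) - 1) + 4 * (K * (R - K)) + K * (K - 1)) / (R * (R - 1))) * X
        - X * (2 * R - 1 - K) * (2 * (2 * R - q)) / (R * (R - 1))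
      = X * (2 * R - 1 - K) * (R * (q - 2)) / (R * (R - 1))" (is ?a)
proof -
  have e: "(2 * R - 1 - K) * q = (2 * R - 1 - K) * (K + 4) - (4 * R - 2)"
    unfolding q_def using pos by (simp add: field_simps)
  have b: "X * (2 * R - 1 - K) * (2 * (2 * R - q)) = X * (2 * (2 * R * (2 * R - 1 - K) - (2 * R - 1 - K) * q))"
    by (simp add: algebra_simps)
  have a: "X * (2 * R - 1 - K) * (R * (q - 2)) = X * R * ((2 * R - 1 - K) * q - 2 * (2 * R - 1 - K))"
    by (simp add: algebra_simps)
  show ?b unfolding b e times_divide_eq_left by (rule arg_cong2[where f = "(/)"]) (simp_all add: algebra_simps)
  have "K / R * (2 * R - 1 - K) + 2 * (2 * (R - K) - 1) / R
      = (K * (2 * R - 1 - K) + 2 * (2 * (R - K) - 1)) * (R - 1) / (R * (R - 1))"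
    using pos by (simp add: field_simps)
  then have "K / R * (2 * R - 1 - K) + 2 * (2 * (R - K) - 1) / R
          + (2 * (R - 1 - K) * (2 * (R - K) - 1) + 4 * (K * (R - K)) + K * (K - 1)) / (R * (R - 1))
      = ((K * (2 * R - 1 - K) + 2 * (2 * (R - K) - 1)) * (R - 1)
          + (2 * (R - 1 - K) * (2 * (R - K) - 1) + 4 * (K * (R - K)) + K * (K - 1))) / (R * (R - 1))"
    by (simp only: add_divide_distrib)
  then show ?a unfolding a b e times_divide_eq_left diff_divide_distrib[symmetric]
    by (simp only: times_divide_eq_left diff_divide_distrib[symmetric])
       (rule arg_cong2[where f = "(/)"], simp_all add: algebra_simps)
qed

lemma tsp_bipartite:
  assumes n: "2 \<le> n" and i: "1 \<le> i" "i \<le> n"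
  shows "tsp_eta n i = bipartite_moment n i * (2 * (2 * real n - bipartite_mean n i)) / (real n * (real n - 1))"
    and "tsp_gamma n i - tsp_eta n i = bipartite_moment n i * (real n * (bipartite_mean n i - 2)) / (real n * (real n - 1))"
proof -
  define c where "c = (fact (n - i))\<^sup>2 / (fact (2 * n - 2 * i) :: real)"
  define X where "X = real (n choose i) * fact (2 * n - i - 2) * c"
  define c' where "c' = inverse (binom (2 * (n - i - 1)) (int n - int i - 1))"
  define R K where "R = real n" and "K = real i"
  have c: "inverse (binom (2 * n - 2 * i) (int n - int i)) = c"
    unfolding c_def by (rule inverse_central_binom[OF i(2)])
  have pos: "2 * R - 1 - K > 0" "R > 0" "R - 1 > 0" using assms by (auto simp: R_def K_def)
  have f: "fact (2 * n - i - 1) = (2 * R - 1 - K) * fact (2 * n - i - 2)"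
    using assms fact_pred[of "2 * n - i - 1"] by (simp add: of_nat_diff R_def K_def)
  have m: "bipartite_moment n i = X * (2 * R - 1 - K)"
    unfolding bipartite_moment_def X_def c_def f by (simp add: R_def K_def)
  have eta: "tsp_eta n i = 2 * (binom (n - 2) (int i) * fact (2 * n - i - 2) * c'
      + 4 * binom (n - 2) (int i - 1) * fact (2 * n - i - 2) * c + binom (n - 2) (int i - 2) * fact (2 * n - i - 2) * c)"
    unfolding tsp_eta_def c c'_def by simp
  have gamma: "tsp_gamma n i = binom (n - 1) (int i - 1) * ((2 * R - 1 - K) * fact (2 * n - i - 2)) * c
      + binom (n - 1) (int i) * fact (2 * n - i - 2) * c' + tsp_eta n i / 2"
    unfolding tsp_gamma_def tsp_eta_def c c'_def f by simp
  have sh: "binom (n - 2) (int i) = (R - K) * (R - 1 - K) / (R * (R - 1)) * real (n choose i)"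
    "binom (n - 2) (int i - 1) = K * (R - K) / (R * (R - 1)) * real (n choose i)"
    "binom (n - 2) (int i - 2) = K * (K - 1) / (R * (R - 1)) * real (n choose i)"
    "binom (n - 1) (int i - 1) = K / R * real (n choose i)"
    "binom (n - 1) (int i) = (R - K) / R * real (n choose i)"
    unfolding R_def K_def using n binom_two_below[of n i] binom_shift2[of n i] binom_shift_both[of n i] binom_shift1[of n i]
    by auto
  have main: "tsp_eta n i = X * (2 * R - 1 - K) * (2 * (2 * R - q)) / (R * (R - 1)) \<and>
      tsp_gamma n i - tsp_eta n i = X * (2 * R - 1 - K) * (R * (q - 2)) / (R * (R - 1))"
    if q: "q = bipartite_mean n i" for q
  proof (cases "i < n")
    case True
    have RK: "R - K \<noteq> 0" using True by (simp add: R_def K_def)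
    have "n - i - 1 = n - Suc i" "int n - int i - 1 = int n - int (Suc i)" by auto
    then have "c' = (fact (n - Suc i))\<^sup>2 / fact (2 * n - 2 * Suc i)"
      unfolding c'_def using inverse_central_binom[of "Suc i" n] True by (simp only: diff_mult_distrib2) 
    also have "\<dots> = c * (2 * (2 * R - 2 * K - 1) / (R - K))"
      unfolding central_ratio[OF True] c_def R_def K_def by simp
    finally have c': "c' = c * (2 * (2 * (R - K) - 1) / (R - K))" by (simp add: algebra_simps)
    have qq: "q = K + 4 - (4 * R - 2) / (2 * R - 1 - K)"
      using True unfolding q by (simp add: bipartite_mean_def R_def K_def)
    have e: "tsp_eta n i = 2 * (2 * (R - 1 - K) * (2 * (R - K) - 1) + 4 * (K * (R - K)) + K * (K - 1)) / (R * (R - 1)) * X"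
    proof -
      have "(R - K) * (R - 1 - K) / (R * (R - 1)) * real (n choose i) * fact (2 * n - i - 2) * c'
          = 2 * (R - 1 - K) * (2 * (R - K) - 1) / (R * (R - 1)) * X"
      proof -
        have "(R - K) * (R - 1 - K) / (R * (R - 1)) * real (n choose i) * fact (2 * n - i - 2) * c'
            = (R - 1 - K) / (R * (R - 1)) * real (n choose i) * fact (2 * n - i - 2) * ((R - K) * c')"
          by (simp only: times_divide_eq_left times_divide_eq_right) (simp only: mult_ac)
        also have "(R - K) * c' = c * (2 * (2 * (R - K) - 1))" unfolding c' using RK by simp
        finally show ?thesis
          unfolding X_def by (simp only: times_divide_eq_left times_divide_eq_right) (simp only: mult_ac)
      qed
      moreover have "4 * (K * (R - K) / (R * (R - 1)) * real (n choose i)) * fact (2 * n - i - 2) * c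
          = 4 * (K * (R - K)) / (R * (R - 1)) * X" unfolding X_def by simp
      moreover have "K * (K - 1) / (R * (R - 1)) * real (n choose i) * fact (2 * n - i - 2) * c
          = K * (K - 1) / (R * (R - 1)) * X" unfolding X_def by simp
      moreover have "2 * (A / D * X + B / D * X + E / D * X) = 2 * (A + B + E) / D * X" for A B D E
        by (simp add: add_divide_distrib distrib_left distrib_right)
      ultimately show ?thesis unfolding eta sh by presburger
    qed
    have g: "tsp_gamma n i = (K / R * (2 * R - 1 - K) + 2 * (2 * (R - K) - 1) / R
          + (2 * (R - 1 - K) * (2 * (R - K) - 1) + 4 * (K * (R - K)) + K * (K - 1)) / (R * (R - 1))) * X"
    proof -
      have "(R - K) / R * real (n choose i) * fact (2 * n - i - 2) * c' = 2 * (2 * (R - K) - 1) / R * X"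
        unfolding c' X_def using RK by simp
      moreover have "K / R * real (n choose i) * ((2 * R - 1 - K) * fact (2 * n - i - 2)) * c = K / R * (2 * R - 1 - K) * X"
        unfolding X_def by simp
      moreover have "2 * A / D * X / 2 = A / D * X" for A D by simp
      then have "tsp_eta n i / 2
          = (2 * (R - 1 - K) * (2 * (R - K) - 1) + 4 * (K * (R - K)) + K * (K - 1)) / (R * (R - 1)) * X"
        unfolding e by blast
      ultimately show ?thesis unfolding gamma sh by (simp only: distrib_right)
    qed
    have "tsp_eta n i = X * (2 * R - 1 - K) * (2 * (2 * R - q)) / (R * (R - 1))"
      unfolding e qq by (rule tsp_bipartite_identities(1)[OF pos])
    moreover have "tsp_gamma n i - X * (2 * R - 1 - K) * (2 * (2 * R - q)) / (R * (R - 1))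
        = X * (2 * R - 1 - K) * (R * (q - 2)) / (R * (R - 1))"
      unfolding g qq by (rule tsp_bipartite_identities(2)[OF pos])
    ultimately show ?thesis by simp
  next
    case False
    then have "i = n" using i by simp
    then have K: "K = R" and q': "q = R" by (simp_all add: K_def R_def q bipartite_mean_def)
    have e: "tsp_eta n i = 2 * X"
      unfolding eta sh K X_def using pos by simp
    have g: "tsp_gamma n i = (R - 1) * X + X"
      unfolding gamma e unfolding sh K X_def using pos by simp
    show ?thesis unfolding e g K q' using pos by (simp add: field_simps)
  qed
  from main[OF refl] show
    "tsp_eta n i = bipartite_moment n i * (2 * (2 * real n - bipartite_mean n i)) / (real n * (real n - 1))"
    "tsp_gamma n i - tsp_eta n i = bipartite_moment n i * (real n * (bipartite_mean n i - 2)) / (real n * (real n - 1))"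
    unfolding m R_def by simp_all
qed

definition bipartite_ratio :: "nat \<Rightarrow> real \<Rightarrow> real \<Rightarrow> real" where
  "bipartite_ratio n Z Y = (2 * real n - 2) * Z / (Y - 2 * Z)"

lemma bipartite_mean_eq:
  assumes "k < n"
  shows "bipartite_mean n k - 2 = real k * (2 * real n - real k - 3) / (2 * real n - 1 - real k)"
proof -
  have "2 * real n - 1 - real k > 0" using assms by linarith
  then show ?thesis using assms by (simp add: bipartite_mean_def field_simps)
qed

lemma bipartite_mean_gt2:
  assumes "3 \<le> n" "1 \<le> k" "k \<le> n"
  shows "2 < bipartite_mean n k"
proof (cases "k < n")
  case True
  have "0 < real k * (2 * real n - real k - 3) / (2 * real n - 1 - real k)"
    using True assms by (intro divide_pos_pos mult_pos_pos) auto
  then show ?thesis using bipartite_mean_eq[OF True] by linarith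
next
  case False
  then show ?thesis using assms by (simp add: bipartite_mean_def)
qed

lemma bipartite_mean_bound:
  assumes n: "3 \<le> n" and k: "1 \<le> k" "k \<le> n" "k + 3 < 2 * n"
  shows "bipartite_ratio n 1 (bipartite_mean n k)
    \<le> 2 * real n / real k + 2 * (real k + 1) / (real k * (2 * real n - real k - 3))"
proof -
  define N K where "N = real n" and "K = real k"
  have p: "K \<ge> 1" "K \<le> N" "2 * N - K - 3 > 0" "N \<ge> 3" using assms by (auto simp: N_def K_def)
  show ?thesis
  proof (cases "k < n")
    case True
    have "bipartite_ratio n 1 (bipartite_mean n k) = (2 * N - 2) * (2 * N - 1 - K) / (K * (2 * N - K - 3))"
      unfolding bipartite_ratio_def using bipartite_mean_eq[OF True] by (simp add: N_def K_def)
    also have "\<dots> = 2 * N / K + 2 * (K + 1) / (K * (2 * N - K - 3))"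
      using p by (simp add: divide_simps) (simp add: algebra_simps)
    finally show ?thesis unfolding N_def K_def by simp
  next
    case False
    then have KN: "K = N" and q: "bipartite_mean n k = N" using k by (simp_all add: K_def N_def bipartite_mean_def)
    have N: "N > 3" using p KN by simp
    have "(2 * N - 2) / (N - 2) = 2 + 2 / (N - 2)" using N by (simp add: field_simps)
    also have "2 / (N - 2) \<le> 2 * (N + 1) / (N * (N - 3))"
      using N by (simp add: divide_simps) (simp add: algebra_simps)
    finally show ?thesis using KN N unfolding bipartite_ratio_def q
      by (simp add: N_def[symmetric] K_def[symmetric])
  qed
qed

lemma bipartite_ratio_antimono:
  assumes n: "3 \<le> n" and k: "1 \<le> k" "k \<le> n"
    and pos: "0 < Z" "0 < Z'"
    and le: "bipartite_mean n k * Z \<le> Y" "Z' * Y \<le> Z * Y'"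
  shows "bipartite_ratio n Z' Y' \<le> bipartite_ratio n Z Y" "0 < Y - 2 * Z" "0 < Y' - 2 * Z'"
proof -
  have "0 < (bipartite_mean n k - 2) * Z"
    using bipartite_mean_gt2[OF n k] pos by simp
  also have "\<dots> \<le> Y - 2 * Z" using le by (simp add: algebra_simps)
  finally show D: "0 < Y - 2 * Z" .
  have l: "Z' * (Y - 2 * Z) \<le> Z * (Y' - 2 * Z')"
    using le(2) by (simp add: algebra_simps)
  have "0 < Z' * (Y - 2 * Z)" using pos D by simp
  then have "0 < Z * (Y' - 2 * Z')" using l by linarith
  then show D': "0 < Y' - 2 * Z'" using pos by (simp add: zero_less_mult_iff)
  from l have "Z' / (Y' - 2 * Z') \<le> Z / (Y - 2 * Z)"
    using D D' by (simp add: divide_simps mult.commute)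
  from mult_left_mono[OF this, of "2 * real n - 2"] show "bipartite_ratio n Z' Y' \<le> bipartite_ratio n Z Y"
    using n by (simp add: bipartite_ratio_def)
qed

lemma bipartite_mean_le_weighted:
  assumes n: "2 \<le> n" and w: "\<And>i. 0 \<le> w i"
  shows "bipartite_mean n k * (\<Sum>i = k..2 * k. w i * bipartite_moment n i)
    \<le> (\<Sum>i = k..2 * k. w i * size_biased (bipartite_moment n) i)"
  unfolding sum_distrib_left
proof (intro sum_mono)
  fix i assume i: "i \<in> {k..2 * k}"
  show "bipartite_mean n k * (w i * bipartite_moment n i) \<le> w i * size_biased (bipartite_moment n) i"
  proof (cases "i \<le> n")
    case True
    have "w i * bipartite_moment n i * bipartite_mean n k \<le> w i * bipartite_moment n i * bipartite_mean n i"
      using bipartite_mean_mono[OF n _ True, of k] i w bipartite_moment_nonneg by (intro mult_left_mono) auto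
    then show ?thesis using size_biased_bipartite_moment[OF n, of i] by (simp add: mult_ac)
  qed (simp add: size_biased_def bipartite_moment_eq_0)
qed

lemma bipartite_bound_eq_ratio:
  assumes n: "3 \<le> n" and k: "1 \<le> k" "k \<le> n"
  shows "bipartite_bound n k = bipartite_ratio n
      (\<Sum>i = k..2 * k. real (i choose k) * bipartite_moment n i)
      (\<Sum>i = k..2 * k. real (i choose k) * size_biased (bipartite_moment n) i)" (is "_ = bipartite_ratio n ?Z ?Y")
    and "0 < (\<Sum>i = k..2 * k. real (i choose k) * bipartite_moment n i)"
proof -
  define m where "m = bipartite_moment n"
  define q where "q = bipartite_mean n"
  define Z where "Z = (\<Sum>i = k..2 * k. real (i choose k) * m i)"
  define Y where "Y = (\<Sum>i = k..2 * k. real (i choose k) * size_biased m i)"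
  define J where "J = {k..min n (2 * k)}"
  define s where "s = 1 / (real n * (real n - 1))"
  have n2: "2 \<le> n" using n by simp
  have s: "s \<noteq> 0" using n by (simp add: s_def)
  have ZJ: "Z = (\<Sum>i\<in>J. real (i choose k) * m i)"
    unfolding Z_def J_def
    by (rule sum.mono_neutral_right) (auto simp: m_def bipartite_moment_eq_0)
  have "Y = (\<Sum>i\<in>J. real (i choose k) * size_biased m i)"
    unfolding Y_def J_def
    by (rule sum.mono_neutral_right) (auto simp: m_def size_biased_def bipartite_moment_eq_0)
  also have "\<dots> = (\<Sum>i\<in>J. real (i choose k) * (m i * q i))"
    unfolding m_def q_def size_biased_bipartite_moment[OF n2] ..
  finally have YJ: "Y = (\<Sum>i\<in>J. real (i choose k) * (m i * q i))" .
  have lin: "(\<Sum>i\<in>J. real (i choose k) * (m i * (a + b * q i) * s)) = s * (a * Z + b * Y)" for a b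
    unfolding ZJ YJ by (simp add: sum_distrib_left sum.distrib algebra_simps)
  have "0 < m k" unfolding m_def by (rule bipartite_moment_pos[OF k(2)])
  also have "\<dots> = real (k choose k) * m k" by simp
  also have "\<dots> \<le> Z" unfolding Z_def
    by (rule member_le_sum) (auto simp: m_def bipartite_moment_nonneg)
  finally have Zpos: "0 < Z" .
  then show "0 < ?Z" by (simp add: Z_def m_def)
  have qZ: "q k * Z \<le> Y" unfolding q_def Z_def Y_def m_def by (rule bipartite_mean_le_weighted[OF n2]) simp
  have b: "(\<Sum>i\<in>J. real (i choose k) * tsp_eta n i) = s * (4 * real n * Z + (- 2) * Y)"
    unfolding lin[symmetric]
  proof (intro sum.cong refl arg_cong2[where f = "(*)"])
    fix i assume "i \<in> J"
    then have i: "1 \<le> i" "i \<le> n" using k by (auto simp: J_def)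
    show "tsp_eta n i = m i * (4 * real n + - 2 * q i) * s"
      unfolding tsp_bipartite(1)[OF n2 i] by (simp add: s_def m_def q_def)
  qed
  have a: "(\<Sum>i\<in>J. real (i choose k) * (tsp_gamma n i - tsp_eta n i)) = s * (- (2 * real n) * Z + real n * Y)"
    unfolding lin[symmetric]
  proof (intro sum.cong refl arg_cong2[where f = "(*)"])
    fix i assume "i \<in> J"
    then have i: "1 \<le> i" "i \<le> n" using k by (auto simp: J_def)
    have "- (2 * real n) + real n * q i = real n * (q i - 2)" by (simp add: algebra_simps)
    then show "tsp_gamma n i - tsp_eta n i = m i * (- (2 * real n) + real n * q i) * s"
      unfolding tsp_bipartite(2)[OF n2 i] by (simp add: s_def m_def q_def)
  qed
  have D: "0 < Y - 2 * Z"
    by (rule bipartite_ratio_antimono(2)[OF n k Zpos Zpos qZ[unfolded q_def], of Y]) simp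
  have "- (2 * real n) * Z + real n * Y = real n * (Y - 2 * Z)" by (simp add: algebra_simps)
  then have "bipartite_bound n k = 1 + real n / 2 * ((4 * real n * Z + - 2 * Y) / (real n * (Y - 2 * Z)))"
    unfolding bipartite_bound_def J_def[symmetric] a b using s
    by (simp only: mult_divide_mult_cancel_left[OF s])
  also have "\<dots> = bipartite_ratio n Z Y"
    using D n by (simp add: bipartite_ratio_def field_simps)
  finally show "bipartite_bound n k = bipartite_ratio n ?Z ?Y" by (simp add: Z_def Y_def m_def)
qed

lemma square_weights:
  assumes k: "1 \<le> k"
  defines "w \<equiv> \<lambda>i. if k \<le> i then real (i choose k) * real (k choose (i - k)) else 0"
  shows "(real (j choose k))\<^sup>2 = (\<Sum>i = 1..2 * k. w i * real (j choose i))"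
    and "(\<Sum>i = 1..2 * k. w i * f i) = (\<Sum>i = k..2 * k. real (i choose k) * real (k choose (i - k)) * f i)"
proof -
  show e: "(\<Sum>i = 1..2 * k. w i * f i) = (\<Sum>i = k..2 * k. real (i choose k) * real (k choose (i - k)) * f i)" for f
    unfolding w_def using k by (intro sum.mono_neutral_cong_right) auto
  have "(real (j choose k))\<^sup>2 = (\<Sum>x\<le>k. real (k + x choose k) * real (k choose x) * real (j choose (k + x)))"
    using arg_cong[OF binomial_square_expansion[of j k], of real] by simp
  then show "(real (j choose k))\<^sup>2 = (\<Sum>i = 1..2 * k. w i * real (j choose i))"
    unfolding e sum_shift_to_zero by simp
qed

lemma bipartite_test_weights:
  assumes n: "3 \<le> n" and k: "1 \<le> k" "k \<le> n"
  defines "m \<equiv> bipartite_moment n"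
  obtains c :: real and w :: "nat \<Rightarrow> real" where
    "\<And>j. (real (j choose k) + c * real (j choose (k - 1)))\<^sup>2 = (\<Sum>i = 1..2 * k. w i * real (j choose i))"
    "0 < (\<Sum>i = 1..2 * k. w i * m i)"
    "(\<Sum>i = 1..2 * k. w i * m i) * (\<Sum>i = k..2 * k. real (i choose k) * size_biased m i)
      \<le> (\<Sum>i = k..2 * k. real (i choose k) * m i) * (\<Sum>i = 1..2 * k. w i * size_biased m i)"
proof -
  have nn: "0 \<le> m i" for i by (simp add: m_def bipartite_moment_nonneg)
  have step: "real (Suc i) * m (Suc i) = m i * (2 * (2 * real n - 2 * real i - 1) / (2 * real n - 1 - real i))"
    if "i < n" for i
    using bipartite_moment_Suc[of n i] that n by (simp add: m_def bipartite_step_def)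
  consider "4 \<le> k \<or> n < 2 * k \<or> k = 1" | "k = 2" "4 \<le> n" | "k = 3" "6 \<le> n" using k n by linarith
  then show thesis
  proof cases
    case 1
    show thesis
    proof (rule that[of 0 "\<lambda>i. if k \<le> i then real (i choose k) * real (k choose (i - k)) else 0"])
      have "0 < m k" unfolding m_def by (rule bipartite_moment_pos[OF k(2)])
      also have "\<dots> = real (k choose k) * real (k choose (k - k)) * m k" by simp
      also have "\<dots> \<le> (\<Sum>i = k..2 * k. real (i choose k) * real (k choose (i - k)) * m i)"
        by (rule member_le_sum) (auto intro!: mult_nonneg_nonneg nn)
      finally show "0 < (\<Sum>i = 1..2 * k. (if k \<le> i then real (i choose k) * real (k choose (i - k)) else 0) * m i)"
        unfolding square_weights(2)[OF k(1)] .
    next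
      show "(real (j choose k) + 0 * real (j choose (k - 1)))\<^sup>2
          = (\<Sum>i = 1..2 * k. (if k \<le> i then real (i choose k) * real (k choose (i - k)) else 0) * real (j choose i))" for j
        using square_weights(1)[OF k(1)] by simp
    next
      show "(\<Sum>i = 1..2 * k. (if k \<le> i then real (i choose k) * real (k choose (i - k)) else 0) * m i)
            * (\<Sum>i = k..2 * k. real (i choose k) * size_biased m i)
          \<le> (\<Sum>i = k..2 * k. real (i choose k) * m i)
            * (\<Sum>i = 1..2 * k. (if k \<le> i then real (i choose k) * real (k choose (i - k)) else 0) * size_biased m i)"
        unfolding square_weights(2)[OF k(1)] m_def
        by (rule bipartite_reweighting) (use 1 n k in auto)
    qed
  next
    case 2
    have "0 < m 1" unfolding m_def using 2 by (intro bipartite_moment_pos) simp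
    moreover have "6/5 \<le> 2 * (2 * real n - 5) / (2 * real n - 3)" using 2 by (simp add: field_simps)
    from mult_left_mono[OF this nn[of 2]] have "6/5 * m 2 \<le> 3 * m 3"
      using step[of 2] 2 by (simp add: numeral_3_eq_3 mult.commute)
    ultimately have "0 < (\<Sum>i = 1..4. test_weight2 i * m i)"
      unfolding sum_1_4 using nn[of 2] nn[of 3] nn[of 4] by (simp add: test_weight2_def)
    moreover have "2 * k = 4" using 2 by simp
    ultimately show thesis
      using bipartite_reweighting2[OF 2(2)] test_square2 2(1)
      by (intro that[of "- 1/2" test_weight2]) (simp_all add: m_def)
  next
    case 3
    have "0 < m 2" unfolding m_def using 3 by (intro bipartite_moment_pos) simp
    moreover have "5/4 \<le> 2 * (2 * real n - 7) / (2 * real n - 4)" using 3 by (simp add: field_simps)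
    from mult_left_mono[OF this nn[of 3]] have "5/4 * m 3 \<le> 4 * m 4"
      using step[of 3] 3 by (simp add: numeral_eq_Suc mult.commute)
    moreover have "6/7 \<le> 2 * (2 * real n - 9) / (2 * real n - 5)" using 3 by (simp add: field_simps)
    from mult_left_mono[OF this nn[of 4]] have "6/7 * m 4 \<le> 5 * m 5"
      using step[of 4] 3 by (simp add: numeral_eq_Suc mult.commute)
    ultimately have "0 < (\<Sum>i = 1..6. test_weight3 i * m i)"
      unfolding sum_1_6 using nn[of 3] nn[of 4] nn[of 6] by (simp add: test_weight3_def)
    moreover have "2 * k = 6" using 3 by simp
    ultimately show thesis
      using bipartite_reweighting3[OF 3(2)] test_square3 3(1)
      by (intro that[of "- 1/2" test_weight3]) (simp_all add: m_def)
  qed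
qed

(*#PART B*)
fun path_edges :: "'v list \<Rightarrow> 'v set set" where
  "path_edges (x # y # zs) = insert {x, y} (path_edges (y # zs))"
| "path_edges _ = {}"

definition cycle_edges :: "'v list \<Rightarrow> 'v set set" where
  "cycle_edges vs = {{vs ! i, vs ! ((i + 1) mod length vs)} | i. i < length vs}"

definition is_matching :: "'v set set \<Rightarrow> bool" where
  "is_matching S \<longleftrightarrow> (\<forall>e\<in>S. card e = 2) \<and> (\<forall>e\<in>S. \<forall>f\<in>S. e \<noteq> f \<longrightarrow> e \<inter> f = {})"

definition arrangements :: "(nat \<Rightarrow> 'v \<Rightarrow> bool) \<Rightarrow> 'v set \<Rightarrow> 'v set set \<Rightarrow> 'v list set" where
  "arrangements P W S = {ws. distinct ws \<and> set ws = W \<and> (\<forall>i<length ws. P i (ws ! i)) \<and> S \<subseteq> path_edges ws}"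

lemma path_edges_subset: "e \<in> path_edges ws \<Longrightarrow> e \<subseteq> set ws"
  by (induction ws rule: path_edges.induct) auto

lemma finite_arrangements:
  assumes "finite W"
  shows "finite (arrangements P W S)"
proof -
  have "arrangements P W S \<subseteq> {ws. set ws \<subseteq> W \<and> distinct ws}"
    unfolding arrangements_def by (rule Collect_mono) simp
  then show ?thesis using finite_subset_distinct[OF assms] finite_subset by blast
qed

lemma is_matching_subset: "is_matching S \<Longrightarrow> T \<subseteq> S \<Longrightarrow> is_matching T"
  unfolding is_matching_def by (meson subsetD)

lemma is_matchingD: "is_matching S \<Longrightarrow> e \<in> S \<Longrightarrow> f \<in> S \<Longrightarrow> x \<in> e \<Longrightarrow> x \<in> f \<Longrightarrow> e = f"
  unfolding is_matching_def by (meson disjoint_iff)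

lemma arrangements_split:
  assumes S: "is_matching S" "\<Union>S \<subseteq> W" and W: "W \<noteq> {}"
  shows "arrangements P W S =
      (\<Union>a\<in>{a\<in>W - \<Union>S. P 0 a}. Cons a ` arrangements (\<lambda>i. P (Suc i)) (W - {a}) S)
    \<union> (\<Union>(a, b)\<in>{(a, b). {a, b} \<in> S \<and> P 0 a \<and> P 1 b}.
         (\<lambda>ws. a # b # ws) ` arrangements (\<lambda>i. P (Suc (Suc i))) (W - {a, b}) (S - {{a, b}}))"
    (is "_ = ?L \<union> ?R")
proof (intro equalityI subsetI)
  fix ws assume ws: "ws \<in> arrangements P W S"
  then obtain a zs where z: "ws = a # zs" using W by (cases ws) (auto simp: arrangements_def)
  have d: "distinct zs" "a \<notin> set zs" "set zs = W - {a}" "P 0 a" "\<forall>i<length zs. P (Suc i) (zs ! i)"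
    and sub: "S \<subseteq> path_edges (a # zs)"
    using ws unfolding z arrangements_def by (auto simp: All_less_Suc2)
  show "ws \<in> ?L \<union> ?R"
  proof (cases "a \<in> \<Union>S")
    case False
    have "S \<subseteq> path_edges zs"
      using sub False by (cases zs) auto
    then have "zs \<in> arrangements (\<lambda>i. P (Suc i)) (W - {a}) S"
      using d by (auto simp: arrangements_def)
    moreover have "a \<in> W" using ws unfolding z by (auto simp: arrangements_def)
    ultimately have "a # zs \<in> ?L" using False d(4) by (intro UN_I[of a]) simp_all
    then show ?thesis unfolding z by (rule UnI1)
  next
    case True
    then obtain e where e: "e \<in> S" "a \<in> e" by auto
    obtain b ys where b: "zs = b # ys" using sub e by (cases zs) auto
    have "e \<notin> path_edges zs" using path_edges_subset[of e zs] e d by auto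
    then have eb: "e = {a, b}" using sub e unfolding b by auto
    have "S - {e} \<subseteq> path_edges ys"
    proof
      fix f assume f: "f \<in> S - {e}"
      then have "a \<notin> f" "b \<notin> f" using is_matchingD[OF S(1) e(1), of f] eb by auto
      then show "f \<in> path_edges ys" using f sub unfolding b by (cases ys) auto
    qed
    then have "ys \<in> arrangements (\<lambda>i. P (Suc (Suc i))) (W - {a, b}) (S - {{a, b}})"
      using d unfolding b eb arrangements_def by (auto simp: All_less_Suc2)
    moreover have "P 1 b" using d unfolding b by auto
    moreover have "{a, b} \<in> S" using e(1) eb by simp
    ultimately have "a # b # ys \<in> ?R" using d(4) by (intro UN_I[of "(a, b)"]) simp_all
    then show ?thesis unfolding z b by (rule UnI2)
  qed
next
  fix ws assume "ws \<in> ?L \<union> ?R"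
  then consider "ws \<in> ?L" | "ws \<in> ?R" by (elim UnE)
  then show "ws \<in> arrangements P W S"
  proof cases
    case 1
    then obtain a zs where single: "a \<in> W - \<Union>S" "P 0 a" "ws = a # zs"
      "zs \<in> arrangements (\<lambda>i. P (Suc i)) (W - {a}) S" by blast
    then have "path_edges zs \<subseteq> path_edges ws" by (cases zs) auto
    then show ?thesis using single by (auto simp: arrangements_def All_less_Suc2)
  next
    case 2
    then obtain a b zs where pair: "{a, b} \<in> S" "P 0 a" "P 1 b" "ws = a # b # zs"
      "zs \<in> arrangements (\<lambda>i. P (Suc (Suc i))) (W - {a, b}) (S - {{a, b}})" by (elim UN_E) auto
    have "a \<noteq> b" using pair S by (auto simp: is_matching_def)
    moreover have "path_edges zs \<subseteq> path_edges ws" using pair by (cases zs) auto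
    moreover have "{a, b} \<subseteq> W" using pair S by auto
    ultimately show ?thesis using pair by (auto simp: arrangements_def All_less_Suc2)
  qed
qed

lemma card_arrangements_split:
  assumes S: "is_matching S" "\<Union>S \<subseteq> W" and W: "W \<noteq> {}" "finite W"
  shows "card (arrangements P W S) =
      (\<Sum>a\<in>{a\<in>W - \<Union>S. P 0 a}. card (arrangements (\<lambda>i. P (Suc i)) (W - {a}) S))
    + (\<Sum>(a, b)\<in>{(a, b). {a, b} \<in> S \<and> P 0 a \<and> P 1 b}.
         card (arrangements (\<lambda>i. P (Suc (Suc i))) (W - {a, b}) (S - {{a, b}})))"
proof -
  define I where "I = {(a, b). {a, b} \<in> S \<and> P 0 a \<and> P 1 b}"
  define L where "L a = Cons a ` arrangements (\<lambda>i. P (Suc i)) (W - {a}) S" for a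
  define R where "R p = (\<lambda>ws. fst p # snd p # ws) ` arrangements (\<lambda>i. P (Suc (Suc i))) (W - {fst p, snd p}) (S - {{fst p, snd p}})" for p
  have "I \<subseteq> W \<times> W" using S unfolding I_def by blast
  then have finI: "finite I" using W by (meson finite_SigmaI finite_subset)
  have fin: "finite (L a)" "finite (R p)" for a p
    using W by (auto simp: L_def R_def intro!: finite_arrangements)
  have "card (arrangements P W S) = card ((\<Union>a\<in>{a\<in>W - \<Union>S. P 0 a}. L a) \<union> (\<Union>p\<in>I. R p))"
    unfolding arrangements_split[OF S W(1)] L_def R_def I_def by (simp add: case_prod_unfold)
  also have "\<dots> = card (\<Union>a\<in>{a\<in>W - \<Union>S. P 0 a}. L a) + card (\<Union>p\<in>I. R p)"
    using fin finI W by (intro card_Un_disjoint) (auto simp: L_def R_def I_def)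
  also have "card (\<Union>a\<in>{a\<in>W - \<Union>S. P 0 a}. L a) = (\<Sum>a\<in>{a\<in>W - \<Union>S. P 0 a}. card (L a))"
    using fin W by (intro card_UN_disjoint) (auto simp: L_def)
  also have "card (\<Union>p\<in>I. R p) = (\<Sum>p\<in>I. card (R p))"
    using fin finI by (intro card_UN_disjoint) (auto simp: R_def)
  finally show ?thesis
    by (simp add: L_def R_def I_def card_image inj_on_def case_prod_unfold)
qed

lemma matching_vertices:
  assumes "is_matching S" "finite S"
  shows "card (\<Union>S) = 2 * card S" and "card {(a, b). {a, b} \<in> S} = 2 * card S"
proof -
  have c: "card e = 2" "finite e" if "e \<in> S" for e
    using assms that by (auto simp: is_matching_def intro: card_ge_0_finite)
  have "card (\<Union>S) = (\<Sum>e\<in>S. card e)"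
    by (rule card_Union_disjoint) (use assms c in \<open>auto simp: is_matching_def pairwise_def disjnt_def\<close>)
  then show "card (\<Union>S) = 2 * card S" using c by simp
  have "bij_betw fst {(a, b). {a, b} \<in> S} (\<Union>S)"
  proof (rule bij_betwI')
    fix p r assume pr: "p \<in> {(a, b). {a, b} \<in> S}" "r \<in> {(a, b). {a, b} \<in> S}"
    show "(fst p = fst r) = (p = r)"
    proof
      assume eq: "fst p = fst r"
      obtain a b d where p: "p = (a, b)" "r = (a, d)" using eq by (cases p; cases r) auto
      then have "{a, b} = {a, d}" using is_matchingD[OF assms(1), of "{a, b}" "{a, d}" a] pr by auto
      then show "p = r" using p by (auto simp: doubleton_eq_iff)
    qed simp
  next
    fix x assume "x \<in> \<Union>S"
    then obtain e where e: "e \<in> S" "x \<in> e" by auto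
    then obtain y where "e = {x, y}" using c(1)[OF e(1)] by (auto simp: card_2_iff)
    then show "\<exists>p\<in>{(a, b). {a, b} \<in> S}. x = fst p" using e by force
  qed auto
  then show "card {(a, b). {a, b} \<in> S} = 2 * card S"
    using \<open>card (\<Union>S) = 2 * card S\<close> by (simp add: bij_betw_same_card)
qed

lemma matching_Diff:
  assumes "is_matching S" "{a, b} \<in> S" "\<Union>S \<subseteq> W"
  shows "\<Union>(S - {{a, b}}) \<subseteq> W - {a, b}"
  using assms is_matchingD[OF assms(1,2)] by blast

lemma card_linear_arrangements:
  assumes "finite W" "is_matching S" "\<Union>S \<subseteq> W"
  shows "card (arrangements (\<lambda>_ _. True) W S) = 2 ^ card S * fact (card W - card S)"
  using assms
proof (induction "card W" arbitrary: W S rule: less_induct)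
  case less
  have finS: "finite S" using less.prems by (meson finite_Union finite_UnionD finite_subset)
  show ?case
  proof (cases "W = {}")
    case True
    have "e \<notin> S" for e
    proof
      assume "e \<in> S"
      then have "e = {}" "card e = 2" using True less.prems by (auto simp: is_matching_def)
      then show False by simp
    qed
    then have "S = {}" by blast
    moreover have "arrangements (\<lambda>_ _. True) {} {} = {[]::'a list}" by (auto simp: arrangements_def)
    ultimately show ?thesis using True by simp
  next
    case False
    define w s where "w = card W" and "s = card S"
    have w: "1 \<le> w" using False less.prems by (simp add: w_def Suc_le_eq card_gt_0_iff)
    have Us: "card (\<Union>S) = 2 * s" unfolding s_def by (rule matching_vertices(1)[OF less.prems(2) finS])
    then have ws: "2 * s \<le> w" unfolding w_def using card_mono[OF less.prems(1,3)] by simp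
    have 1: "card (arrangements (\<lambda>_ _. True) (W - {a}) S) = 2 ^ s * fact (w - 1 - s)" if "a \<in> W - \<Union>S" for a
      using less.hyps[of "W - {a}" S] less.prems that w
      by (auto simp: w_def s_def card_Diff_singleton)
    have 2: "card (arrangements (\<lambda>_ _. True) (W - {a, b}) (S - {{a, b}})) = 2 ^ (s - 1) * fact (w - 1 - s)"
      if ab: "{a, b} \<in> S" for a b
    proof -
      have "card {a, b} = 2" using less.prems(2) ab by (auto simp: is_matching_def)
      moreover have "{a, b} \<subseteq> W" using ab less.prems by auto
      ultimately have cW: "card (W - {a, b}) = w - 2" using less.prems(1)
        by (simp add: card_Diff_subset w_def)
      have "card S > 0" using ab finS by (auto simp: card_gt_0_iff)
      then have s1: "1 \<le> s" by (simp add: s_def)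
      have "card (arrangements (\<lambda>_ _. True) (W - {a, b}) (S - {{a, b}}))
          = 2 ^ card (S - {{a, b}}) * fact (card (W - {a, b}) - card (S - {{a, b}}))"
        by (rule less.hyps) (use less.prems cW w is_matching_subset[OF less.prems(2)] matching_Diff[OF less.prems(2) ab less.prems(3)] in \<open>auto simp: w_def\<close>)
      then show ?thesis using ab finS s1 ws unfolding cW by (simp add: s_def)
    qed
    have "card (arrangements (\<lambda>_ _. True) W S)
        = (w - 2 * s) * (2 ^ s * fact (w - 1 - s)) + 2 * s * (2 ^ (s - 1) * fact (w - 1 - s))"
    proof -
      have "card (W - \<Union>S) = w - 2 * s"
        using less.prems Us finite_subset[OF less.prems(3,1)] by (simp add: card_Diff_subset w_def)
      then have "(\<Sum>a\<in>W - \<Union>S. card (arrangements (\<lambda>_ _. True) (W - {a}) S))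
          = (w - 2 * s) * (2 ^ s * fact (w - 1 - s))"
        using 1 by simp
      moreover have "(\<Sum>(a, b)\<in>{(a, b). {a, b} \<in> S}. card (arrangements (\<lambda>_ _. True) (W - {a, b}) (S - {{a, b}})))
          = (\<Sum>(a, b)\<in>{(a, b). {a, b} \<in> S}. 2 ^ (s - 1) * fact (w - 1 - s))"
        using 2 by (intro sum.cong) auto
      moreover have "\<dots> = 2 * s * (2 ^ (s - 1) * fact (w - 1 - s))"
        using matching_vertices(2)[OF less.prems(2) finS] by (simp add: s_def)
      moreover have "{a \<in> W - \<Union>S. True} = W - \<Union>S" "{(a, b). {a, b} \<in> S \<and> True \<and> True} = {(a, b). {a, b} \<in> S}"
        by auto
      ultimately show ?thesis
        using card_arrangements_split[OF less.prems(2,3) False less.prems(1), of "\<lambda>_ _. True"] by metis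
    qed
    also have "\<dots> = 2 ^ s * ((w - 2 * s + s) * fact (w - 1 - s))"
      by (cases s) (simp_all add: algebra_simps)
    also have "\<dots> = 2 ^ s * fact (w - s)"
    proof -
      have "w - 2 * s + s = w - s" "0 < w - s" using ws w by auto
      then show ?thesis using fact_reduce[of "w - s", where 'a = nat] by (simp add: diff_commute)
    qed
    finally show ?thesis by (simp add: w_def s_def)
  qed
qed

(*#PART B2*)
abbreviation alternating :: "'v set \<Rightarrow> nat \<Rightarrow> 'v \<Rightarrow> bool" where
  "alternating C \<equiv> \<lambda>i v. v \<in> C \<longleftrightarrow> even i"

lemma card_matching_side:
  assumes "is_matching S" "finite S" "\<And>e. e \<in> S \<Longrightarrow> card (e \<inter> C) = 1"
  shows "card (\<Union>S \<inter> C) = card S"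
proof -
  have "\<Union>S \<inter> C = (\<Union>e\<in>S. e \<inter> C)" by auto
  also have "card \<dots> = (\<Sum>e\<in>S. card (e \<inter> C))"
  proof (rule card_UN_disjoint)
    show "\<forall>e\<in>S. finite (e \<inter> C)" using assms(3) by (metis card.infinite zero_neq_one)
    show "\<forall>e\<in>S. \<forall>f\<in>S. e \<noteq> f \<longrightarrow> e \<inter> C \<inter> (f \<inter> C) = {}"
      using is_matchingD[OF assms(1)] by (metis IntD1 disjoint_iff)
  qed (rule assms)
  finally show ?thesis using assms(3) by simp
qed

lemma card_matching_oriented:
  assumes "is_matching S" "finite S" "\<And>e. e \<in> S \<Longrightarrow> card (e \<inter> C) = 1"
  shows "card {(a, b). {a, b} \<in> S \<and> a \<in> C \<and> b \<notin> C} = card S"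
proof -
  have "bij_betw (\<lambda>(a, b). {a, b}) {(a, b). {a, b} \<in> S \<and> a \<in> C \<and> b \<notin> C} S"
    unfolding bij_betw_def
  proof
    show "inj_on (\<lambda>(a, b). {a, b}) {(a, b). {a, b} \<in> S \<and> a \<in> C \<and> b \<notin> C}"
      by (auto simp: inj_on_def doubleton_eq_iff)
    show "(\<lambda>(a, b). {a, b}) ` {(a, b). {a, b} \<in> S \<and> a \<in> C \<and> b \<notin> C} = S"
    proof (intro equalityI subsetI)
      fix e assume e: "e \<in> S"
      obtain x y where xy: "e = {x, y}" "x \<noteq> y" using e assms(1) by (auto simp: is_matching_def card_2_iff)
      have "x \<in> C \<and> y \<notin> C \<or> y \<in> C \<and> x \<notin> C"
      proof (rule ccontr)
        assume "\<not> ?thesis"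
        then have "e \<inter> C = e \<or> e \<inter> C = {}" using xy by auto
        then show False using assms(3)[OF e] xy by auto
      qed
      then show "e \<in> (\<lambda>(a, b). {a, b}) ` {(a, b). {a, b} \<in> S \<and> a \<in> C \<and> b \<notin> C}"
      proof
        assume "x \<in> C \<and> y \<notin> C"
        then show ?thesis using e xy by (intro image_eqI[of _ _ "(x, y)"]) auto
      next
        assume "y \<in> C \<and> x \<notin> C"
        then show ?thesis using e xy by (intro image_eqI[of _ _ "(y, x)"]) (auto simp: insert_commute)
      qed
    qed auto
  qed
  then show ?thesis by (rule bij_betw_same_card)
qed

lemma card_alternating_arrangements:
  assumes "finite W" "is_matching S" "\<Union>S \<subseteq> W" "\<And>e. e \<in> S \<Longrightarrow> card (e \<inter> C) = 1"
    and "card (W \<inter> C) = x + card S" "card (W - C) = y + card S" "x = y \<or> x = y + 1"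
  shows "real (card (arrangements (alternating C) W S))
    = fact (card S + x + y) * fact x * fact y / fact (x + y)"
  using assms
proof (induction "card W" arbitrary: W S C x y rule: less_induct)
  case less
  note W = less.prems(1) and S = less.prems(2) and SW = less.prems(3) and side = less.prems(4)
    and cC = less.prems(5) and cD = less.prems(6) and xy = less.prems(7)
  have finS: "finite S" using W SW by (meson finite_UnionD finite_subset)
  show ?case
  proof (cases "W = {}")
    case True
    then have "card S = 0" "x = 0" "y = 0" using cC cD by auto
    moreover from this have "S = {}" using finS by simp
    moreover have "arrangements (alternating C) {} {} = {[]}" by (auto simp: arrangements_def)
    ultimately show ?thesis using True by simp
  next
    case False
    define s where "s = card S"
    have sub: "W - {a} \<subseteq> W" "card (W - {a}) < card W" if "a \<in> W" for a
      using card_Diff1_less[OF W that] by auto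
    have shift: "(\<lambda>i v. (v \<in> C) = even (Suc i)) = alternating (- C)"
      "(\<lambda>i v. (v \<in> C) = even (Suc (Suc i))) = alternating C" by auto
    have side': "card (e \<inter> - C) = 1" if "e \<in> S" for e
    proof -
      have "card e = 2" using S that by (auto simp: is_matching_def)
      moreover from this have "finite e" using card_gt_0_iff[of e] by simp
      moreover from this have "card e = card (e \<inter> C) + card (e - C)" by (rule card_Int_Diff[symmetric, THEN sym])
      moreover have "e \<inter> - C = e - C" by auto
      ultimately show ?thesis using side[OF that] by simp
    qed
    define A1 where "A1 = {a \<in> W - \<Union>S. a \<in> C}"
    define A2 where "A2 = {(a, b). {a, b} \<in> S \<and> a \<in> C \<and> b \<notin> C}"
    have cA1: "card A1 = x"
    proof -
      have "A1 = (W \<inter> C) - (\<Union>S \<inter> C)" by (auto simp: A1_def)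
      moreover have "card ((W \<inter> C) - (\<Union>S \<inter> C)) = card (W \<inter> C) - card (\<Union>S \<inter> C)"
        using W SW by (intro card_Diff_subset) (auto intro: finite_subset)
      ultimately show ?thesis using card_matching_side[OF S finS side] cC by simp
    qed
    have cA2: "card A2 = s" unfolding A2_def s_def by (rule card_matching_oriented[OF S finS side])
    have 1: "real (card (arrangements (alternating (- C)) (W - {a}) S))
        = fact (s + y + (x - 1)) * fact y * fact (x - 1) / fact (y + (x - 1))" if a: "a \<in> A1" for a
    proof -
      have aW: "a \<in> W" "a \<in> C" "a \<notin> \<Union>S" using a by (auto simp: A1_def)
      have x1: "1 \<le> x" using a cA1 W by (metis A1_def One_nat_def Suc_leI card_gt_0_iff empty_iff finite_Diff finite_subset mem_Collect_eq subsetI)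
      have e1: "(W - {a}) \<inter> - C = W - C" "W - {a} - - C = W \<inter> C - {a}" using aW by auto
      have "card (W \<inter> C - {a}) = card (W \<inter> C) - 1" using aW W by (simp add: card_Diff_singleton)
      then show ?thesis unfolding s_def
        by (intro less.hyps) (use sub[OF aW(1)] W S SW aW side' cC cD xy x1 e1 in auto)
    qed
    have 2: "real (card (arrangements (alternating C) (W - {a, b}) (S - {{a, b}})))
        = fact (s - 1 + x + y) * fact x * fact y / fact (x + y)" if ab: "(a, b) \<in> A2" for a b
    proof -
      have abS: "{a, b} \<in> S" "a \<in> C" "b \<notin> C" "a \<in> W" "b \<in> W" using ab SW by (auto simp: A2_def)
      have s1: "card S \<ge> 1" using abS finS by (metis One_nat_def Suc_leI card_gt_0_iff empty_iff)
      have e1: "(W - {a, b}) \<inter> C = W \<inter> C - {a}" "W - {a, b} - C = W - C - {b}" using abS by auto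
      have c1: "card (W \<inter> C - {a}) = card (W \<inter> C) - 1" "card (W - C - {b}) = card (W - C) - 1"
        using abS W by (simp_all add: card_Diff_singleton)
      have cS: "card (S - {{a, b}}) = s - 1" using abS finS by (simp add: s_def)
      have lt: "card (W - {a, b}) < card W" using abS W by (intro psubset_card_mono) auto
      have "real (card (arrangements (alternating C) (W - {a, b}) (S - {{a, b}})))
          = fact (card (S - {{a, b}}) + x + y) * fact x * fact y / fact (x + y)"
      proof (rule less.hyps[OF lt])
        show "\<Union>(S - {{a, b}}) \<subseteq> W - {a, b}" by (rule matching_Diff[OF S abS(1) SW])
        show "is_matching (S - {{a, b}})" by (rule is_matching_subset[OF S]) auto
      qed (use W side xy cC cD cS s1 s_def e1 c1 in auto)
      then show ?thesis unfolding cS .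
    qed
    have idx: "{a \<in> W - \<Union>S. (a \<in> C) = even (0::nat)} = A1"
      "{(a, b). {a, b} \<in> S \<and> (a \<in> C) = even (0::nat) \<and> (b \<in> C) = even (1::nat)} = A2"
      by (auto simp: A1_def A2_def)
    have "real (card (arrangements (alternating C) W S))
        = (\<Sum>a\<in>A1. real (card (arrangements (alternating (- C)) (W - {a}) S)))
          + (\<Sum>(a, b)\<in>A2. real (card (arrangements (alternating C) (W - {a, b}) (S - {{a, b}}))))"
      unfolding card_arrangements_split[OF S SW False W] shift idx by (simp add: case_prod_unfold)
    also have "(\<Sum>a\<in>A1. real (card (arrangements (alternating (- C)) (W - {a}) S)))
        = real x * (fact (s + y + (x - 1)) * fact y * fact (x - 1) / fact (y + (x - 1)))"
      using 1 cA1 by simp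
    also have "(\<Sum>(a, b)\<in>A2. real (card (arrangements (alternating C) (W - {a, b}) (S - {{a, b}}))))
        = (\<Sum>(a, b)\<in>A2. fact (s - 1 + x + y) * fact x * fact y / fact (x + y))"
      using 2 by (intro sum.cong) auto
    also have "\<dots> = real s * (fact (s - 1 + x + y) * fact x * fact y / fact (x + y))"
      using cA2 by simp
    also have "real x * (fact (s + y + (x - 1)) * fact y * fact (x - 1) / fact (y + (x - 1)))
        + real s * (fact (s - 1 + x + y) * fact x * fact y / fact (x + y))
        = fact (s + x + y) * fact x * fact y / fact (x + y)"
    proof (cases x)
      case 0
      then have y: "y = 0" using xy by simp
      have "s \<noteq> 0"
      proof
        assume "s = 0"
        then have "card (W \<inter> C) = 0" "card (W - C) = 0" using cC cD 0 y by (auto simp: s_def)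
        then have "W \<inter> C = {}" "W - C = {}" using W by auto
        then show False using False by auto
      qed
      then show ?thesis using 0 y by (cases s) auto
    next
      case (Suc t)
      have e1: "real s * (fact (s - 1 + Suc t + y) * u * v / w) = real s * fact (s + t + y) * u * v / w" for u v w :: real
        by (cases s) auto
      have e2: "fact (s + Suc t + y) = (real s + real (Suc (t + y))) * fact (s + t + y)" by simp
      have e3: "fact (Suc t + y) = real (Suc (t + y)) * fact (t + y)" by simp
      have e4: "Suc t - 1 = t" "s + y + t = s + t + y" "y + t = t + y" by simp_all
      have e: "T * (F * Y * A / Q) + S * F * (T * A) * Y / (P * Q) = (S + P) * F * (T * A) * Y / (P * Q)"
        if "P \<noteq> 0" "Q \<noteq> 0" for T F Y A S P Q :: real
        using that by (simp add: field_simps)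
      show ?thesis unfolding Suc e4 e1 e2 e3 fact_Suc[of t] by (rule e) auto
    qed
    finally show ?thesis unfolding s_def .
  qed
qed


lemma path_edges_snoc: "xs \<noteq> [] \<Longrightarrow> path_edges (xs @ [x]) = insert {last xs, x} (path_edges xs)"
  by (induction xs rule: path_edges.induct) auto

lemma path_edges_nth: "path_edges vs = (\<lambda>i. {vs ! i, vs ! Suc i}) ` {i. Suc i < length vs}"
proof (induction vs rule: path_edges.induct)
  case (1 x y zs)
  have "{i. Suc i < length (x # y # zs)} = insert 0 (Suc ` {i. Suc i < length (y # zs)})"
    by (auto simp: image_iff) (metis Suc_less_eq not0_implies_Suc)
  then show ?case using 1 by (simp add: image_image)
qed auto

lemma cycle_edges_path:
  assumes "vs \<noteq> []"
  shows "cycle_edges vs = insert {last vs, hd vs} (path_edges vs)"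
proof -
  define m where "m = length vs - 1"
  have len: "length vs = Suc m" using assms by (simp add: m_def)
  have "cycle_edges vs = (\<lambda>i. {vs ! i, vs ! ((i + 1) mod length vs)}) ` {..<Suc m}"
    unfolding cycle_edges_def len by auto
  also have "{..<Suc m} = insert m {i. Suc i < length vs}" by (auto simp: len)
  also have "(\<lambda>i. {vs ! i, vs ! ((i + 1) mod length vs)}) ` \<dots>
      = insert {vs ! m, vs ! 0} ((\<lambda>i. {vs ! i, vs ! Suc i}) ` {i. Suc i < length vs})"
    by (simp add: len)
  finally show ?thesis
    using assms by (simp add: path_edges_nth last_conv_nth hd_conv_nth len)
qed

lemma cycle_edges_rotate1: "cycle_edges (rotate1 vs) = cycle_edges vs"
proof (cases vs)
  case (Cons x xs)
  show ?thesis
  proof (cases "xs = []")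
    case False
    then have "path_edges (x # xs) = insert {x, hd xs} (path_edges xs)" by (cases xs) auto
    then show ?thesis using False unfolding Cons
      by (simp add: cycle_edges_path path_edges_snoc insert_commute)
  qed (simp add: Cons)
qed simp

lemma cycle_edges_rotate: "cycle_edges (rotate t vs) = cycle_edges vs"
  by (induction t) (simp_all add: cycle_edges_rotate1)

lemma cycle_edges_map: "cycle_edges (map \<sigma> vs) = (`) \<sigma> ` cycle_edges vs"
proof -
  have img: "cycle_edges ws = (\<lambda>i. {ws ! i, ws ! ((i + 1) mod length ws)}) ` {..<length ws}" for ws :: "'z list"
    unfolding cycle_edges_def by auto
  have "cycle_edges vs = (\<lambda>i. {vs ! i, vs ! ((i + 1) mod length vs)}) ` {..<length vs}"
    unfolding cycle_edges_def by auto
  then have "(`) \<sigma> ` cycle_edges vs = (\<lambda>i. \<sigma> ` {vs ! i, vs ! ((i + 1) mod length vs)}) ` {..<length vs}"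
    by (simp only: image_image)
  also have "\<dots> = (\<lambda>i. {map \<sigma> vs ! i, map \<sigma> vs ! ((i + 1) mod length vs)}) ` {..<length vs}"
  proof (rule image_cong[OF refl])
    fix i assume "i \<in> {..<length vs}"
    then have "i < length vs" "(i + 1) mod length vs < length vs" by (auto intro: mod_less_divisor)
    then show "\<sigma> ` {vs ! i, vs ! ((i + 1) mod length vs)} = {map \<sigma> vs ! i, map \<sigma> vs ! ((i + 1) mod length vs)}"
      by simp
  qed
  finally show ?thesis unfolding img[of "map \<sigma> vs"] length_map ..
qed

definition enumerations :: "'v::finite set set \<Rightarrow> 'v list set" where
  "enumerations E = {vs. distinct vs \<and> set vs = UNIV \<and> cycle_edges vs \<subseteq> E}"

lemma enumerations_length: "vs \<in> enumerations E \<Longrightarrow> length vs = CARD('v)" for E :: "'v::finite set set"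
  unfolding enumerations_def using distinct_card[of vs] by auto

lemma finite_enumerations: "finite (enumerations E)" for E :: "'v::finite set set"
proof -
  have "enumerations E \<subseteq> {vs. set vs \<subseteq> UNIV \<and> length vs = CARD('v)}"
    by (simp add: subset_iff enumerations_length)
  then show ?thesis by (rule finite_subset) (rule finite_lists_length_eq[OF finite])
qed

lemma ham_cycles_eq_image:
  fixes E :: "'v::finite set set"
  assumes "3 \<le> CARD('v)"
  shows "ham_cycles E = cycle_edges ` enumerations E"
proof (intro equalityI subsetI)
  fix c assume "c \<in> ham_cycles E"
  then obtain vs where vs: "c \<subseteq> E" "distinct vs" "set vs = UNIV" "c = cycle_edges vs"
    unfolding ham_cycles_def cycle_edges_def by auto
  then have "vs \<in> enumerations E" by (simp add: enumerations_def)
  then show "c \<in> cycle_edges ` enumerations E" using vs by auto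
next
  fix c assume "c \<in> cycle_edges ` enumerations E"
  then obtain vs where vs: "vs \<in> enumerations E" "c = cycle_edges vs" by auto
  have "length vs \<ge> 3" using enumerations_length[OF vs(1)] assms by simp
  moreover have "distinct vs" "set vs = UNIV" "c \<subseteq> E" using vs by (auto simp: enumerations_def)
  ultimately show "c \<in> ham_cycles E"
    unfolding ham_cycles_def using vs(2)[unfolded cycle_edges_def] by blast
qed

lemma enumerations_rotate: "vs \<in> enumerations E \<Longrightarrow> rotate t vs \<in> enumerations E"
  by (simp add: enumerations_def cycle_edges_rotate)

lemma card_enumerations_position:
  fixes E :: "'v::finite set set"
  assumes t: "t < CARD('v)" and two: "2 \<le> CARD('v)"
  shows "card {vs \<in> enumerations E. S \<subseteq> cycle_edges vs \<and> vs ! t = c \<and> vs ! ((t + 1) mod CARD('v)) = d}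
    = card {vs \<in> enumerations E. S \<subseteq> cycle_edges vs \<and> vs ! 0 = c \<and> vs ! 1 = d}"
proof -
  define N where "N = CARD('v)"
  have len: "length vs = N" if "vs \<in> enumerations E" for vs
    using enumerations_length[OF that] by (simp add: N_def)
  have full: "rotate N vs = vs" if "vs \<in> enumerations E" for vs
    using len[OF that] by (metis rotate_id mod_self)
  show ?thesis
  proof (rule bij_betw_same_card[OF bij_betw_byWitness[where f = "rotate t" and f' = "rotate (N - t)"]])
    show "\<forall>vs\<in>{vs \<in> enumerations E. S \<subseteq> cycle_edges vs \<and> vs ! t = c \<and> vs ! ((t + 1) mod CARD('v)) = d}.
        rotate (N - t) (rotate t vs) = vs"
      using full t by (simp add: rotate_rotate N_def)
    show "\<forall>vs\<in>{vs \<in> enumerations E. S \<subseteq> cycle_edges vs \<and> vs ! 0 = c \<and> vs ! 1 = d}.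
        rotate t (rotate (N - t) vs) = vs"
      using full t by (simp add: rotate_rotate N_def)
    show "rotate t ` {vs \<in> enumerations E. S \<subseteq> cycle_edges vs \<and> vs ! t = c \<and> vs ! ((t + 1) mod CARD('v)) = d}
        \<subseteq> {vs \<in> enumerations E. S \<subseteq> cycle_edges vs \<and> vs ! 0 = c \<and> vs ! 1 = d}"
      using len t two by (auto simp: enumerations_rotate cycle_edges_rotate nth_rotate N_def)
    show "rotate (N - t) ` {vs \<in> enumerations E. S \<subseteq> cycle_edges vs \<and> vs ! 0 = c \<and> vs ! 1 = d}
        \<subseteq> {vs \<in> enumerations E. S \<subseteq> cycle_edges vs \<and> vs ! t = c \<and> vs ! ((t + 1) mod CARD('v)) = d}"
    proof clarsimp
      fix vs assume vs: "vs \<in> enumerations E" "S \<subseteq> cycle_edges vs" 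
      have l: "length vs = N" by (rule len[OF vs(1)])
      have "(N - t + (t + 1) mod N) mod N = (N - t + (t + 1)) mod N" by (simp add: mod_simps)
      also have "N - t + (t + 1) = N + 1" using t by (simp add: N_def)
      also have "(N + 1) mod N = 1 mod N" by (rule mod_add_self1)
      also have "\<dots> = 1" using two unfolding N_def by (intro mod_less) linarith
      finally have "(N - t + (t + 1) mod N) mod N = 1" .
      moreover have "(N - t + t) mod N = 0" using t by (simp add: N_def)
      ultimately show "rotate (N - t) vs \<in> enumerations E \<and> S \<subseteq> cycle_edges (rotate (N - t) vs) \<and>
          rotate (N - t) vs ! t = vs ! 0 \<and> rotate (N - t) vs ! (Suc t mod CARD('v)) = vs ! Suc 0"
        using vs l t two by (simp add: enumerations_rotate cycle_edges_rotate nth_rotate N_def)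
    qed
  qed
qed

lemma card_enumerations_containing:
  fixes E :: "'v::finite set set"
  assumes three: "3 \<le> CARD('v)" and cd: "{c, d} \<in> S" "c \<noteq> d"
  defines "R \<equiv> \<lambda>c d. card {vs \<in> enumerations E. S \<subseteq> cycle_edges vs \<and> vs ! 0 = c \<and> vs ! 1 = d}"
  shows "card {vs \<in> enumerations E. S \<subseteq> cycle_edges vs} = CARD('v) * (R c d + R d c)"
proof -
  define N where "N = CARD('v)"
  define A where "A t a b = {vs \<in> enumerations E. S \<subseteq> cycle_edges vs \<and> vs ! t = a \<and> vs ! ((t + 1) mod N) = b}" for t a b
  have fin: "finite (A t a b)" for t a b
    unfolding A_def using finite_enumerations[of E] by simp
  have cA: "card (A t a b) = R a b" if "t < N" for t a b
    using card_enumerations_position[of t E S a b] that three by (simp add: A_def R_def N_def)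
  have uniq: "t = t'" if "vs \<in> enumerations E" "t < N" "t' < N" "vs ! t = vs ! t'" for vs t t'
    using that enumerations_length[OF that(1)] nth_eq_iff_index_eq[of vs t t'] by (auto simp: enumerations_def N_def)
  have nt: "(t + 1) mod N < N" for t using three by (simp add: N_def)
  have cross: "A t c d \<inter> A t' d c = {}" if "t < N" "t' < N" for t t'
  proof (rule ccontr)
    assume "A t c d \<inter> A t' d c \<noteq> {}"
    then obtain vs where vs: "vs \<in> A t c d" "vs \<in> A t' d c" by auto
    then have e: "vs \<in> enumerations E" "vs ! ((t + 1) mod N) = vs ! t'" "vs ! ((t' + 1) mod N) = vs ! t"
      by (auto simp: A_def)
    have "(t + 1) mod N = t'" "(t' + 1) mod N = t"
      using uniq[OF e(1) nt that(2) e(2)] uniq[OF e(1) nt that(1) e(3)] by auto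
    then show False using that three by (auto simp: N_def mod_Suc split: if_splits)
  qed
  have same: "A t a b \<inter> A t' a b = {}" if "t < N" "t' < N" "t \<noteq> t'" for t t' a b
    using uniq[OF _ that(2,1)] that(3) by (auto simp: A_def)
  have "{vs \<in> enumerations E. S \<subseteq> cycle_edges vs} = (\<Union>t\<in>{..<N}. A t c d \<union> A t d c)"
  proof (intro equalityI subsetI)
    fix vs assume vs: "vs \<in> {vs \<in> enumerations E. S \<subseteq> cycle_edges vs}"
    then have "{c, d} \<in> cycle_edges vs" and l: "length vs = N" using cd enumerations_length by (auto simp: N_def)
    then obtain t where t: "t < N" "{c, d} = {vs ! t, vs ! ((t + 1) mod N)}"
      unfolding cycle_edges_def by auto
    then have "vs \<in> A t c d \<union> A t d c" using vs by (auto simp: A_def doubleton_eq_iff)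
    then show "vs \<in> (\<Union>t\<in>{..<N}. A t c d \<union> A t d c)" using t(1) by auto
  qed (auto simp: A_def)
  also have "card \<dots> = (\<Sum>t<N. card (A t c d \<union> A t d c))"
  proof (rule card_UN_disjoint)
    show "\<forall>t\<in>{..<N}. \<forall>t'\<in>{..<N}. t \<noteq> t' \<longrightarrow> (A t c d \<union> A t d c) \<inter> (A t' c d \<union> A t' d c) = {}"
    proof (intro ballI impI)
      fix t t' assume t: "t \<in> {..<N}" "t' \<in> {..<N}" "t \<noteq> t'"
      have "A t c d \<inter> A t' c d = {}" "A t d c \<inter> A t' d c = {}" using same t by simp_all
      moreover have "A t c d \<inter> A t' d c = {}" "A t' c d \<inter> A t d c = {}" using cross t by simp_all
      ultimately show "(A t c d \<union> A t d c) \<inter> (A t' c d \<union> A t' d c) = {}" by blast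
    qed
  qed (use fin in auto)
  also have "\<dots> = (\<Sum>t<N. R c d + R d c)"
    using fin cross cA by (intro sum.cong refl) (simp add: card_Un_disjoint)
  finally show ?thesis by (simp add: N_def)
qed

(*#PART B3*)
lemma matching_cons_cons:
  assumes "is_matching S" "{c, d} \<in> S"
  shows "S \<subseteq> cycle_edges (c # d # ws) \<longleftrightarrow> S - {{c, d}} \<subseteq> path_edges ws"
proof -
  have c: "cycle_edges (c # d # ws) = insert {last (d # ws), c} (insert {c, d} (path_edges (d # ws)))"
    by (simp add: cycle_edges_path)
  have "f \<in> cycle_edges (c # d # ws) \<longleftrightarrow> f \<in> path_edges ws" if f: "f \<in> S - {{c, d}}" for f
  proof -
    have "c \<notin> f" "d \<notin> f" using is_matchingD[OF assms, of f] f by auto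
    then show ?thesis unfolding c by (cases ws) auto
  qed
  moreover have "{c, d} \<in> cycle_edges (c # d # ws)" unfolding c by simp
  ultimately show ?thesis by auto
qed

lemma card_enumerations_start:
  fixes E :: "'v::finite set set"
  assumes S: "is_matching S" "{c, d} \<in> S" and three: "3 \<le> CARD('v)"
    and P: "\<And>ws. distinct ws \<Longrightarrow> set ws = UNIV - {c, d} \<Longrightarrow>
        cycle_edges (c # d # ws) \<subseteq> E \<longleftrightarrow> (\<forall>i<length ws. P i (ws ! i))"
  shows "card {vs \<in> enumerations E. S \<subseteq> cycle_edges vs \<and> vs ! 0 = c \<and> vs ! 1 = d}
    = card (arrangements P (UNIV - {c, d}) (S - {{c, d}}))"
proof -
  have cd: "c \<noteq> d" using S by (auto simp: is_matching_def)
  have in_enum: "c # d # ws \<in> enumerations E \<longleftrightarrow>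
      distinct ws \<and> set ws = UNIV - {c, d} \<and> (\<forall>i<length ws. P i (ws ! i))" for ws
  proof -
    have "distinct (c # d # ws) \<and> set (c # d # ws) = UNIV \<longleftrightarrow> distinct ws \<and> set ws = UNIV - {c, d}"
      using cd by auto
    then show ?thesis using P[of ws] unfolding enumerations_def by blast
  qed
  have "{vs \<in> enumerations E. S \<subseteq> cycle_edges vs \<and> vs ! 0 = c \<and> vs ! 1 = d}
      = (\<lambda>ws. c # d # ws) ` arrangements P (UNIV - {c, d}) (S - {{c, d}})"
  proof (intro equalityI subsetI)
    fix vs assume vs: "vs \<in> {vs \<in> enumerations E. S \<subseteq> cycle_edges vs \<and> vs ! 0 = c \<and> vs ! 1 = d}"
    then have "length vs \<ge> 3" using enumerations_length[of vs E] three by simp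
    then obtain a b ws where "vs = a # b # ws" by (cases vs rule: path_edges.cases) auto
    then have v: "vs = c # d # ws" using vs by simp
    have "ws \<in> arrangements P (UNIV - {c, d}) (S - {{c, d}})"
      using vs in_enum[of ws] matching_cons_cons[OF S, of ws] unfolding v arrangements_def by blast
    then show "vs \<in> (\<lambda>ws. c # d # ws) ` arrangements P (UNIV - {c, d}) (S - {{c, d}})" unfolding v by blast
  next
    fix vs assume "vs \<in> (\<lambda>ws. c # d # ws) ` arrangements P (UNIV - {c, d}) (S - {{c, d}})"
    then obtain ws where "vs = c # d # ws" "ws \<in> arrangements P (UNIV - {c, d}) (S - {{c, d}})" by blast
    then show "vs \<in> {vs \<in> enumerations E. S \<subseteq> cycle_edges vs \<and> vs ! 0 = c \<and> vs ! 1 = d}"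
      using in_enum[of ws] matching_cons_cons[OF S, of ws] by (simp add: arrangements_def)
  qed
  then show ?thesis by (simp add: card_image inj_on_def)
qed

lemma constant_fibres:
  fixes E :: "'v::finite set set"
  assumes three: "3 \<le> CARD('v)" and ne: "enumerations E \<noteq> {}"
    and trans: "\<And>vs vs'. vs \<in> enumerations E \<Longrightarrow> vs' \<in> enumerations E \<Longrightarrow>
      \<exists>\<sigma>. bij \<sigma> \<and> (\<lambda>e. \<sigma> ` e) ` E \<subseteq> E \<and> cycle_edges (map \<sigma> vs) = cycle_edges vs'"
  shows "\<exists>\<phi>>0. \<forall>S. card {vs \<in> enumerations E. S \<subseteq> cycle_edges vs} = \<phi> * card {u \<in> ham_cycles E. S \<subseteq> u}"
proof -
  define F where "F u = {vs \<in> enumerations E. cycle_edges vs = u}" for u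
  have fin: "finite (F u)" for u using finite_enumerations[of E] by (simp add: F_def)
  have le: "card (F u) \<le> card (F u')" if u: "u \<in> ham_cycles E" "u' \<in> ham_cycles E" for u u'
  proof -
    obtain vs vs' where v: "vs \<in> enumerations E" "u = cycle_edges vs" "vs' \<in> enumerations E" "u' = cycle_edges vs'"
      using u unfolding ham_cycles_eq_image[OF three] by blast
    obtain \<sigma> where s: "bij \<sigma>" "(\<lambda>e. \<sigma> ` e) ` E \<subseteq> E" "cycle_edges (map \<sigma> vs) = cycle_edges vs'"
      using trans[OF v(1,3)] by blast
    have "map \<sigma> ` F u \<subseteq> F u'"
    proof (rule image_subsetI)
      fix ws assume ws: "ws \<in> F u"
      have "cycle_edges (map \<sigma> ws) = cycle_edges (map \<sigma> vs)"
        using ws v by (simp add: F_def cycle_edges_map)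
      then have c: "cycle_edges (map \<sigma> ws) = u'" using s v by simp
      have "u' \<subseteq> E" using v by (simp add: enumerations_def)
      moreover have "distinct (map \<sigma> ws)" "set (map \<sigma> ws) = UNIV"
        using ws s(1) by (auto simp: F_def enumerations_def distinct_map bij_def inj_on_def)
      ultimately show "map \<sigma> ws \<in> F u'" using c by (simp add: F_def enumerations_def)
    qed
    moreover have "inj_on (map \<sigma>) (F u)"
      using s(1) by (meson bij_def inj_mapI inj_on_subset subset_UNIV)
    ultimately show ?thesis using fin by (meson card_inj_on_le)
  qed
  obtain u0 where u0: "u0 \<in> ham_cycles E" using ne unfolding ham_cycles_eq_image[OF three] by blast
  have const: "card (F u) = card (F u0)" if "u \<in> ham_cycles E" for u
    using le[OF that u0] le[OF u0 that] by simp
  have "F u0 \<noteq> {}" using u0 unfolding ham_cycles_eq_image[OF three] F_def by blast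
  then have pos: "0 < card (F u0)" using fin by (simp add: card_gt_0_iff)
  have "card {vs \<in> enumerations E. S \<subseteq> cycle_edges vs} = card (F u0) * card {u \<in> ham_cycles E. S \<subseteq> u}" for S
  proof -
    have "{vs \<in> enumerations E. S \<subseteq> cycle_edges vs} = (\<Union>u\<in>{u \<in> ham_cycles E. S \<subseteq> u}. F u)"
      unfolding ham_cycles_eq_image[OF three] F_def by blast
    also have "card \<dots> = (\<Sum>u\<in>{u \<in> ham_cycles E. S \<subseteq> u}. card (F u))"
      using fin by (intro card_UN_disjoint) (auto simp: F_def)
    also have "\<dots> = card (F u0) * card {u \<in> ham_cycles E. S \<subseteq> u}"
      using const by simp
    finally show ?thesis .
  qed
  then show ?thesis using pos by blast
qed

lemma list_relabelling:
  fixes vs vs' :: "'v list"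
  assumes "distinct vs" "set vs = UNIV" "distinct vs'" "set vs' = UNIV" "length vs = length vs'"
  shows "\<exists>\<sigma>. bij \<sigma> \<and> map \<sigma> vs = vs'"
proof -
  have b: "bij_betw ((!) vs) {..<length vs} UNIV" "bij_betw ((!) vs') {..<length vs} UNIV"
    using bij_betw_nth[of vs] bij_betw_nth[of vs'] assms by auto
  define \<sigma> where "\<sigma> = (!) vs' \<circ> inv_into {..<length vs} ((!) vs)"
  have "bij \<sigma>" unfolding \<sigma>_def
    by (rule bij_betw_trans[OF bij_betw_inv_into[OF b(1)] b(2)])
  moreover have "map \<sigma> vs = vs'"
  proof (rule nth_equalityI)
    fix i assume "i < length (map \<sigma> vs)"
    then show "map \<sigma> vs ! i = vs' ! i"
      using bij_betw_inv_into_left[OF b(1), of i] by (simp add: \<sigma>_def)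
  qed (use assms in simp)
  ultimately show ?thesis by blast
qed


lemma enumerations_relabelling:
  assumes "vs \<in> enumerations E" "vs' \<in> enumerations E"
  obtains \<sigma> where "bij \<sigma>" "map \<sigma> vs = vs'"
proof -
  have "distinct vs" "set vs = UNIV" "distinct vs'" "set vs' = UNIV"
    using assms by (simp_all add: enumerations_def)
  moreover have "length vs = length vs'"
    using enumerations_length[OF assms(1)] enumerations_length[OF assms(2)] by simp
  ultimately show thesis using list_relabelling[of vs vs'] that by metis
qed

lemma is_matchingE:
  assumes "is_matching S" "e \<in> S"
  obtains x y where "e = {x, y}" "x \<noteq> y"
proof -
  have "card e = 2" using assms by (simp add: is_matching_def)
  then show thesis using that by (auto simp: card_2_iff)
qed

lemma containing_count_from_start:
  fixes E :: "'v::finite set set"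
  assumes three: "3 \<le> CARD('v)" and S: "is_matching S" "S \<noteq> {}"
    and start: "\<And>c d. {c, d} \<in> S \<Longrightarrow>
      real (card {vs \<in> enumerations E. S \<subseteq> cycle_edges vs \<and> vs ! 0 = c \<and> vs ! 1 = d}) = r"
  shows "real (card {vs \<in> enumerations E. S \<subseteq> cycle_edges vs}) = real CARD('v) * (2 * r)"
proof -
  obtain e where e: "e \<in> S" using S by auto
  obtain c d where "e = {c, d}" "c \<noteq> d" by (rule is_matchingE[OF S(1) e])
  then have cd: "{c, d} \<in> S" "c \<noteq> d" using e by simp_all
  then have dc: "{d, c} \<in> S" by (simp add: insert_commute)
  show ?thesis
    using card_enumerations_containing[OF three cd, of E] start[OF cd(1)] start[OF dc] by simp
qed

lemma proportional_counts:
  fixes E :: "'v::finite set set" and r :: "nat \<Rightarrow> real"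
  assumes three: "3 \<le> CARD('v)"
    and trans: "\<And>vs vs'. vs \<in> enumerations E \<Longrightarrow> vs' \<in> enumerations E \<Longrightarrow>
      \<exists>\<sigma>. bij \<sigma> \<and> (\<lambda>e. \<sigma> ` e) ` E \<subseteq> E \<and> cycle_edges (map \<sigma> vs) = cycle_edges vs'"
    and e: "e \<in> E" "card e = 2"
    and count: "\<And>S c d. is_matching S \<Longrightarrow> S \<subseteq> E \<Longrightarrow> {c, d} \<in> S \<Longrightarrow>
      real (card {vs \<in> enumerations E. S \<subseteq> cycle_edges vs \<and> vs ! 0 = c \<and> vs ! 1 = d}) = r (card S)"
    and pos: "0 < r 1"
  shows "\<exists>\<kappa>>0. \<forall>S. is_matching S \<and> S \<subseteq> E \<and> S \<noteq> {} \<longrightarrow>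
    real (card {u \<in> ham_cycles E. S \<subseteq> u}) = \<kappa> * r (card S)"
proof -
  have cnt: "real (card {vs \<in> enumerations E. S \<subseteq> cycle_edges vs}) = real CARD('v) * (2 * r (card S))"
    if "is_matching S" "S \<subseteq> E" "S \<noteq> {}" for S
    using containing_count_from_start[OF three that(1,3)] count[OF that(1,2)] by simp
  have "is_matching {e}" using e by (simp add: is_matching_def)
  then have "real (card {vs \<in> enumerations E. {e} \<subseteq> cycle_edges vs}) = real CARD('v) * (2 * r 1)"
    using cnt[of "{e}"] e by simp
  also have "\<dots> > 0" using pos by simp
  finally have "{vs \<in> enumerations E. {e} \<subseteq> cycle_edges vs} \<noteq> {}"
    unfolding of_nat_0_less_iff card_gt_0_iff by (rule conjunct1)
  then have "enumerations E \<noteq> {}" by blast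
  from constant_fibres[OF three this trans] obtain \<phi> where \<phi>: "\<phi> > 0"
    "\<And>S. card {vs \<in> enumerations E. S \<subseteq> cycle_edges vs} = \<phi> * card {u \<in> ham_cycles E. S \<subseteq> u}" by blast
  show ?thesis
  proof (intro exI[of _ "real CARD('v) * 2 / real \<phi>"] conjI allI impI)
    fix S assume S: "is_matching S \<and> S \<subseteq> E \<and> S \<noteq> {}"
    then have "real \<phi> * real (card {u \<in> ham_cycles E. S \<subseteq> u}) = real CARD('v) * (2 * r (card S))"
      using cnt[of S] \<phi>(2)[of S] by simp
    then show "real (card {u \<in> ham_cycles E. S \<subseteq> u}) = real CARD('v) * 2 / real \<phi> * r (card S)"
      using \<phi>(1) by (simp add: field_simps)
  qed (use \<phi>(1) in simp)
qed

lemma complete_edge_iff: "{x, y} \<in> complete_edges \<longleftrightarrow> x \<noteq> y"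
  unfolding complete_edges_def by (auto simp: doubleton_eq_iff)

lemma cycle_edges_complete:
  assumes "distinct vs" "2 \<le> length vs"
  shows "cycle_edges vs \<subseteq> complete_edges"
proof
  fix e assume "e \<in> cycle_edges vs"
  then obtain i where i: "i < length vs" "e = {vs ! i, vs ! ((i + 1) mod length vs)}"
    unfolding cycle_edges_def by blast
  have "(i + 1) mod length vs \<noteq> i" "(i + 1) mod length vs < length vs"
    using assms(2) i(1) by (auto simp: mod_Suc)
  then have "vs ! i \<noteq> vs ! ((i + 1) mod length vs)"
    using assms(1) i(1) by (metis nth_eq_iff_index_eq)
  then show "e \<in> complete_edges" unfolding i(2) complete_edge_iff .
qed

lemma complete_count:
  assumes three: "3 \<le> CARD('v::finite)"
  shows "\<exists>\<kappa>>0. \<forall>S. is_matching S \<and> S \<subseteq> (complete_edges :: 'v set set) \<and> S \<noteq> {} \<longrightarrow>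
    real (card {u \<in> ham_cycles complete_edges. S \<subseteq> u}) = \<kappa> * (2 ^ card S * fact (CARD('v) - card S - 1))"
proof -
  define r :: "nat \<Rightarrow> real" where "r s = 2 ^ (s - 1) * fact (CARD('v) - s - 1)" for s
  obtain x y :: 'v where xy: "x \<noteq> y"
    using three card_le_Suc0_iff_eq[of "UNIV :: 'v set"] by auto
  have "\<exists>\<kappa>>0. \<forall>S. is_matching S \<and> S \<subseteq> (complete_edges :: 'v set set) \<and> S \<noteq> {} \<longrightarrow>
    real (card {u \<in> ham_cycles complete_edges. S \<subseteq> u}) = \<kappa> * r (card S)"
  proof (rule proportional_counts[OF three, where e = "{x, y}"])
    fix vs vs' :: "'v list" assume v: "vs \<in> enumerations complete_edges" "vs' \<in> enumerations complete_edges"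
    obtain \<sigma> where s: "bij \<sigma>" "map \<sigma> vs = vs'" by (rule enumerations_relabelling[OF v])
    have "(\<lambda>e. \<sigma> ` e) ` complete_edges \<subseteq> complete_edges"
    proof (rule image_subsetI)
      fix e :: "'v set" assume "e \<in> complete_edges"
      then obtain x y where "e = {x, y}" "x \<noteq> y" unfolding complete_edges_def by blast
      then show "\<sigma> ` e \<in> complete_edges" using s(1) by (simp add: complete_edge_iff bij_def inj_eq)
    qed
    then show "\<exists>\<sigma>. bij \<sigma> \<and> (\<lambda>e. \<sigma> ` e) ` complete_edges \<subseteq> complete_edges \<and> cycle_edges (map \<sigma> vs) = cycle_edges vs'"
      using s by blast
  next
    show "{x, y} \<in> complete_edges" "card {x, y} = 2" using xy by (simp_all add: complete_edge_iff)
  next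
    fix S :: "'v set set" and c d
    assume S: "is_matching S" "S \<subseteq> complete_edges" "{c, d} \<in> S"
    have cd: "c \<noteq> d" using S by (auto simp: is_matching_def)
    have finS: "finite S" by simp
    have "card {vs \<in> enumerations complete_edges. S \<subseteq> cycle_edges vs \<and> vs ! 0 = c \<and> vs ! 1 = d}
      = card (arrangements (\<lambda>_ _. True) (UNIV - {c, d}) (S - {{c, d}}))"
    proof (rule card_enumerations_start[OF S(1,3) three])
      fix ws assume "distinct ws" "set ws = UNIV - {c, d}"
      then show "(cycle_edges (c # d # ws) \<subseteq> complete_edges) = (\<forall>i<length ws. True)"
        using cycle_edges_complete[of "c # d # ws"] cd by simp
    qed
    also have "\<dots> = 2 ^ card (S - {{c, d}}) * fact (card (UNIV - {c, d}) - card (S - {{c, d}}))"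
      by (rule card_linear_arrangements)
        (use is_matching_subset[OF S(1)] matching_Diff[OF S(1,3), of UNIV] in auto)
    also have "card (S - {{c, d}}) = card S - 1" using S(3) by simp
    also have "card (UNIV - {c, d}) = CARD('v) - 2" using cd by (simp add: card_Diff_subset)
    also have "CARD('v) - 2 - (card S - 1) = CARD('v) - card S - 1"
    proof -
      have "0 < card S" using S(3) finS by (auto simp: card_gt_0_iff)
      then show ?thesis by simp
    qed
    finally show "real (card {vs \<in> enumerations complete_edges. S \<subseteq> cycle_edges vs \<and> vs ! 0 = c \<and> vs ! 1 = d}) = r (card S)"
      by (simp add: r_def)
  qed (simp add: r_def)
  then obtain \<kappa> where k: "\<kappa> > 0" "\<And>S. is_matching S \<Longrightarrow> S \<subseteq> (complete_edges :: 'v set set) \<Longrightarrow> S \<noteq> {} \<Longrightarrow>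
    real (card {u \<in> ham_cycles complete_edges. S \<subseteq> u}) = \<kappa> * r (card S)" by blast
  have "r (card S) = 2 ^ card S * fact (CARD('v) - card S - 1) / 2" if "S \<noteq> {}" for S :: "'v set set"
  proof -
    have "0 < card S" using that by (simp add: card_gt_0_iff)
    then show ?thesis by (cases "card S") (simp_all add: r_def)
  qed
  then show ?thesis using k by (intro exI[of _ "\<kappa> / 2"]) simp
qed

lemma alternating_path:
  assumes edge: "\<And>x y. {x, y} \<in> E \<longleftrightarrow> (x \<in> C) \<noteq> (y \<in> C)"
  shows "path_edges (x # xs) \<subseteq> E \<longleftrightarrow> (\<forall>i<length xs. (xs ! i \<in> C) = (even i = (x \<notin> C)))"
proof (induction xs arbitrary: x)
  case (Cons y ys)
  have "path_edges (x # y # ys) \<subseteq> E \<longleftrightarrow> (x \<in> C) \<noteq> (y \<in> C) \<and> (\<forall>i<length ys. (ys ! i \<in> C) = (even i = (y \<notin> C)))"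
    using Cons.IH[of y] edge[of x y] by simp
  also have "\<dots> \<longleftrightarrow> (\<forall>i<length (y # ys). ((y # ys) ! i \<in> C) = (even i = (x \<notin> C)))"
    by (simp add: All_less_Suc2) auto
  finally show ?case .
qed simp

lemma alternating_cycle:
  assumes edge: "\<And>x y. {x, y} \<in> E \<longleftrightarrow> (x \<in> C) \<noteq> (y \<in> C)"
    and cd: "c \<in> C" "d \<notin> C" and ev: "even (length ws)"
  shows "cycle_edges (c # d # ws) \<subseteq> E \<longleftrightarrow> (\<forall>i<length ws. (ws ! i \<in> C) = even i)"
proof -
  have p: "path_edges (d # ws) \<subseteq> E \<longleftrightarrow> (\<forall>i<length ws. (ws ! i \<in> C) = even i)"
    using alternating_path[OF edge, of d ws] cd by simp
  have l: "last (d # ws) \<notin> C" if "\<forall>i<length ws. (ws ! i \<in> C) = even i"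
  proof (cases "ws = []")
    case False
    then have "odd (length ws - 1)" "length ws - 1 < length ws" using ev by auto
    then show ?thesis using that False by (simp add: last_conv_nth)
  qed (use cd in simp)
  have "cycle_edges (c # d # ws) \<subseteq> E \<longleftrightarrow> {last (d # ws), c} \<in> E \<and> {c, d} \<in> E \<and> path_edges (d # ws) \<subseteq> E"
    by (simp add: cycle_edges_path)
  also have "\<dots> \<longleftrightarrow> (\<forall>i<length ws. (ws ! i \<in> C) = even i)"
    using p l edge cd by blast
  finally show ?thesis .
qed

lemma bipartite_edge_iff:
  assumes "A \<inter> B = {}" "A \<union> B = UNIV"
  shows "{x, y} \<in> complete_bipartite_edges A B \<longleftrightarrow> (x \<in> A) \<noteq> (y \<in> A)"
proof -
  have "{x, y} \<in> complete_bipartite_edges A B \<longleftrightarrow> x \<in> A \<and> y \<in> B \<or> y \<in> A \<and> x \<in> B"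
    unfolding complete_bipartite_edges_def by (simp add: doubleton_eq_iff) blast
  moreover have "z \<in> B \<longleftrightarrow> z \<notin> A" for z using assms by blast
  ultimately show ?thesis by blast
qed

lemma bipartite_transitive:
  fixes E :: "'v::finite set set"
  assumes edge: "\<And>x y. {x, y} \<in> E \<longleftrightarrow> (x \<in> A) \<noteq> (y \<in> A)"
    and two: "2 \<le> CARD('v)" and card2: "\<And>e. e \<in> E \<Longrightarrow> card e = 2"
    and v: "vs \<in> enumerations E" "vs' \<in> enumerations E"
  shows "\<exists>\<sigma>. bij \<sigma> \<and> (\<lambda>e. \<sigma> ` e) ` E \<subseteq> E \<and> cycle_edges (map \<sigma> vs) = cycle_edges vs'"
proof -
  have alt: "(ws ! i \<in> A) = (even i = (ws ! 0 \<in> A))" if ws: "ws \<in> enumerations E" and i: "i < CARD('v)" for ws i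
  proof -
    obtain x xs where x: "ws = x # xs" using enumerations_length[OF ws] two by (cases ws) auto
    have "path_edges ws \<subseteq> E" using ws unfolding enumerations_def x by (simp add: cycle_edges_path)
    then have "\<forall>i<length xs. (xs ! i \<in> A) = (even i = (x \<notin> A))"
      unfolding x using alternating_path[OF edge, of x xs] by simp
    moreover have "length xs = CARD('v) - 1" using enumerations_length[OF ws] x by simp
    ultimately show ?thesis using i unfolding x by (cases i) auto
  qed
  obtain ws where ws: "ws \<in> enumerations E" "cycle_edges ws = cycle_edges vs'" "(ws ! 0 \<in> A) = (vs ! 0 \<in> A)"
  proof (cases "(vs' ! 0 \<in> A) = (vs ! 0 \<in> A)")
    case True
    then show ?thesis using that v by blast
  next
    case False
    have r: "rotate 1 vs' \<in> enumerations E" by (rule enumerations_rotate[OF v(2)])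
    have "rotate 1 vs' ! 0 = vs' ! 1"
      using enumerations_length[OF v(2)] two by (simp only: nth_rotate) simp
    moreover have "(vs' ! 1 \<in> A) \<noteq> (vs' ! 0 \<in> A)" using alt[OF v(2), of 1] two by simp
    ultimately show ?thesis using that[OF r] False cycle_edges_rotate by metis
  qed
  obtain \<sigma> where s: "bij \<sigma>" "map \<sigma> vs = ws" by (rule enumerations_relabelling[OF v(1) ws(1)])
  have side: "(\<sigma> x \<in> A) = (x \<in> A)" for x
  proof -
    have "x \<in> set vs" using v(1) by (simp add: enumerations_def)
    then obtain i where i: "i < length vs" "x = vs ! i" by (auto simp: in_set_conv_nth)
    then have "\<sigma> x = ws ! i" using s(2) by auto
    then show ?thesis using alt[OF ws(1), of i] alt[OF v(1), of i] i enumerations_length[OF v(1)] ws(3) by simp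
  qed
  have "(\<lambda>e. \<sigma> ` e) ` E \<subseteq> E"
  proof (rule image_subsetI)
    fix e assume e: "e \<in> E"
    obtain x y where xy: "e = {x, y}" using card2[OF e] by (auto simp: card_2_iff)
    then show "\<sigma> ` e \<in> E" using e edge side by simp
  qed
  then show ?thesis using s ws(2) by blast
qed

lemma bipartite_count:
  fixes A B :: "'v::finite set"
  assumes AB: "A \<inter> B = {}" "A \<union> B = UNIV" "card A = n" "card B = n" and n: "2 \<le> n"
  shows "\<exists>\<kappa>>0. \<forall>S. is_matching S \<and> S \<subseteq> complete_bipartite_edges A B \<and> S \<noteq> {} \<longrightarrow>
    real (card {u \<in> ham_cycles (complete_bipartite_edges A B). S \<subseteq> u})
      = \<kappa> * (fact (2 * n - card S - 1) * (fact (n - card S))\<^sup>2 / fact (2 * n - 2 * card S))"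
proof -
  let ?E = "complete_bipartite_edges A B"
  have B: "B = - A" using AB by auto
  have N: "CARD('v) = 2 * n" using card_Un_disjoint[of A B] AB by simp
  note edge = bipartite_edge_iff[OF AB(1,2)]
  have card2: "card e = 2" if "e \<in> ?E" for e
  proof -
    have "e \<in> ?E" by (rule that)
    then obtain a b where "e = {a, b}" "a \<in> A" "b \<in> B" unfolding complete_bipartite_edges_def by blast
    then show ?thesis using AB(1) by (cases "a = b") auto
  qed
  have three: "3 \<le> CARD('v)" using N n by simp
  have "A \<noteq> {}" "B \<noteq> {}" using AB n by auto
  then obtain a b where ab: "a \<in> A" "b \<in> B" by blast
  then have abE: "{a, b} \<in> ?E" unfolding complete_bipartite_edges_def by blast
  show ?thesis
  proof (rule proportional_counts[where e = "{a, b}"])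
  show "3 \<le> CARD('v)" by (rule three)
  show "\<exists>\<sigma>. bij \<sigma> \<and> (\<lambda>e. \<sigma> ` e) ` ?E \<subseteq> ?E \<and> cycle_edges (map \<sigma> vs) = cycle_edges vs'"
    if "vs \<in> enumerations ?E" "vs' \<in> enumerations ?E" for vs vs'
    by (rule bipartite_transitive[OF edge _ card2 that]) (use three in auto)
  show "{a, b} \<in> ?E" "card {a, b} = 2" using abE card2 by simp_all
  show "0 < (fact (2 * n - 1 - 1) * (fact (n - 1))\<^sup>2 / fact (2 * n - 2 * 1) :: real)" by simp
  fix S c d assume S: "is_matching S" "S \<subseteq> ?E" "{c, d} \<in> S"
  define C where "C = (if c \<in> A then A else - A)"
  have edgeC: "{x, y} \<in> ?E \<longleftrightarrow> (x \<in> C) \<noteq> (y \<in> C)" for x y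
    using edge[of x y] unfolding C_def by (cases "c \<in> A") auto
  have c: "c \<in> C" by (simp add: C_def)
  have d: "d \<notin> C" using S(2,3) edgeC[of c d] c by blast
  have cd: "c \<noteq> d" using c d by auto
  have cardC: "card C = n" "card (- C) = n" using AB unfolding C_def B by auto
  have s: "0 < card S" using S(3) by (auto simp: card_gt_0_iff)
  have side: "card (e \<inter> C) = 1" if "e \<in> S" for e
  proof -
    have e: "e \<in> S" by (rule that)
    obtain x y where xy: "e = {x, y}" by (rule is_matchingE[OF S(1) e])
    then have "(x \<in> C) \<noteq> (y \<in> C)" using edgeC[of x y] S(2) that by blast
    then have "e \<inter> C = {x} \<or> e \<inter> C = {y}" using xy by auto
    then show ?thesis by auto
  qed
  have sn: "card S \<le> n"
    using card_mono[of C "\<Union>S \<inter> C"] card_matching_side[OF S(1) _ side] cardC by simp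
  have "card {vs \<in> enumerations ?E. S \<subseteq> cycle_edges vs \<and> vs ! 0 = c \<and> vs ! 1 = d}
      = card (arrangements (alternating C) (UNIV - {c, d}) (S - {{c, d}}))"
  proof (rule card_enumerations_start[OF S(1,3) three])
    fix ws assume ws: "distinct ws" "set ws = UNIV - {c, d}"
    have "length ws = card (UNIV - {c, d})" using ws distinct_card by metis
    also have "\<dots> = 2 * n - 2" using cd N by (simp add: card_Diff_subset)
    finally have "even (length ws)" by simp
    then show "(cycle_edges (c # d # ws) \<subseteq> ?E) = (\<forall>i<length ws. (ws ! i \<in> C) = even i)"
      by (rule alternating_cycle[OF edgeC c d])
  qed
  moreover have "real (card (arrangements (alternating C) (UNIV - {c, d}) (S - {{c, d}})))
      = fact (card (S - {{c, d}}) + (n - card S) + (n - card S)) * fact (n - card S) * fact (n - card S)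
        / fact ((n - card S) + (n - card S))"
  proof (rule card_alternating_arrangements)
    show "is_matching (S - {{c, d}})" by (rule is_matching_subset[OF S(1)]) auto
    show "\<Union>(S - {{c, d}}) \<subseteq> UNIV - {c, d}" by (rule matching_Diff[OF S(1,3)]) simp
    have "(UNIV - {c, d}) \<inter> C = C - {c}" "UNIV - {c, d} - C = - C - {d}" using c d by auto
    moreover have "card (C - {c}) = n - 1" "card (- C - {d}) = n - 1" using c d cardC by auto
    ultimately show "card ((UNIV - {c, d}) \<inter> C) = n - card S + card (S - {{c, d}})"
      "card (UNIV - {c, d} - C) = n - card S + card (S - {{c, d}})"
      using s sn S(3) by auto
  qed (use side in auto)
  moreover have "card (S - {{c, d}}) + (n - card S) + (n - card S) = 2 * n - card S - 1"
    "(n - card S) + (n - card S) = 2 * n - 2 * card S"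
    using s sn S(3) by auto
  ultimately show "real (card {vs \<in> enumerations ?E. S \<subseteq> cycle_edges vs \<and> vs ! 0 = c \<and> vs ! 1 = d})
      = fact (2 * n - card S - 1) * (fact (n - card S))\<^sup>2 / fact (2 * n - 2 * card S)"
    by (simp add: power2_eq_square mult.assoc)
qed
qed

(*#PART C*)
abbreviation swap :: "'v \<Rightarrow> 'v \<Rightarrow> 'v \<Rightarrow> 'v" where
  "swap \<equiv> Transposition.transpose"

locale two_sided_graph =
  fixes E :: "'v::finite set set" and side :: "'v \<Rightarrow> bool"
  assumes three: "3 \<le> CARD('v)"
    and card_edge: "e \<in> E \<Longrightarrow> card e = 2"
    and swap_edge: "side x = side x' \<Longrightarrow> e \<in> E \<Longrightarrow> swap x x' ` e \<in> E"
    and orient: "{x, y} \<in> E \<Longrightarrow> {x', y'} \<in> E \<Longrightarrow>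
      side x = side x' \<and> side y = side y' \<or> side x = side y' \<and> side y = side x'"
begin

definition admissible :: "('v \<Rightarrow> 'v) \<Rightarrow> bool" where
  "admissible \<sigma> \<longleftrightarrow> bij \<sigma> \<and> (\<forall>e\<in>E. \<sigma> ` e \<in> E) \<and> (\<forall>x. side (\<sigma> x) = side x)"

lemma admissible_swap: "side x = side x' \<Longrightarrow> admissible (swap x x')"
  unfolding admissible_def using swap_edge by (auto simp: Transposition.transpose_def)

lemma admissible_id: "admissible (\<lambda>x. x)"
  unfolding admissible_def using bij_id by (simp add: id_def)

lemma admissible_comp: "admissible \<sigma> \<Longrightarrow> admissible \<tau> \<Longrightarrow> admissible (\<lambda>x. \<sigma> (\<tau> x))"
  unfolding admissible_def using bij_comp[of \<tau> \<sigma>] by (simp add: comp_def image_image[symmetric])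

lemma edge_neq: "{x, y} \<in> E \<Longrightarrow> x \<noteq> y"
  using card_edge[of "{x, y}"] by auto

lemma edgeE:
  assumes "e \<in> E"
  obtains x y where "e = {x, y}" "x \<noteq> y"
  using card_edge[OF assms] by (auto simp: card_2_iff)

lemma oriented_edges:
  assumes "e \<in> E" "e' \<in> E"
  obtains x y x' y' where "e = {x, y}" "e' = {x', y'}" "side x = side x'" "side y = side y'"
proof -
  obtain x y where xy: "e = {x, y}" by (rule edgeE[OF assms(1)])
  obtain x' y' where xy': "e' = {x', y'}" by (rule edgeE[OF assms(2)])
  have "e' = {y', x'}" using xy' by auto
  then show thesis using orient[of x y x' y'] assms that[OF xy xy'] that[OF xy, of y' x'] unfolding xy xy' by auto
qed

lemma ham_cycle_subset: "u \<in> ham_cycles E \<Longrightarrow> u \<subseteq> E"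
  by (simp add: ham_cycles_def)

lemma admissible_inj:
  assumes "admissible \<sigma>"
  shows "inj ((`) \<sigma>)" and "inj ((`) ((`) \<sigma>))"
proof -
  have bij: "bij \<sigma>" using assms by (simp add: admissible_def)
  show inj: "inj ((`) \<sigma>)"
    by (rule injI) (simp only: inj_image_eq_iff[OF bij_is_inj[OF bij]])
  show "inj ((`) ((`) \<sigma>))"
    by (rule injI) (simp only: inj_image_eq_iff[OF inj])
qed

lemma ham_cycles_image:
  assumes "admissible \<sigma>"
  shows "(\<lambda>u. (`) \<sigma> ` u) ` ham_cycles E = ham_cycles E"
proof (rule endo_inj_surj)
  have bij: "bij \<sigma>" and E: "\<And>e. e \<in> E \<Longrightarrow> \<sigma> ` e \<in> E" using assms by (auto simp: admissible_def)
  show "inj_on (\<lambda>u. (`) \<sigma> ` u) (ham_cycles E)"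
    using admissible_inj(2)[OF assms] by (rule inj_on_subset) simp
  show "(\<lambda>u. (`) \<sigma> ` u) ` ham_cycles E \<subseteq> ham_cycles E"
  proof (rule image_subsetI)
    fix u assume "u \<in> ham_cycles E"
    then obtain vs where vs: "vs \<in> enumerations E" "u = cycle_edges vs"
      unfolding ham_cycles_eq_image[OF three] by blast
    have "cycle_edges (map \<sigma> vs) \<subseteq> E"
      using vs(1) E by (auto simp: cycle_edges_map enumerations_def)
    moreover have "distinct (map \<sigma> vs)" "set (map \<sigma> vs) = UNIV"
      using vs(1) bij by (auto simp: enumerations_def distinct_map bij_def inj_on_def)
    ultimately have "map \<sigma> vs \<in> enumerations E" by (simp add: enumerations_def)
    then show "(`) \<sigma> ` u \<in> ham_cycles E"
      unfolding ham_cycles_eq_image[OF three] vs(2) cycle_edges_map[symmetric] by blast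
  qed
qed simp

definition edge_weight :: "(nat \<Rightarrow> real) \<Rightarrow> 'v set set \<Rightarrow> 'v set \<Rightarrow> real" where
  "edge_weight G M e = (\<Sum>u\<in>{u \<in> ham_cycles E. e \<in> u}. G (card (u \<inter> M)))"

lemma edge_weight_invariant:
  assumes \<sigma>: "admissible \<sigma>" and M: "\<And>f. f \<in> M \<Longrightarrow> \<sigma> ` f \<in> M"
  shows "edge_weight G M (\<sigma> ` e) = edge_weight G M e"
proof -
  have inj: "inj ((`) \<sigma>)" by (rule admissible_inj(1)[OF \<sigma>])
  have M': "(`) \<sigma> ` M = M"
    by (rule endo_inj_surj) (use M inj in \<open>auto intro: inj_on_subset\<close>)
  have c: "card ((`) \<sigma> ` u \<inter> M) = card (u \<inter> M)" for u
  proof -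
    have "(`) \<sigma> ` u \<inter> M = (`) \<sigma> ` (u \<inter> M)"
      using image_Int[OF inj, of u M] M' by simp
    then show ?thesis using inj by (simp add: card_image inj_on_subset)
  qed
  have "{u \<in> ham_cycles E. \<sigma> ` e \<in> u} = (\<lambda>u. (`) \<sigma> ` u) ` {u \<in> ham_cycles E. e \<in> u}"
  proof (intro equalityI subsetI)
    fix u assume u: "u \<in> {u \<in> ham_cycles E. \<sigma> ` e \<in> u}"
    then have "u \<in> (\<lambda>u. (`) \<sigma> ` u) ` ham_cycles E" unfolding ham_cycles_image[OF \<sigma>] by simp
    then obtain w where w: "u = (`) \<sigma> ` w" "w \<in> ham_cycles E" by (elim imageE)
    have "\<sigma> ` e \<in> (`) \<sigma> ` w" using u w(1) by simp
    then have "e \<in> w" by (simp only: inj_image_mem_iff[OF inj])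
    then show "u \<in> (\<lambda>u. (`) \<sigma> ` u) ` {u \<in> ham_cycles E. e \<in> u}" using w by (intro image_eqI[of _ _ w]) simp_all
  next
    fix u assume "u \<in> (\<lambda>u. (`) \<sigma> ` u) ` {u \<in> ham_cycles E. e \<in> u}"
    then obtain w where w: "u = (`) \<sigma> ` w" "w \<in> {u \<in> ham_cycles E. e \<in> u}" by (elim imageE)
    then have "u \<in> (\<lambda>u. (`) \<sigma> ` u) ` ham_cycles E" by simp
    then show "u \<in> {u \<in> ham_cycles E. \<sigma> ` e \<in> u}" unfolding ham_cycles_image[OF \<sigma>] using w by simp
  qed
  moreover have "inj_on (\<lambda>u. (`) \<sigma> ` u) {u \<in> ham_cycles E. e \<in> u}"
    using admissible_inj(2)[OF \<sigma>] by (rule inj_on_subset) simp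
  ultimately show ?thesis
    unfolding edge_weight_def by (simp add: sum.reindex c)
qed

definition preserves :: "'v set set \<Rightarrow> ('v \<Rightarrow> 'v) \<Rightarrow> bool" where
  "preserves M \<sigma> \<longleftrightarrow> admissible \<sigma> \<and> (\<forall>f\<in>M. \<sigma> ` f \<in> M)"

lemma edge_weight_preserves: "preserves M \<sigma> \<Longrightarrow> edge_weight G M (\<sigma> ` e) = edge_weight G M e"
  unfolding preserves_def using edge_weight_invariant by blast

lemma preserves_reflects:
  assumes "preserves M \<sigma>" "\<sigma> ` f \<in> M"
  shows "f \<in> M"
proof -
  have inj: "inj ((`) \<sigma>)" using assms(1) admissible_inj(1) by (simp add: preserves_def)
  have "(`) \<sigma> ` M = M"
    by (rule endo_inj_surj) (use assms(1) inj in \<open>auto intro: inj_on_subset simp: preserves_def\<close>)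
  then have "\<sigma> ` f \<in> (`) \<sigma> ` M" using assms(2) by simp
  then show ?thesis by (simp only: inj_image_mem_iff[OF inj])
qed

lemma matching_move:
  assumes M: "is_matching M" "M \<subseteq> E" and xy: "{x, y} \<in> M" "{x', y'} \<in> M" and side: "side x = side x'"
  obtains \<sigma> where "preserves M \<sigma>" "\<sigma> x = x'" "\<And>z. z \<notin> {x, y, x', y'} \<Longrightarrow> \<sigma> z = z"
proof -
  have ne: "x \<noteq> y" "x' \<noteq> y'" using M xy edge_neq by blast+
  have sy: "side y = side y'" using orient[of x y x' y'] M xy side by blast
  consider "x' = x" | "x' \<noteq> x" "x' = y" | "x' \<noteq> x" "x' \<noteq> y" by blast
  then show thesis
  proof cases
    case 1
    show thesis by (rule that[of "\<lambda>x. x"]) (use 1 admissible_id in \<open>auto simp: preserves_def\<close>)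
  next
    case 2
    have "swap x y ` f \<in> M" if f: "f \<in> M" for f
    proof (cases "f = {x, y}")
      case True
      then have "swap x y ` f = f" by auto
      then show ?thesis using f by simp
    next
      case False
      then have "x \<notin> f" "y \<notin> f" using is_matchingD[OF M(1) xy(1) f] by auto
      then have "swap x y ` f = f" by simp
      then show ?thesis using f by simp
    qed
    then have "preserves M (swap x y)" using admissible_swap[of x y] side 2 by (simp add: preserves_def)
    then show thesis by (rule that) (use 2 in auto)
  next
    case 3
    have y'x: "y' \<noteq> x" "y' \<noteq> y"
      using is_matchingD[OF M(1) xy, of y'] is_matchingD[OF M(1) xy, of x'] 3 ne by (auto simp: doubleton_eq_iff)
    define \<sigma> where "\<sigma> z = swap x x' (swap y y' z)" for z
    have vals: "\<sigma> x = x'" "\<sigma> y = y'" "\<sigma> x' = x" "\<sigma> y' = y" "\<And>z. z \<notin> {x, y, x', y'} \<Longrightarrow> \<sigma> z = z"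
      using 3 ne y'x by (auto simp: \<sigma>_def Transposition.transpose_def)
    have "\<sigma> ` f \<in> M" if f: "f \<in> M" for f
    proof -
      consider "f = {x, y}" | "f = {x', y'}" | "f \<noteq> {x, y}" "f \<noteq> {x', y'}" by blast
      then show ?thesis
      proof cases
        case 1
        then show ?thesis using xy vals by simp
      next
        case 2
        then show ?thesis using xy vals by simp
      next
        case 3
        then have nf: "x \<notin> f" "y \<notin> f" "x' \<notin> f" "y' \<notin> f"
          using is_matchingD[OF M(1) xy(1) f] is_matchingD[OF M(1) xy(2) f] by auto
        have "\<sigma> z = z" if "z \<in> f" for z by (rule vals(5)) (use nf that in auto)
        then have "\<sigma> ` f = f" by simp
        then show ?thesis using f by simp
      qed
    qed
    moreover have "admissible \<sigma>"
      unfolding \<sigma>_def by (rule admissible_comp[OF admissible_swap admissible_swap]) (use side sy in auto)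
    ultimately have "preserves M \<sigma>" by (simp add: preserves_def)
    then show thesis using that vals by blast
  qed
qed

lemma matching_mate:
  assumes "is_matching M" "v \<in> \<Union>M"
  shows "\<exists>m. {v, m} \<in> M"
proof -
  obtain f where f: "f \<in> M" "v \<in> f" using assms(2) by blast
  obtain a b where "f = {a, b}" by (rule is_matchingE[OF assms(1) f(1)])
  then show ?thesis using f by (auto simp: insert_commute)
qed

lemma edge_weight_matching_edges:
  assumes M: "is_matching M" "M \<subseteq> E" and e: "e \<in> M" "e' \<in> M"
  shows "edge_weight G M e = edge_weight G M e'"
proof -
  have "e \<in> E" "e' \<in> E" using e M by auto
  then obtain x y x' y' where xy: "e = {x, y}" "e' = {x', y'}" "side x = side x'" "side y = side y'"
    by (rule oriented_edges)
  obtain \<sigma> where \<sigma>: "preserves M \<sigma>" "\<sigma> x = x'"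
    by (rule matching_move[OF M e[unfolded xy] xy(3)])
  have "\<sigma> ` e \<in> M" using \<sigma>(1) e by (simp add: preserves_def)
  then have "\<sigma> ` e = e'" using is_matchingD[OF M(1) _ e(2), of "\<sigma> ` e" x'] xy \<sigma>(2) by auto
  then show ?thesis using edge_weight_preserves[OF \<sigma>(1), of G e] by simp
qed

lemma edge_weight_other_edges:
  assumes M: "is_matching M" "M \<subseteq> E" and e: "e \<in> E - M" "e' \<in> E - M" and cov: "e \<subseteq> \<Union>M" "e' \<subseteq> \<Union>M"
  shows "edge_weight G M e = edge_weight G M e'"
proof -
  have "e \<in> E" "e' \<in> E" using e by auto
  then obtain x y x' y' where xy: "e = {x, y}" "e' = {x', y'}" "side x = side x'" "side y = side y'"
    by (rule oriented_edges)
  note mate = matching_mate[OF M(1)]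
  obtain m where m: "{x, m} \<in> M" using mate cov xy by blast
  obtain m' where m': "{x', m'} \<in> M" using mate cov xy by blast
  obtain \<sigma> where \<sigma>: "preserves M \<sigma>" "\<sigma> x = x'"
    by (rule matching_move[OF M m m' xy(3)])
  define y1 where "y1 = \<sigma> y"
  have e1: "\<sigma> ` e = {x', y1}" using xy \<sigma>(2) by (simp add: y1_def)
  have adm: "admissible \<sigma>" using \<sigma>(1) by (simp add: preserves_def)
  have e1E: "{x', y1} \<in> E" unfolding e1[symmetric] using adm e(1) by (simp add: admissible_def)
  have e1M: "{x', y1} \<notin> M" using preserves_reflects[OF \<sigma>(1), of e] e e1 by auto
  have sy1: "side y1 = side y'" using adm xy unfolding admissible_def y1_def by simp
  obtain n where n: "{y, n} \<in> M" using mate cov xy by blast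
  have "\<sigma> ` {y, n} \<in> M" using \<sigma>(1) n unfolding preserves_def by blast
  then have n1: "{y1, \<sigma> n} \<in> M" by (simp add: y1_def)
  obtain n' where n': "{y', n'} \<in> M" using mate cov xy by blast
  obtain \<tau> where \<tau>: "preserves M \<tau>" "\<tau> y1 = y'" "\<And>z. z \<notin> {y1, \<sigma> n, y', n'} \<Longrightarrow> \<tau> z = z"
    by (rule matching_move[OF M n1 n' sy1]) blast
  have "x' \<noteq> y1" using e1E edge_neq by blast
  moreover have "x' \<noteq> \<sigma> n" using n1 e1M by (auto simp: insert_commute)
  moreover have "x' \<noteq> y'" using e xy edge_neq by blast
  moreover have "x' \<noteq> n'" using n' e xy by (auto simp: insert_commute)
  ultimately have "\<tau> x' = x'" using \<tau>(3) by blast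
  then have "\<tau> ` (\<sigma> ` e) = e'" using e1 \<tau>(2) xy by simp
  then show ?thesis
    using edge_weight_preserves[OF \<sigma>(1), of G e] edge_weight_preserves[OF \<tau>(1), of G "\<sigma> ` e"] by simp
qed

lemma edge_weight_loose_edges:
  assumes M: "is_matching M" "M \<subseteq> E" and z: "UNIV - \<Union>M = {z}" and e: "e \<in> E" "e' \<in> E" "z \<in> e" "z \<in> e'"
  shows "edge_weight G M e = edge_weight G M e'"
proof -
  have ex: "\<exists>y m. f = {z, y} \<and> {y, m} \<in> M" if f: "f \<in> E" "z \<in> f" for f
  proof -
    obtain a b where ab: "f = {a, b}" "a \<noteq> b" by (rule edgeE[OF f(1)])
    then obtain y where y: "f = {z, y}" "y \<noteq> z" using f(2) by (metis insert_commute insertE singletonD)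
    then have "y \<in> \<Union>M" using z by blast
    then show ?thesis using matching_mate[OF M(1)] y(1) by blast
  qed
  obtain y m where y: "e = {z, y}" "{y, m} \<in> M" using ex[OF e(1,3)] by blast
  obtain y' m' where y': "e' = {z, y'}" "{y', m'} \<in> M" using ex[OF e(2,4)] by blast
  have "side y = side y'" using orient[of z y z y'] e y y' by auto
  from matching_move[OF M y(2) y'(2) this] obtain \<sigma> where \<sigma>: "preserves M \<sigma>" "\<sigma> y = y'"
    "\<And>v. v \<notin> {y, m, y', m'} \<Longrightarrow> \<sigma> v = v" by blast
  have "z \<notin> {y, m, y', m'}" using z y(2) y'(2) by blast
  then have "\<sigma> ` e = e'" using \<sigma> y y' by simp
  then show ?thesis using edge_weight_preserves[OF \<sigma>(1), of G e] by simp
qed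

lemma edge_count_constant:
  assumes e: "e \<in> E" "e' \<in> E"
  shows "card {u \<in> ham_cycles E. e \<in> u} = card {u \<in> ham_cycles E. e' \<in> u}"
proof -
  obtain x y x' y' where xy: "e = {x, y}" "e' = {x', y'}" "side x = side x'" "side y = side y'"
    by (rule oriented_edges[OF e])
  have w: "real (card {u \<in> ham_cycles E. f \<in> u}) = edge_weight (\<lambda>_. 1) {} f" for f
    by (simp add: edge_weight_def)
  define \<sigma> where "\<sigma> = swap x x'"
  have \<sigma>: "preserves {} \<sigma>" using admissible_swap[OF xy(3)] by (simp add: preserves_def \<sigma>_def)
  define y1 where "y1 = \<sigma> y"
  have e1: "\<sigma> ` e = {x', y1}" using xy by (simp add: y1_def \<sigma>_def)
  have e1E: "{x', y1} \<in> E" unfolding e1[symmetric] using \<sigma> e(1) by (simp add: preserves_def admissible_def)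
  have "side y1 = side y'" using \<sigma> xy unfolding preserves_def admissible_def y1_def by simp
  then have \<tau>: "preserves {} (swap y1 y')" using admissible_swap by (simp add: preserves_def)
  have "x' \<noteq> y1" "x' \<noteq> y'" using e1E e xy edge_neq by blast+
  then have "swap y1 y' ` \<sigma> ` e = e'" using e1 xy by simp
  then have "edge_weight (\<lambda>_. 1) {} e' = edge_weight (\<lambda>_. 1) {} e"
    using edge_weight_preserves[OF \<sigma>, of _ e] edge_weight_preserves[OF \<tau>, of _ "\<sigma> ` e"] by metis
  then show ?thesis using w by (metis of_nat_eq_iff)
qed

end

(*#PART C2*)
definition cycle_edge :: "'v list \<Rightarrow> nat \<Rightarrow> 'v set" where
  "cycle_edge vs t = {vs ! t, vs ! ((t + 1) mod length vs)}"

lemma cycle_edges_image: "cycle_edges vs = cycle_edge vs ` {..<length vs}"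
  unfolding cycle_edges_def cycle_edge_def by auto

lemma next_index: "t < N \<Longrightarrow> Suc t mod N = (if Suc t = N then 0 else Suc t)" for t N :: nat
  by auto

lemma cycle_edge_inj:
  assumes "distinct vs" "3 \<le> length vs"
  shows "inj_on (cycle_edge vs) {..<length vs}"
proof (rule inj_onI)
  fix s t assume st: "s \<in> {..<length vs}" "t \<in> {..<length vs}" "cycle_edge vs s = cycle_edge vs t"
  define N where "N = length vs"
  have "0 < N" using assms(2) unfolding N_def by linarith
  then have l: "s < N" "t < N" "(s + 1) mod N < N" "(t + 1) mod N < N" using st by (simp_all add: N_def)
  have eq: "vs ! i = vs ! j \<longleftrightarrow> i = j" if "i < N" "j < N" for i j
    using that assms(1) by (simp add: nth_eq_iff_index_eq N_def)
  have "s = t \<or> s = (t + 1) mod N \<and> (s + 1) mod N = t"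
    using st(3) l eq unfolding cycle_edge_def N_def[symmetric] doubleton_eq_iff by auto
  then show "s = t"
    using l assms(2) unfolding N_def[symmetric] by (auto simp: next_index split: if_splits)
qed

lemma card_cycle_edges:
  assumes "distinct vs" "3 \<le> length vs"
  shows "card (cycle_edges vs) = length vs"
  using cycle_edge_inj[OF assms] by (simp add: cycle_edges_image card_image)

lemma cycle_degree:
  assumes vs: "distinct vs" "3 \<le> length vs" and z: "z \<in> set vs"
  shows "card {e \<in> cycle_edges vs. z \<in> e} = 2"
proof -
  define N where "N = length vs"
  obtain p where p: "p < N" "z = vs ! p" using z by (auto simp: in_set_conv_nth N_def)
  define p' where "p' = (if p = 0 then N - 1 else p - 1)"
  have p': "p' < N" "p' \<noteq> p" "(p' + 1) mod N = p" using p vs(2) by (auto simp: p'_def N_def)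
  have eq: "vs ! i = vs ! j \<longleftrightarrow> i = j" if "i < N" "j < N" for i j
    using that vs(1) by (simp add: nth_eq_iff_index_eq N_def)
  have in_edge: "z \<in> cycle_edge vs t \<longleftrightarrow> t = p \<or> t = p'" if t: "t < N" for t
  proof -
    have "(t + 1) mod N < N" using t by (intro mod_less_divisor) linarith
    then have "z \<in> cycle_edge vs t \<longleftrightarrow> p = t \<or> p = (t + 1) mod N"
      using eq p t unfolding cycle_edge_def N_def[symmetric] by auto
    also have "\<dots> \<longleftrightarrow> t = p \<or> t = p'"
      using t p unfolding p'_def by (auto simp: next_index split: if_splits)
    finally show ?thesis .
  qed
  have "{e \<in> cycle_edges vs. z \<in> e} = cycle_edge vs ` {t \<in> {..<N}. z \<in> cycle_edge vs t}"
    unfolding cycle_edges_image N_def by auto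
  also have "{t \<in> {..<N}. z \<in> cycle_edge vs t} = {p, p'}" using in_edge p p' by auto
  also have "card (cycle_edge vs ` {p, p'}) = card {p, p'}"
    by (rule card_image, rule inj_on_subset[OF cycle_edge_inj[OF vs]]) (use p p' in \<open>auto simp: N_def\<close>)
  also have "\<dots> = 2" using p' by simp
  finally show ?thesis .
qed

definition alternate_edges :: "'v list \<Rightarrow> 'v set set" where
  "alternate_edges vs = (\<lambda>s. {vs ! (2 * s), vs ! (2 * s + 1)}) ` {..<length vs div 2}"

lemma alternate_edges_cycle:
  "alternate_edges vs = cycle_edge vs ` (\<lambda>s. 2 * s) ` {..<length vs div 2}"
proof -
  have "(2 * s + 1) mod length vs = 2 * s + 1" if "s < length vs div 2" for s
    using that by (intro mod_less) linarith
  then show ?thesis unfolding alternate_edges_def cycle_edge_def image_image by (intro image_cong) auto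
qed

lemma alternate_edges_matching:
  assumes "distinct vs"
  shows "is_matching (alternate_edges vs)"
proof -
  have eq: "vs ! i = vs ! j \<longleftrightarrow> i = j" if "i < length vs" "j < length vs" for i j
    using that assms by (simp add: nth_eq_iff_index_eq)
  have l: "2 * s < length vs" "2 * s + 1 < length vs" if "s < length vs div 2" for s
    using that by linarith+
  have c2: "card {vs ! (2 * s), vs ! (2 * s + 1)} = 2" if "s < length vs div 2" for s
    using eq[OF l[OF that]] by simp
  have dj: "{vs ! (2 * s), vs ! (2 * s + 1)} \<inter> {vs ! (2 * t), vs ! (2 * t + 1)} = {}"
    if st: "s < length vs div 2" "t < length vs div 2" "s \<noteq> t" for s t
  proof -
    have "2 * s \<noteq> 2 * t + 1" "2 * s + 1 \<noteq> 2 * t" by presburger+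
    then show ?thesis using eq l[OF st(1)] l[OF st(2)] st(3) by simp
  qed
  show ?thesis unfolding is_matching_def
  proof (intro conjI ballI impI)
    fix e f assume "e \<in> alternate_edges vs" "f \<in> alternate_edges vs" "e \<noteq> f"
    then obtain s t where "s < length vs div 2" "t < length vs div 2" "s \<noteq> t"
      "e = {vs ! (2 * s), vs ! (2 * s + 1)}" "f = {vs ! (2 * t), vs ! (2 * t + 1)}"
      unfolding alternate_edges_def by blast
    then show "e \<inter> f = {}" using dj by simp
  qed (use c2 in \<open>auto simp: alternate_edges_def\<close>)
qed

lemma alternate_edges_subset: "alternate_edges vs \<subseteq> cycle_edges vs"
  unfolding alternate_edges_cycle cycle_edges_image by auto

lemma card_alternate_edges:
  assumes "distinct vs" "3 \<le> length vs"
  shows "card (alternate_edges vs) = length vs div 2"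
proof -
  have "inj_on (cycle_edge vs) ((\<lambda>s. 2 * s) ` {..<length vs div 2})"
    by (rule inj_on_subset[OF cycle_edge_inj[OF assms]]) auto
  then show ?thesis unfolding alternate_edges_cycle by (simp add: card_image inj_on_def)
qed

lemma Union_alternate_edges: "\<Union>(alternate_edges vs) = (!) vs ` {..<2 * (length vs div 2)}"
proof (intro equalityI subsetI)
  fix x assume "x \<in> (!) vs ` {..<2 * (length vs div 2)}"
  then obtain i where i: "i < 2 * (length vs div 2)" "x = vs ! i" by auto
  have "i div 2 < length vs div 2" using i(1) by linarith
  moreover have "i = 2 * (i div 2) \<or> i = 2 * (i div 2) + 1" by presburger
  then have "x \<in> {vs ! (2 * (i div 2)), vs ! (2 * (i div 2) + 1)}" using i(2) by auto
  ultimately show "x \<in> \<Union>(alternate_edges vs)" unfolding alternate_edges_def by blast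
qed (auto simp: alternate_edges_def)

lemma unmatched_alternate_edges:
  fixes vs :: "'v::finite list"
  assumes vs: "distinct vs" "set vs = UNIV"
  shows "UNIV - \<Union>(alternate_edges vs) = (if even (length vs) then {} else {last vs})"
proof -
  have U: "UNIV = (!) vs ` {..<length vs}" using vs(2) by (auto simp: set_conv_nth)
  show ?thesis
  proof (cases "even (length vs)")
    case True
    then show ?thesis unfolding Union_alternate_edges using U by simp
  next
    case False
    define m where "m = 2 * (length vs div 2)"
    have m: "length vs = Suc m" using False by (simp add: m_def)
    have "last vs = vs ! m" using m by (subst last_conv_nth) auto
    moreover have "vs ! m \<notin> (!) vs ` {..<m}" using vs(1) m by (auto simp: nth_eq_iff_index_eq)
    moreover have "UNIV = insert (vs ! m) ((!) vs ` {..<m})" using U unfolding m lessThan_Suc by simp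
    ultimately show ?thesis using False unfolding Union_alternate_edges m_def[symmetric] by auto
  qed
qed

lemma alternate_edges_rotate:
  assumes "vs \<noteq> []"
  shows "alternate_edges (rotate t vs) = (\<lambda>s. cycle_edge vs ((t + 2 * s) mod length vs)) ` {..<length vs div 2}"
proof -
  have "{rotate t vs ! (2 * s), rotate t vs ! (2 * s + 1)} = cycle_edge vs ((t + 2 * s) mod length vs)"
    if "s < length vs div 2" for s
  proof -
    have "2 * s < length vs" "2 * s + 1 < length vs" using that by linarith+
    then show ?thesis unfolding cycle_edge_def by (simp add: nth_rotate mod_simps)
  qed
  then show ?thesis unfolding alternate_edges_def by (intro image_cong) auto
qed

lemma card_rotations_containing:
  assumes vs: "distinct vs" "3 \<le> length vs" and e: "e \<in> cycle_edges vs"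
  shows "card {t \<in> {..<length vs}. e \<in> alternate_edges (rotate t vs)} = length vs div 2"
proof -
  define N where "N = length vs"
  obtain p where p: "p < N" "e = cycle_edge vs p" using e by (auto simp: cycle_edges_image N_def)
  define \<tau> where "\<tau> s = (if 2 * s \<le> p then p - 2 * s else p + N - 2 * s)" for s
  have N: "2 * s < N" if "s < N div 2" for s using that by linarith
  have shift: "(t + 2 * s) mod N = p \<longleftrightarrow> t = \<tau> s" if "t < N" "s < N div 2" for t s
  proof -
    have "(t + 2 * s) mod N = (if t + 2 * s < N then t + 2 * s else t + 2 * s - N)"
      using that N[OF that(2)] by (auto simp: mod_if)
    then show ?thesis using that p N[OF that(2)] unfolding \<tau>_def by auto
  qed
  have \<tau>N: "\<tau> s < N" if "s < N div 2" for s using p N[OF that] by (auto simp: \<tau>_def)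
  have "e \<in> alternate_edges (rotate t vs) \<longleftrightarrow> (\<exists>s<N div 2. t = \<tau> s)" if t: "t < N" for t
  proof -
    have inj: "cycle_edge vs p = cycle_edge vs q \<longleftrightarrow> p = q" if "q < N" for q
      using inj_on_eq_iff[OF cycle_edge_inj[OF vs], of p q] p that by (simp add: N_def)
    have "0 < N" using p(1) by linarith
    then have edge: "cycle_edge vs p = cycle_edge vs ((t + 2 * s) mod N) \<longleftrightarrow> p = (t + 2 * s) mod N" for s
      by (intro inj mod_less_divisor)
    have "vs \<noteq> []" using vs by auto
    then have "e \<in> alternate_edges (rotate t vs) \<longleftrightarrow> (\<exists>s<N div 2. p = (t + 2 * s) mod N)"
      unfolding alternate_edges_rotate[OF \<open>vs \<noteq> []\<close>] p(2) N_def[symmetric] image_iff edge by auto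
    also have "\<dots> \<longleftrightarrow> (\<exists>s<N div 2. t = \<tau> s)" using shift[OF t] by metis
    finally show ?thesis .
  qed
  then have "{t \<in> {..<N}. e \<in> alternate_edges (rotate t vs)} = \<tau> ` {..<N div 2}"
    using \<tau>N by auto
  moreover have "inj_on \<tau> {..<N div 2}"
  proof (rule inj_onI)
    fix s s' assume "s \<in> {..<N div 2}" "s' \<in> {..<N div 2}" "\<tau> s = \<tau> s'"
    then show "s = s'" using N[of s] N[of s'] unfolding \<tau>_def by (auto split: if_splits)
  qed
  ultimately show ?thesis by (simp add: card_image N_def)
qed

lemma card_rotations_last:
  fixes vs :: "'v::finite list"
  assumes vs: "distinct vs" "set vs = UNIV" "vs \<noteq> []"
  shows "card {t \<in> {..<length vs}. last (rotate t vs) \<in> e} = card e"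
proof -
  define N where "N = length vs"
  define \<tau> where "\<tau> t = (if t = 0 then N - 1 else t - 1)" for t
  have N: "0 < N" using vs by (simp add: N_def)
  have l: "last (rotate t vs) = vs ! \<tau> t" if "t < N" for t
  proof -
    have "last (rotate t vs) = rotate t vs ! (N - 1)" using vs(3) by (simp add: last_conv_nth N_def)
    also have "\<dots> = vs ! ((t + (N - 1)) mod N)" using N by (simp add: nth_rotate N_def)
    also have "(t + (N - 1)) mod N = \<tau> t"
      using that N by (cases t) (auto simp: \<tau>_def)
    finally show ?thesis .
  qed
  have \<tau>: "\<tau> t < N" if "t < N" for t using that by (auto simp: \<tau>_def)
  have "bij_betw (\<lambda>t. last (rotate t vs)) {t \<in> {..<N}. last (rotate t vs) \<in> e} e"
  proof (rule bij_betw_imageI)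
    show "inj_on (\<lambda>t. last (rotate t vs)) {t \<in> {..<N}. last (rotate t vs) \<in> e}"
    proof (rule inj_onI)
      fix s t assume st: "s \<in> {t \<in> {..<N}. last (rotate t vs) \<in> e}" "t \<in> {t \<in> {..<N}. last (rotate t vs) \<in> e}"
        "last (rotate s vs) = last (rotate t vs)"
      then have "\<tau> s = \<tau> t" using l \<tau> vs(1) by (simp add: nth_eq_iff_index_eq N_def)
      then show "s = t" using st unfolding \<tau>_def by (auto split: if_splits)
    qed
    show "(\<lambda>t. last (rotate t vs)) ` {t \<in> {..<N}. last (rotate t vs) \<in> e} = e"
    proof (intro equalityI subsetI)
      fix x assume x: "x \<in> e"
      have "x \<in> set vs" using vs(2) by simp
      then obtain i where i: "i < N" "x = vs ! i" by (auto simp: in_set_conv_nth N_def)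
      define t where "t = (if i = N - 1 then 0 else i + 1)"
      have "t < N" "\<tau> t = i" using i N by (auto simp: t_def \<tau>_def)
      then show "x \<in> (\<lambda>t. last (rotate t vs)) ` {t \<in> {..<N}. last (rotate t vs) \<in> e}"
        using l x i(2) by (intro image_eqI[of _ _ t]) auto
    qed auto
  qed
  then show ?thesis unfolding N_def by (rule bij_betw_same_card)
qed

context two_sided_graph
begin

lemma enumerations_props:
  assumes "vs \<in> enumerations E"
  shows "distinct vs" "set vs = UNIV" "length vs = CARD('v)" "3 \<le> length vs" "vs \<noteq> []" "cycle_edges vs \<subseteq> E"
  using assms enumerations_length[OF assms] three by (auto simp: enumerations_def)

lemma ham_cycle_card:
  assumes "u \<in> ham_cycles E"
  shows "card u = CARD('v)" and "card {e \<in> u. z \<in> e} = 2"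
proof -
  obtain vs where vs: "vs \<in> enumerations E" "u = cycle_edges vs"
    using assms unfolding ham_cycles_eq_image[OF three] by blast
  note p = enumerations_props[OF vs(1)]
  show "card u = CARD('v)" unfolding vs(2) using card_cycle_edges[OF p(1,4)] p(3) by simp
  show "card {e \<in> u. z \<in> e} = 2" unfolding vs(2) by (rule cycle_degree[OF p(1,4)]) (simp add: p(2))
qed

lemma sum_edge_weight:
  "(\<Sum>e\<in>X. edge_weight G M e) = (\<Sum>u\<in>ham_cycles E. real (card (u \<inter> X)) * G (card (u \<inter> M)))"
proof -
  have "(\<Sum>e\<in>X. edge_weight G M e) = (\<Sum>e\<in>X. \<Sum>u\<in>ham_cycles E. if e \<in> u then G (card (u \<inter> M)) else 0)"
    unfolding edge_weight_def by (simp only: sum.inter_filter[OF finite])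
  also have "\<dots> = (\<Sum>u\<in>ham_cycles E. \<Sum>e\<in>X. if e \<in> u then G (card (u \<inter> M)) else 0)"
    by (rule sum.swap)
  also have "\<dots> = (\<Sum>u\<in>ham_cycles E. real (card (u \<inter> X)) * G (card (u \<inter> M)))"
  proof (rule sum.cong[OF refl])
    fix u
    have "(\<Sum>e\<in>X. if e \<in> u then G (card (u \<inter> M)) else 0) = (\<Sum>e\<in>{e \<in> X. e \<in> u}. G (card (u \<inter> M)))"
      by (simp only: sum.inter_filter[OF finite])
    also have "{e \<in> X. e \<in> u} = u \<inter> X" by auto
    finally show "(\<Sum>e\<in>X. if e \<in> u then G (card (u \<inter> M)) else 0) = real (card (u \<inter> X)) * G (card (u \<inter> M))"
      by simp
  qed
  finally show ?thesis .
qed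

lemma edge_weight_profile:
  fixes G :: "nat \<Rightarrow> real"
  assumes M: "is_matching M" "M \<subseteq> E" "card M = CARD('v) div 2"
    and unmatched: "UNIV - \<Union>M = (if even CARD('v) then {} else {z})"
    and degree: "odd CARD('v) \<Longrightarrow> card {e \<in> E. z \<in> e} = 2 * (CARD('v) div 2)"
  defines "r \<equiv> real (CARD('v) div 2)" and "d \<equiv> real (CARD('v) mod 2)"
    and "Z \<equiv> \<Sum>u\<in>ham_cycles E. G (card (u \<inter> M))"
    and "Y \<equiv> \<Sum>u\<in>ham_cycles E. real (card (u \<inter> M)) * G (card (u \<inter> M))"
  assumes size: "real (card E) - r - 2 * r * d > 0"
  shows "e \<in> M \<Longrightarrow> edge_weight G M e = Y / r"
    and "e \<in> E \<Longrightarrow> \<not> e \<subseteq> \<Union>M \<Longrightarrow> edge_weight G M e = Z / r"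
    and "e \<in> E - M \<Longrightarrow> e \<subseteq> \<Union>M \<Longrightarrow>
      edge_weight G M e = (real CARD('v) * Z - Y - 2 * d * Z) / (real (card E) - r - 2 * r * d)"
proof -
  let ?W = "edge_weight G M"
  have r: "r > 0" using three by (simp add: r_def)
  have const: "(\<Sum>f\<in>X. ?W f) = real (card X) * w" if "\<And>f. f \<in> X \<Longrightarrow> ?W f = w" for X w
    using that by simp
  have sM: "(\<Sum>f\<in>M. ?W f) = Y" unfolding sum_edge_weight Y_def ..
  show a: "?W e = Y / r" if "e \<in> M" for e
    using const[of M "?W e"] edge_weight_matching_edges[OF M(1,2) _ that, of _ G] sM M(3) r
    by (simp add: r_def field_simps)
  define L where "L = {f \<in> E. \<not> f \<subseteq> \<Union>M}"
  define K where "K = {f \<in> E - M. f \<subseteq> \<Union>M}"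
  have L: "L = (if even CARD('v) then {} else {f \<in> E. z \<in> f})"
    using unmatched unfolding L_def by (auto split: if_splits)
  have cL: "real (card L) = 2 * r * d"
  proof (cases "even CARD('v)")
    case False
    have "real (card L) = real (2 * (CARD('v) div 2))" using degree[OF False] False by (simp only: L if_False)
    also have "\<dots> = 2 * r" unfolding of_nat_mult r_def by (simp only: of_nat_numeral)
    finally show ?thesis using False by (simp add: d_def odd_iff_mod_2_eq_one)
  qed (simp add: L d_def)
  have cuL: "real (card (u \<inter> L)) = 2 * d" if "u \<in> ham_cycles E" for u
  proof (cases "even CARD('v)")
    case False
    then have "u \<inter> L = {f \<in> u. z \<in> f}" using L ham_cycle_subset[OF that] by auto
    then show ?thesis using ham_cycle_card(2)[OF that] False by (simp add: d_def odd_iff_mod_2_eq_one)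
  qed (simp add: L d_def)
  have sL: "(\<Sum>f\<in>L. ?W f) = 2 * d * Z"
    unfolding sum_edge_weight Z_def sum_distrib_left using cuL by (intro sum.cong) auto
  show b: "?W e = Z / r" if "e \<in> E" "\<not> e \<subseteq> \<Union>M" for e
  proof -
    have odd: "odd CARD('v)" using that unmatched by (auto split: if_splits)
    have e: "z \<in> e" using that unmatched odd by auto
    have "?W f = ?W e" if "f \<in> L" for f
      by (rule edge_weight_loose_edges[OF M(1,2), of z]) (use unmatched odd e that L \<open>e \<in> E\<close> in auto)
    then have "(\<Sum>f\<in>L. ?W f) = real (card L) * ?W e" by (rule const)
    then have "2 * Z = 2 * r * ?W e" using sL cL odd by (simp add: d_def odd_iff_mod_2_eq_one)
    then show ?thesis using r by (simp add: field_simps)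
  qed
  have E: "E = M \<union> L \<union> K" "M \<inter> L = {}" "(M \<union> L) \<inter> K = {}"
    using M(2) unfolding L_def K_def by auto
  have "card E = card (M \<union> L) + card K" unfolding E(1) by (rule card_Un_disjoint) (use E(3) in auto)
  also have "card (M \<union> L) = card M + card L" by (rule card_Un_disjoint) (use E(2) in auto)
  finally have cK: "real (card K) = real (card E) - r - 2 * r * d" using M(3) cL by (simp add: r_def)
  have "(\<Sum>f\<in>E. ?W f) = (\<Sum>f\<in>M \<union> L. ?W f) + (\<Sum>f\<in>K. ?W f)"
    by (subst E(1), rule sum.union_disjoint) (use E(3) in auto)
  also have "(\<Sum>f\<in>M \<union> L. ?W f) = Y + 2 * d * Z"
    using sM sL E(2) by (simp add: sum.union_disjoint)
  finally have sE: "(\<Sum>f\<in>E. ?W f) = Y + 2 * d * Z + (\<Sum>f\<in>K. ?W f)" .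
  have "(\<Sum>f\<in>E. ?W f) = (\<Sum>u\<in>ham_cycles E. real CARD('v) * G (card (u \<inter> M)))"
    unfolding sum_edge_weight
    using ham_cycle_subset ham_cycle_card(1) by (intro sum.cong refl) (simp add: Int_absorb2)
  then have "(\<Sum>f\<in>E. ?W f) = real CARD('v) * Z" unfolding Z_def sum_distrib_left .
  with sE have sK: "(\<Sum>f\<in>K. ?W f) = real CARD('v) * Z - Y - 2 * d * Z" by simp
  show "?W e = (real CARD('v) * Z - Y - 2 * d * Z) / (real (card E) - r - 2 * r * d)"
    if "e \<in> E - M" "e \<subseteq> \<Union>M" for e
  proof -
    have "?W f = ?W e" if "f \<in> K" for f
      using edge_weight_other_edges[OF M(1,2), of f e G] that \<open>e \<in> E - M\<close> \<open>e \<subseteq> \<Union>M\<close> unfolding K_def by simp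
    then have "(\<Sum>f\<in>K. ?W f) = real (card K) * ?W e" by (rule const)
    then show ?thesis using sK cK size by (simp add: field_simps)
  qed
qed

lemma rotation_sum:
  fixes G :: "nat \<Rightarrow> real"
  defines "r \<equiv> real (CARD('v) div 2)" and "d \<equiv> real (CARD('v) mod 2)" and "N \<equiv> real CARD('v)"
  assumes vs: "vs \<in> enumerations E" and e: "e \<in> E"
    and degree: "\<And>z. odd CARD('v) \<Longrightarrow> card {e \<in> E. z \<in> e} = 2 * (CARD('v) div 2)"
    and size: "real (card E) - r - 2 * r * d > 0"
    and Z: "\<And>M. is_matching M \<Longrightarrow> M \<subseteq> E \<Longrightarrow> card M = CARD('v) div 2 \<Longrightarrow>
      (\<Sum>u\<in>ham_cycles E. G (card (u \<inter> M))) = Z"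
    and Y: "\<And>M. is_matching M \<Longrightarrow> M \<subseteq> E \<Longrightarrow> card M = CARD('v) div 2 \<Longrightarrow>
      (\<Sum>u\<in>ham_cycles E. real (card (u \<inter> M)) * G (card (u \<inter> M))) = Y"
  defines "a \<equiv> Y / r" and "b \<equiv> Z / r" and "c \<equiv> (N * Z - Y - 2 * d * Z) / (real (card E) - r - 2 * r * d)"
  shows "(\<Sum>t<CARD('v). edge_weight G (alternate_edges (rotate t vs)) e)
    = (if e \<in> cycle_edges vs then r * (a - c) else 0) + (2 * d * b + (N - 2 * d) * c)"
proof -
  define n where "n = CARD('v)"
  define M where "M t = alternate_edges (rotate t vs)" for t
  have rot: "rotate t vs \<in> enumerations E" for t by (rule enumerations_rotate[OF vs])
  note pv = enumerations_props[OF vs]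
  note p = enumerations_props[OF rot]
  have M: "is_matching (M t)" "M t \<subseteq> cycle_edges vs" "M t \<subseteq> E" "card (M t) = n div 2" for t
    using alternate_edges_matching[OF p(1)] alternate_edges_subset[of "rotate t vs"] p(6)[of t]
      card_alternate_edges[OF p(1,4), of t] p(3)[of t] pv(6)
    by (auto simp: M_def cycle_edges_rotate n_def)
  have un: "UNIV - \<Union>(M t) = (if even n then {} else {last (rotate t vs)})" for t
    using unmatched_alternate_edges[OF p(1,2), of t] p(3)[of t] by (simp add: M_def n_def)
  have w: "edge_weight G (M t) e = (if e \<in> M t then a else if \<not> e \<subseteq> \<Union>(M t) then b else c)" for t
  proof -
    note c = M(4)[of t, unfolded n_def]
    note pr = edge_weight_profile[where M = "M t" and z = "last (rotate t vs)" and G = G and e = e,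
        OF M(1) M(3) c un[unfolded n_def] degree size[unfolded r_def d_def],
        unfolded Z[OF M(1) M(3) c] Y[OF M(1) M(3) c]]
    show ?thesis using pr e by (auto simp: a_def b_def c_def N_def r_def d_def)
  qed
  define T1 where "T1 = {t \<in> {..<n}. e \<in> M t}"
  define T2 where "T2 = {t \<in> {..<n}. \<not> e \<subseteq> \<Union>(M t)}"
  have dis: "T1 \<inter> T2 = {}" unfolding T1_def T2_def by auto
  have c1: "real (card T1) = (if e \<in> cycle_edges vs then r else 0)"
  proof (cases "e \<in> cycle_edges vs")
    case True
    then show ?thesis
      using card_rotations_containing[OF pv(1,4) True] pv(3) by (simp add: T1_def M_def n_def r_def)
  next
    case False
    then have "T1 = {}" using M(2) unfolding T1_def by auto
    then show ?thesis using False by simp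
  qed
  have c2: "real (card T2) = 2 * d"
  proof (cases "even n")
    case True
    then have "T2 = {}" using un unfolding T2_def by auto
    then show ?thesis using True by (simp add: d_def n_def)
  next
    case False
    have "\<not> e \<subseteq> \<Union>(M t) \<longleftrightarrow> last (rotate t vs) \<in> e" for t
    proof -
      have "e \<subseteq> \<Union>(M t) \<longleftrightarrow> e \<inter> (UNIV - \<Union>(M t)) = {}" by blast
      also have "UNIV - \<Union>(M t) = {last (rotate t vs)}" using un[of t] False by simp
      finally show ?thesis by simp
    qed
    then have "card T2 = card e"
      using card_rotations_last[OF pv(1,2,5), of e] pv(3) by (simp add: T2_def n_def)
    then show ?thesis using card_edge[OF e] False by (simp add: d_def n_def odd_iff_mod_2_eq_one)
  qed
  have "(\<Sum>t<n. edge_weight G (M t) e) = (\<Sum>t<n. c + (if t \<in> T1 then a - c else 0) + (if t \<in> T2 then b - c else 0))"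
    unfolding w using dis by (intro sum.cong refl) (auto simp: T1_def T2_def)
  also have "\<dots> = real n * c + real (card T1) * (a - c) + real (card T2) * (b - c)"
  proof -
    have "{..<n} \<inter> T1 = T1" "{..<n} \<inter> T2 = T2" by (auto simp: T1_def T2_def)
    then show ?thesis by (simp add: sum.distrib sum.If_cases)
  qed
  finally show ?thesis unfolding c1 c2
    by (cases "e \<in> cycle_edges vs") (simp_all add: M_def n_def N_def algebra_simps)
qed

end

(*#PART D*)
lemma dual_spaceD:
  assumes "l \<in> dual_space V"
  shows "x \<in> V \<Longrightarrow> y \<in> V \<Longrightarrow> l (x + y) = l x + l y" and "x \<in> V \<Longrightarrow> l (c *\<^sub>R x) = c * l x"
    and "x \<notin> V \<Longrightarrow> l x = undefined"
  using assms by (auto simp: dual_space_def extensional_def)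

lemma dual_space_sum:
  assumes l: "l \<in> dual_space V" and V: "subspace V" and x: "\<And>i. i \<in> I \<Longrightarrow> x i \<in> V" and I: "finite I"
  shows "l (\<Sum>i\<in>I. c i *\<^sub>R x i) = (\<Sum>i\<in>I. c i * l (x i))"
  using I x
proof (induction I rule: finite_induct)
  case empty
  have "l (0 *\<^sub>R 0) = 0 * l 0" by (rule dual_spaceD(2)[OF l subspace_0[OF V]])
  then show ?case by simp
next
  case (insert i I)
  have "(\<Sum>i\<in>I. c i *\<^sub>R x i) \<in> V" using insert.prems by (intro subspace_sum[OF V] subspace_scale[OF V]) auto
  moreover have "c i *\<^sub>R x i \<in> V" using insert.prems by (intro subspace_scale[OF V]) auto
  ultimately show ?case
    using insert dual_spaceD(1)[OF l] dual_spaceD(2)[OF l, of "x i" "c i"] by simp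
qed

lemma adj_matrix_in_span: "u \<in> ham_cycles E \<Longrightarrow> adj_matrix u \<in> ts_span E"
  unfolding ts_span_def by (simp add: span_base)

lemma subspace_ts_span: "subspace (ts_span E)"
  unfolding ts_span_def by simp

lemma ts_barycenter_sum:
  "ts_barycenter E = (\<Sum>u\<in>ham_cycles E. (1 / real (card (ham_cycles E))) *\<^sub>R adj_matrix u)"
  unfolding ts_barycenter_def uniform_count_measure_def
  by (subst lebesgue_integral_point_measure_finite) simp_all

lemma ts_barycenter_in_span: "ts_barycenter E \<in> ts_span E"
  unfolding ts_barycenter_sum
  by (intro subspace_sum[OF subspace_ts_span] subspace_scale[OF subspace_ts_span] adj_matrix_in_span)

lemma ts_g_dual: "ts_g E \<in> dual_space (ts_span E)" for E :: "'v::finite set set"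
proof -
  define S where "S A = (\<Sum>i\<in>UNIV. \<Sum>j\<in>UNIV. A $ i $ j)" for A :: "real^'v^'v"
  have S: "S (A + B) = S A + S B" "S (c *\<^sub>R A) = c * S A" for A B c
    by (simp_all add: S_def sum.distrib sum_distrib_left)
  have "ts_g E = (\<lambda>A\<in>ts_span E. 1 / (2 * real CARD('v)) * S A)" by (simp add: ts_g_def S_def)
  then show ?thesis
    unfolding dual_space_def
    by (simp add: subspace_add[OF subspace_ts_span] subspace_scale[OF subspace_ts_span] S add_divide_distrib)
qed

lemma ts_dual_coneI:
  assumes l: "l \<in> dual_space (ts_span E)" and pos: "\<And>u. u \<in> ham_cycles E \<Longrightarrow> 0 \<le> l (adj_matrix u)"
  shows "l \<in> ts_dual_cone E"
proof -
  let ?K = "{x \<in> ts_span E. 0 \<le> l x}"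
  have l0: "l 0 = 0" using dual_spaceD(2)[OF l subspace_0[OF subspace_ts_span], of 0] by simp
  have "convex_cone ?K"
    unfolding convex_cone_def
  proof (intro conjI)
    show "?K \<noteq> {}" using subspace_0[OF subspace_ts_span, of E] l0 by auto
    show "convex ?K"
    proof (rule convexI)
      fix x y :: "real^'a^'a" and a b :: real
      assume *: "x \<in> ?K" "y \<in> ?K" "0 \<le> a" "0 \<le> b"
      then have "a *\<^sub>R x \<in> ts_span E" "b *\<^sub>R y \<in> ts_span E" by (auto intro: subspace_scale[OF subspace_ts_span])
      then show "a *\<^sub>R x + b *\<^sub>R y \<in> ?K"
        using * dual_spaceD[OF l] by (auto intro: subspace_add[OF subspace_ts_span])
    qed
    show "conic ?K"
      unfolding conic_def using dual_spaceD(2)[OF l] by (auto intro: subspace_scale[OF subspace_ts_span])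
  qed
  moreover have "adj_matrix ` ham_cycles E \<subseteq> ?K" using pos adj_matrix_in_span by auto
  ultimately have "ts_cone E \<subseteq> ?K" unfolding ts_cone_def by (intro hull_minimal)
  then show ?thesis using l by (auto simp: ts_dual_cone_def)
qed

lemma scaling_constant_le:
  fixes E :: "'v::finite set set"
  assumes ne: "ham_cycles E \<noteq> {}" and g: "\<And>u. u \<in> ham_cycles E \<Longrightarrow> ts_g E (adj_matrix u) = 1"
    and \<beta>: "0 \<le> \<beta>" and low: "\<And>l u. l \<in> ts_B_dual_approx E F \<Longrightarrow> u \<in> ham_cycles E \<Longrightarrow> - \<beta> \<le> l (adj_matrix u)"
  shows "scaling_constant E F \<le> ereal (1 + \<beta>)"
proof -
  let ?V = "ts_span E"
  have c0: "real (card (ham_cycles E)) \<noteq> 0" using ne by simp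
  have gb: "ts_g E (ts_barycenter E) = 1"
  proof -
    have "ts_g E (ts_barycenter E) = (\<Sum>u\<in>ham_cycles E. 1 / real (card (ham_cycles E)) * ts_g E (adj_matrix u))"
      unfolding ts_barycenter_sum by (rule dual_space_sum[OF ts_g_dual subspace_ts_span adj_matrix_in_span finite])
    then show ?thesis using g c0 by simp
  qed
  have "(\<lambda>l. \<lambda>x\<in>?V. 1 / (1 + \<beta>) * (l x - ts_g E x)) ` ts_B_dual_approx E F
      \<subseteq> (\<lambda>l. \<lambda>x\<in>?V. l x - ts_g E x) ` ts_B_dual E"
  proof (rule image_subsetI)
    fix l assume l: "l \<in> ts_B_dual_approx E F"
    then have ld: "l \<in> dual_space ?V" and lb: "l (ts_barycenter E) = 1"
      by (auto simp: ts_B_dual_approx_def ts_Lambda_dual_def)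
    define l' where "l' = (\<lambda>x\<in>?V. 1 / (1 + \<beta>) * (l x - ts_g E x) + ts_g E x)"
    have l'd: "l' \<in> dual_space ?V"
      unfolding dual_space_def l'_def
      using dual_spaceD[OF ld] dual_spaceD[OF ts_g_dual[of E]]
      by (auto simp: subspace_add[OF subspace_ts_span] subspace_scale[OF subspace_ts_span] algebra_simps add_divide_distrib)
    have "0 \<le> l' (adj_matrix u)" if u: "u \<in> ham_cycles E" for u
    proof -
      have "- 1 \<le> (l (adj_matrix u) - 1) / (1 + \<beta>)"
        using low[OF l u] \<beta> by (simp add: pos_le_divide_eq)
      then show ?thesis using adj_matrix_in_span[OF u] g[OF u] by (simp add: l'_def)
    qed
    then have "l' \<in> ts_dual_cone E" by (rule ts_dual_coneI[OF l'd])
    moreover have "l' (ts_barycenter E) = 1" using ts_barycenter_in_span[of E] lb gb by (simp add: l'_def)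
    ultimately have mem: "l' \<in> ts_B_dual E" using l'd by (simp add: ts_B_dual_def ts_Lambda_dual_def)
    have eq: "(\<lambda>x\<in>?V. 1 / (1 + \<beta>) * (l x - ts_g E x)) = (\<lambda>x\<in>?V. l' x - ts_g E x)"
      by (rule restrict_ext) (simp add: l'_def)
    show "(\<lambda>x\<in>?V. 1 / (1 + \<beta>) * (l x - ts_g E x)) \<in> (\<lambda>l. \<lambda>x\<in>?V. l x - ts_g E x) ` ts_B_dual E"
      unfolding eq using mem by (rule imageI)
  qed
  then show ?thesis
    unfolding scaling_constant_def using \<beta> by (intro Inf_lower imageI) simp
qed

lemma finite_exponents: "finite {m :: 'a::finite \<Rightarrow> nat. (\<Sum>e\<in>UNIV. m e) = k}"
proof (rule finite_subset)
  show "{m :: 'a \<Rightarrow> nat. (\<Sum>e\<in>UNIV. m e) = k} \<subseteq> {m. \<forall>x. (x \<in> UNIV \<longrightarrow> m x \<in> {..k}) \<and> (x \<notin> UNIV \<longrightarrow> m x = 0)}"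
  proof (intro subsetI CollectI allI conjI impI)
    fix m :: "'a \<Rightarrow> nat" and x assume "m \<in> {m. (\<Sum>e\<in>UNIV. m e) = k}"
    then show "m x \<in> {..k}" using member_le_sum[of x UNIV m] by simp
  qed simp
  show "finite {m :: 'a \<Rightarrow> nat. \<forall>x. (x \<in> UNIV \<longrightarrow> m x \<in> {..k}) \<and> (x \<notin> UNIV \<longrightarrow> m x = 0)}"
    by (rule finite_set_of_finite_funs) auto
qed

lemma ts_F_I: "(\<lambda>u\<in>ham_cycles E. hom_poly k a (adj_matrix u)) \<in> ts_F E k"
  unfolding ts_F_def by blast

lemma ts_F_linear_combination:
  assumes "finite I" "\<And>i. i \<in> I \<Longrightarrow> (\<lambda>u\<in>ham_cycles E. f i u) \<in> ts_F E k"
  shows "(\<lambda>u\<in>ham_cycles E. \<Sum>i\<in>I. c i * f i u) \<in> ts_F E k"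
proof -
  have "\<exists>a. \<forall>u\<in>ham_cycles E. f i u = hom_poly k a (adj_matrix u)" if "i \<in> I" for i
  proof -
    have "(\<lambda>u\<in>ham_cycles E. f i u) \<in> ts_F E k" by (rule assms(2)[OF that])
    then obtain a where a: "(\<lambda>u\<in>ham_cycles E. f i u) = (\<lambda>u\<in>ham_cycles E. hom_poly k a (adj_matrix u))"
      unfolding ts_F_def by blast
    have "f i u = hom_poly k a (adj_matrix u)" if "u \<in> ham_cycles E" for u
      using fun_cong[OF a, of u] that by simp
    then show ?thesis by blast
  qed
  then obtain a where a: "\<And>i u. i \<in> I \<Longrightarrow> u \<in> ham_cycles E \<Longrightarrow> f i u = hom_poly k (a i) (adj_matrix u)"
    by metis
  have "(\<lambda>u\<in>ham_cycles E. \<Sum>i\<in>I. c i * f i u)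
      = (\<lambda>u\<in>ham_cycles E. hom_poly k (\<lambda>m. \<Sum>i\<in>I. c i * a i m) (adj_matrix u))"
  proof (rule restrict_ext)
    fix u assume u: "u \<in> ham_cycles E"
    have "(\<Sum>i\<in>I. c i * f i u) = (\<Sum>i\<in>I. c i * hom_poly k (a i) (adj_matrix u))"
      using a u by (intro sum.cong) auto
    also have "\<dots> = hom_poly k (\<lambda>m. \<Sum>i\<in>I. c i * a i m) (adj_matrix u)"
      unfolding hom_poly_def by (simp only: sum_distrib_left sum_distrib_right sum.swap[of _ I] mult.assoc)
    finally show "(\<Sum>i\<in>I. c i * f i u) = hom_poly k (\<lambda>m. \<Sum>i\<in>I. c i * a i m) (adj_matrix u)" .
  qed
  then show ?thesis using ts_F_I[where E = E and k = k] by simp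
qed

lemma prod_list_eq_prod_count:
  fixes f :: "'a::finite \<Rightarrow> real"
  shows "(\<Prod>x\<in>UNIV. f x ^ count_list xs x) = prod_list (map f xs)"
proof (induction xs)
  case (Cons y ys)
  have "(\<Prod>x\<in>UNIV. f x ^ count_list (y # ys) x) = (\<Prod>x\<in>UNIV. (if x = y then f x else 1) * f x ^ count_list ys x)"
    by (intro prod.cong) auto
  also have "\<dots> = f y * (\<Prod>x\<in>UNIV. f x ^ count_list ys x)"
    by (simp add: prod.distrib prod.delta)
  finally show ?case using Cons by simp
qed simp

lemma monomial_in_ts_F:
  fixes E :: "'v::finite set set"
  assumes "length es = k"
  shows "(\<lambda>u\<in>ham_cycles E. prod_list (map (\<lambda>e. adj_matrix u $ fst e $ snd e) es)) \<in> ts_F E k"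
proof -
  define m0 where "m0 = count_list es"
  have "(\<Sum>e\<in>UNIV. m0 e) = k"
    unfolding m0_def using sum_count_set[of es UNIV] assms by simp
  then have "hom_poly k (\<lambda>m. if m = m0 then 1 else 0) A = prod_list (map (\<lambda>e. A $ fst e $ snd e) es)"
    for A :: "real^'v^'v"
    unfolding hom_poly_def m0_def[symmetric] prod_list_eq_prod_count[symmetric, of _ es]
    by (simp add: if_distrib[of "\<lambda>x. x * _"] sum.delta[OF finite_exponents] cong: if_cong)
  then show ?thesis using ts_F_I[of k "\<lambda>m. if m = m0 then 1 else 0" E] by simp
qed


lemma prod_indicator_list:
  "prod_list (map (\<lambda>x. if P x then 1 else 0 :: real) xs) = (if \<forall>x\<in>set xs. P x then 1 else 0)"
  by (induction xs) auto

lemma containing_indicator_in_ts_F: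
  fixes E :: "'v::finite set set"
  assumes S: "\<And>e. e \<in> S \<Longrightarrow> card e = 2" and k: "card S + length ps = k"
  shows "(\<lambda>u\<in>ham_cycles E. (if S \<subseteq> u then 1 else 0) * prod_list (map (\<lambda>e. adj_matrix u $ fst e $ snd e) ps)) \<in> ts_F E k"
proof -
  obtain xs where xs: "set xs = S" "distinct xs" using finite_distinct_list[of S] by auto
  have "\<exists>p. e = {fst p, snd p}" if "e \<in> S" for e
    using S[OF that] by (auto simp: card_2_iff)
  then obtain o' where o': "\<And>e. e \<in> S \<Longrightarrow> e = {fst (o' e), snd (o' e)}" by metis
  have l: "length (map o' xs @ ps) = k" using k xs distinct_card[of xs] by simp
  have "prod_list (map (\<lambda>e. adj_matrix u $ fst e $ snd e) (map o' xs)) = (if S \<subseteq> u then 1 else 0)"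
    for u :: "'v set set"
  proof -
    have "map (\<lambda>e. adj_matrix u $ fst e $ snd e) (map o' xs) = map (\<lambda>e. if e \<in> u then 1 else 0) xs"
      unfolding map_map comp_def
      by (rule map_cong[OF refl]) (use o' xs in \<open>simp add: adj_matrix_def\<close>)
    then have "prod_list (map (\<lambda>e. adj_matrix u $ fst e $ snd e) (map o' xs))
        = (if \<forall>x\<in>set xs. x \<in> u then 1 else 0)"
      by (simp only: prod_indicator_list)
    then show ?thesis using xs by (simp add: subset_iff)
  qed
  then show ?thesis
    using monomial_in_ts_F[OF l, of E] by (simp add: restrict_def cong: if_cong)
qed

lemma real_binomial_as_sum:
  assumes "finite M"
  shows "real (card (u \<inter> M) choose k) = (\<Sum>S\<in>{S. S \<subseteq> M \<and> card S = k}. if S \<subseteq> u then 1 else 0)"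
proof -
  have fin: "finite {S. S \<subseteq> M \<and> card S = k}" using assms by (auto intro: finite_subset[of _ "Pow M"])
  have "(\<Sum>S\<in>{S. S \<subseteq> M \<and> card S = k}. if S \<subseteq> u then 1 else 0 :: real)
      = real (card {S \<in> {S. S \<subseteq> M \<and> card S = k}. S \<subseteq> u})"
    using fin by (simp flip: sum.inter_filter)
  also have "{S \<in> {S. S \<subseteq> M \<and> card S = k}. S \<subseteq> u} = {S. S \<subseteq> u \<inter> M \<and> card S = k}" by auto
  also have "card \<dots> = (card (u \<inter> M) choose k)" using assms by (intro n_subsets) auto
  finally show ?thesis by simp
qed

context two_sided_graph
begin

lemma adj_matrix_entry_sum:
  assumes "u \<in> ham_cycles E"
  shows "(\<Sum>i\<in>UNIV. \<Sum>j\<in>UNIV. adj_matrix u $ i $ j) = 2 * real CARD('v)"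
proof -
  have row: "(\<Sum>j\<in>UNIV. adj_matrix u $ i $ j) = 2" for i
  proof -
    have inj: "inj_on (\<lambda>j. {i, j}) {j. {i, j} \<in> u}"
      by (rule inj_onI) (auto simp: doubleton_eq_iff)
    have "(\<lambda>j. {i, j}) ` {j. {i, j} \<in> u} = {e \<in> u. i \<in> e}"
    proof (intro equalityI subsetI)
      fix e assume e: "e \<in> {e \<in> u. i \<in> e}"
      then have "e \<in> E" using ham_cycle_subset[OF assms] by auto
      then obtain x y where xy: "e = {x, y}" by (rule edgeE)
      then have "e = {i, x} \<or> e = {i, y}" using e by auto
      then show "e \<in> (\<lambda>j. {i, j}) ` {j. {i, j} \<in> u}" using e by auto
    qed auto
    then have "card {j. {i, j} \<in> u} = 2"
      using card_image[OF inj] ham_cycle_card(2)[OF assms, of i] by simp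
    then show ?thesis by (simp add: adj_matrix_def sum.If_cases)
  qed
  show ?thesis unfolding row by simp
qed

lemma ts_g_ham_cycle: "u \<in> ham_cycles E \<Longrightarrow> ts_g E (adj_matrix u) = 1"
  using adj_matrix_entry_sum adj_matrix_in_span[of u E] by (simp add: ts_g_def)

lemma test_function_in_ts_F:
  assumes M: "is_matching M" and k: "1 \<le> k"
  shows "(\<lambda>u\<in>ham_cycles E. real (card (u \<inter> M) choose k) + c * real (card (u \<inter> M) choose (k - 1))) \<in> ts_F E k"
proof -
  let ?H = "ham_cycles E"
  define A where "A i = {S. S \<subseteq> M \<and> card S = i}" for i
  have fin: "finite (A i)" for i by simp
  have c2: "card e = 2" if "S \<in> A i" "e \<in> S" for S i e
    using M that by (auto simp: A_def is_matching_def)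
  have 1: "(\<lambda>u\<in>?H. if S \<subseteq> u then 1 else 0) \<in> ts_F E k" if "S \<in> A k" for S
    using containing_indicator_in_ts_F[of S "[]" k E] c2[OF that] that by (simp add: A_def)
  have 2: "(\<lambda>u\<in>?H. (if S \<subseteq> u then 1 else 0) * adj_matrix u $ fst p $ snd p) \<in> ts_F E k"
    if "S \<in> A (k - 1)" for S p
    using containing_indicator_in_ts_F[of S "[p]" k E] c2[OF that] that k by (simp add: A_def)
  have g1: "(\<lambda>u\<in>?H. real (card (u \<inter> M) choose k)) \<in> ts_F E k"
    using ts_F_linear_combination[OF fin 1, where c = "\<lambda>_. 1"] by (simp add: real_binomial_as_sum A_def)
  have "(\<lambda>u\<in>?H. \<Sum>q\<in>A (k - 1) \<times> UNIV. 1 / (2 * real CARD('v)) *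
      ((if fst q \<subseteq> u then 1 else 0) * adj_matrix u $ fst (snd q) $ snd (snd q))) \<in> ts_F E k"
    by (rule ts_F_linear_combination) (use 2 in auto)
  also have "(\<lambda>u\<in>?H. \<Sum>q\<in>A (k - 1) \<times> UNIV. 1 / (2 * real CARD('v)) *
      ((if fst q \<subseteq> u then 1 else 0) * adj_matrix u $ fst (snd q) $ snd (snd q)))
      = (\<lambda>u\<in>?H. real (card (u \<inter> M) choose (k - 1)))"
  proof (rule restrict_ext)
    fix u assume u: "u \<in> ?H"
    have tot: "(\<Sum>p\<in>UNIV. adj_matrix u $ fst p $ snd p) = 2 * real CARD('v)"
      using adj_matrix_entry_sum[OF u]
      by (simp add: sum.cartesian_product UNIV_Times_UNIV[symmetric] case_prod_unfold del: UNIV_Times_UNIV)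
    have "(\<Sum>q\<in>A (k - 1) \<times> UNIV. 1 / (2 * real CARD('v)) *
        ((if fst q \<subseteq> u then 1 else 0) * adj_matrix u $ fst (snd q) $ snd (snd q)))
      = (\<Sum>S\<in>A (k - 1). \<Sum>p\<in>UNIV. 1 / (2 * real CARD('v)) * ((if S \<subseteq> u then 1 else 0) * adj_matrix u $ fst p $ snd p))"
      unfolding sum.cartesian_product by (simp only: case_prod_unfold)
    also have "\<dots> = (\<Sum>S\<in>A (k - 1). if S \<subseteq> u then 1 else 0)"
      unfolding sum_distrib_left[symmetric] tot sum_distrib_right[symmetric] by simp
    also have "\<dots> = real (card (u \<inter> M) choose (k - 1))"
      by (simp add: real_binomial_as_sum A_def)
    finally show "(\<Sum>q\<in>A (k - 1) \<times> UNIV. 1 / (2 * real CARD('v)) *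
        ((if fst q \<subseteq> u then 1 else 0) * adj_matrix u $ fst (snd q) $ snd (snd q)))
      = real (card (u \<inter> M) choose (k - 1))" .
  qed
  finally have g2: "(\<lambda>u\<in>?H. real (card (u \<inter> M) choose (k - 1))) \<in> ts_F E k" .
  have "(\<lambda>u\<in>?H. \<Sum>b\<in>UNIV. (if b then 1 else c) *
      (if b then real (card (u \<inter> M) choose k) else real (card (u \<inter> M) choose (k - 1)))) \<in> ts_F E k"
  proof (rule ts_F_linear_combination)
    fix b :: bool
    show "(\<lambda>u\<in>?H. if b then real (card (u \<inter> M) choose k) else real (card (u \<inter> M) choose (k - 1))) \<in> ts_F E k"
      using g1 g2 by (cases b) simp_all
  qed simp
  then show ?thesis by (simp add: UNIV_bool add.commute)
qed

lemma binomial_moment: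
  assumes M: "is_matching M" "M \<subseteq> E" and i: "1 \<le> i"
    and count: "\<And>S. is_matching S \<Longrightarrow> S \<subseteq> E \<Longrightarrow> S \<noteq> {} \<Longrightarrow>
      real (card {u \<in> ham_cycles E. S \<subseteq> u}) = \<kappa> * h (card S)"
  shows "(\<Sum>u\<in>ham_cycles E. real (card (u \<inter> M) choose i)) = \<kappa> * (real (card M choose i) * h i)"
proof -
  have "(\<Sum>u\<in>ham_cycles E. real (card (u \<inter> M) choose i))
      = (\<Sum>S\<in>{S. S \<subseteq> M \<and> card S = i}. \<Sum>u\<in>ham_cycles E. if S \<subseteq> u then 1 else 0)"
    by (simp only: real_binomial_as_sum[OF finite] sum.swap[of _ "ham_cycles E"])
  also have "\<dots> = (\<Sum>S\<in>{S. S \<subseteq> M \<and> card S = i}. \<kappa> * h i)"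
  proof (rule sum.cong[OF refl])
    fix S assume S: "S \<in> {S. S \<subseteq> M \<and> card S = i}"
    then have "S \<noteq> {}" "S \<subseteq> E" "is_matching S" using i M is_matching_subset[OF M(1)] by auto
    then have "real (card {u \<in> ham_cycles E. S \<subseteq> u}) = \<kappa> * h i" using count S by auto
    then show "(\<Sum>u\<in>ham_cycles E. if S \<subseteq> u then 1 else 0) = \<kappa> * h i"
      by (simp flip: sum.inter_filter)
  qed
  also have "\<dots> = real (card M choose i) * (\<kappa> * h i)"
    using n_subsets[of M i] by simp
  finally show ?thesis by simp
qed

lemma times_binomial: "real j * real (j choose i) = real i * real (j choose i) + real (Suc i) * real (j choose Suc i)"
  using Suc_times_binomial_Suc[of i j] by (simp add: algebra_simps)

lemma graph_scaling:
  fixes w h :: "nat \<Rightarrow> real"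
  defines "r \<equiv> real (CARD('v) div 2)" and "d \<equiv> real (CARD('v) mod 2)" and "N \<equiv> real CARD('v)"
  assumes k: "1 \<le> k"
    and square: "\<And>j. (real (j choose k) + q * real (j choose (k - 1)))\<^sup>2 = (\<Sum>i = 1..2 * k. w i * real (j choose i))"
    and \<kappa>: "0 < \<kappa>"
    and count: "\<And>S. is_matching S \<Longrightarrow> S \<subseteq> E \<Longrightarrow> S \<noteq> {} \<Longrightarrow>
      real (card {u \<in> ham_cycles E. S \<subseteq> u}) = \<kappa> * h (card S)"
    and nonempty: "ham_cycles E \<noteq> {}"
    and degree: "\<And>z. odd CARD('v) \<Longrightarrow> card {e \<in> E. z \<in> e} = 2 * (CARD('v) div 2)"
    and size: "0 < real (card E) - r - 2 * r * d"
  defines "m \<equiv> \<lambda>i. real (CARD('v) div 2 choose i) * h i"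
  defines "Z \<equiv> \<Sum>i = 1..2 * k. w i * m i" and "Y \<equiv> \<Sum>i = 1..2 * k. w i * size_biased m i"
  defines "a \<equiv> Y / r" and "b \<equiv> Z / r" and "c \<equiv> (N * Z - Y - 2 * d * Z) / (real (card E) - r - 2 * r * d)"
  assumes gap: "c < a"
  shows "scaling_constant E (ts_F E k) \<le> ereal (1 + (2 * d * b + (N - 2 * d) * c) * real (card E) / (N * (r * (a - c))))"
proof (rule scaling_constant_le[OF nonempty ts_g_ham_cycle])
  let ?H = "ham_cycles E"
  define B where "B = 2 * d * b + (N - 2 * d) * c"
  define G where "G j = (real (j choose k) + q * real (j choose (k - 1)))\<^sup>2" for j
  define D where "D = r * (a - c)"
  have r: "0 < r" and N: "0 < N" using three by (simp_all add: r_def N_def)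
  have D: "0 < D" using r gap by (simp add: D_def)
  have cE: "0 < real (card E)"
  proof -
    have "0 \<le> r + 2 * r * d" using r by (simp add: d_def)
    then show ?thesis using size by linarith
  qed
  have GS: "(\<Sum>u\<in>?H. f u * G (card (u \<inter> X))) = (\<Sum>i = 1..2 * k. w i * (\<Sum>u\<in>?H. f u * real (card (u \<inter> X) choose i)))"
    for f X
    unfolding G_def square sum_distrib_left by (subst sum.swap) (simp only: mult_ac)
  have sums: "(\<Sum>u\<in>?H. G (card (u \<inter> X))) = \<kappa> * Z"
    "(\<Sum>u\<in>?H. real (card (u \<inter> X)) * G (card (u \<inter> X))) = \<kappa> * Y"
    if X: "is_matching X" "X \<subseteq> E" "card X = CARD('v) div 2" for X
  proof -
    have mom: "(\<Sum>u\<in>?H. real (card (u \<inter> X) choose i)) = \<kappa> * m i" if "1 \<le> i" for i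
      using binomial_moment[OF X(1,2) that count] X(3) by (simp add: m_def)
    have "(\<Sum>u\<in>?H. G (card (u \<inter> X))) = (\<Sum>i = 1..2 * k. w i * (\<Sum>u\<in>?H. real (card (u \<inter> X) choose i)))"
      using GS[of "\<lambda>_. 1" X] by simp
    also have "\<dots> = (\<Sum>i = 1..2 * k. w i * (\<kappa> * m i))" using mom by (intro sum.cong) auto
    finally show "(\<Sum>u\<in>?H. G (card (u \<inter> X))) = \<kappa> * Z"
      by (simp add: Z_def sum_distrib_left mult_ac)
    have "(\<Sum>u\<in>?H. real (card (u \<inter> X)) * G (card (u \<inter> X)))
        = (\<Sum>i = 1..2 * k. w i * (\<Sum>u\<in>?H. real (card (u \<inter> X)) * real (card (u \<inter> X) choose i)))"
      by (rule GS)
    also have "\<dots> = (\<Sum>i = 1..2 * k. w i * (\<kappa> * size_biased m i))"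
    proof (intro sum.cong refl arg_cong2[where f = "(*)"])
      fix i assume i: "i \<in> {1..2 * k}"
      have "(\<Sum>u\<in>?H. real (card (u \<inter> X)) * real (card (u \<inter> X) choose i))
          = real i * (\<kappa> * m i) + real (Suc i) * (\<kappa> * m (Suc i))"
        unfolding times_binomial sum.distrib sum_distrib_left[symmetric] using mom i by simp
      then show "(\<Sum>u\<in>?H. real (card (u \<inter> X)) * real (card (u \<inter> X) choose i)) = \<kappa> * size_biased m i"
        by (simp add: size_biased_def algebra_simps)
    qed
    finally show "(\<Sum>u\<in>?H. real (card (u \<inter> X)) * G (card (u \<inter> X))) = \<kappa> * Y"
      by (simp add: Y_def sum_distrib_left mult_ac)
  qed
  obtain vs0 where vs0: "vs0 \<in> enumerations E" using nonempty unfolding ham_cycles_eq_image[OF three] by blast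
  note p0 = enumerations_props[OF vs0]
  define M0 where "M0 = alternate_edges vs0"
  have M0: "is_matching M0" "M0 \<subseteq> E" "card M0 = CARD('v) div 2"
    using alternate_edges_matching[OF p0(1)] alternate_edges_subset[of vs0] p0(6) card_alternate_edges[OF p0(1,4)] p0(3)
    by (auto simp: M0_def)
  have G0: "0 \<le> G j" for j by (simp add: G_def)
  have "0 \<le> \<kappa> * Z" unfolding sums(1)[OF M0, symmetric] using G0 by (intro sum_nonneg) auto
  then have Z0: "0 \<le> Z" using \<kappa> by (simp add: zero_le_mult_iff)
  have "\<kappa> * Y \<le> (\<Sum>u\<in>?H. r * G (card (u \<inter> M0)))"
    unfolding sums(2)[OF M0, symmetric]
  proof (intro sum_mono mult_right_mono G0)
    fix u
    have "card (u \<inter> M0) \<le> card M0" by (intro card_mono) auto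
    then show "real (card (u \<inter> M0)) \<le> r" unfolding M0(3) r_def by simp
  qed
  also have "\<dots> = \<kappa> * (r * Z)" unfolding sum_distrib_left[symmetric] sums(1)[OF M0] by simp
  finally have YZ: "Y \<le> r * Z" using \<kappa> by simp
  have Nrd: "N = 2 * r + d"
  proof -
    have "CARD('v) = 2 * (CARD('v) div 2) + CARD('v) mod 2" by simp
    then show ?thesis unfolding N_def r_def d_def by (metis of_nat_add of_nat_mult of_nat_numeral)
  qed
  have d: "0 \<le> d" "d \<le> r"
  proof -
    have "CARD('v) mod 2 \<le> CARD('v) div 2" using three by linarith
    then show "0 \<le> d" "d \<le> r" by (simp_all add: d_def r_def)
  qed
  have "r * Z \<le> (N - 2 * d) * Z" using Z0 d Nrd by (intro mult_right_mono) auto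
  also have "\<dots> = N * Z - 2 * d * Z" by (simp add: algebra_simps)
  finally have "0 \<le> N * Z - Y - 2 * d * Z" using YZ by linarith
  then have c0: "0 \<le> c" unfolding c_def using size by (intro divide_nonneg_pos) auto
  have "0 \<le> N - 2 * d" using d Nrd r by linarith
  then have nonneg: "0 \<le> 2 * d * b + (N - 2 * d) * c"
    using c0 d Z0 r by (intro add_nonneg_nonneg mult_nonneg_nonneg) (auto simp: b_def)
  show "0 \<le> (2 * d * b + (N - 2 * d) * c) * real (card E) / (N * (r * (a - c)))"
    using nonneg r gap N by (intro divide_nonneg_pos mult_nonneg_nonneg mult_pos_pos) auto
  fix l v assume l: "l \<in> ts_B_dual_approx E (ts_F E k)" and v: "v \<in> ?H"
  have ld: "l \<in> dual_space (ts_span E)" and lb: "l (ts_barycenter E) = 1"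
    and lp: "\<And>p. p \<in> ts_F E k \<Longrightarrow> 0 \<le> (\<integral>u. l (adj_matrix u) * (p u)\<^sup>2 \<partial>uniform_count_measure ?H)"
    using l by (auto simp: ts_B_dual_approx_def ts_Lambda_dual_def ts_dual_cone_approx_def)
  obtain vs where vs: "vs \<in> enumerations E" "v = cycle_edges vs"
    using v unfolding ham_cycles_eq_image[OF three] by blast
  define M where "M t = alternate_edges (rotate t vs)" for t
  have rot: "rotate t vs \<in> enumerations E" for t by (rule enumerations_rotate[OF vs(1)])
  note p = enumerations_props[OF rot]
  have M: "is_matching (M t)" "M t \<subseteq> E" for t
    using alternate_edges_matching[OF p(1)] alternate_edges_subset[of "rotate t vs"] p(6)[of t] by (auto simp: M_def)
  define Q where "Q u = (\<Sum>t<CARD('v). G (card (u \<inter> M t)))" for u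
  have nonneg_t: "0 \<le> (\<Sum>u\<in>?H. l (adj_matrix u) * G (card (u \<inter> M t)))" for t
  proof -
    have "0 \<le> (\<integral>u. l (adj_matrix u) * ((\<lambda>u\<in>?H. real (card (u \<inter> M t) choose k)
        + q * real (card (u \<inter> M t) choose (k - 1))) u)\<^sup>2 \<partial>uniform_count_measure ?H)"
      by (rule lp[OF test_function_in_ts_F[OF M(1) k]])
    also have "\<dots> = (\<Sum>u\<in>?H. l (adj_matrix u) * G (card (u \<inter> M t))) / real (card ?H)"
      by (subst integral_uniform_count_measure) (simp_all add: G_def)
    finally show ?thesis using nonempty by (simp add: zero_le_divide_iff card_gt_0_iff)
  qed
  have Q0: "0 \<le> (\<Sum>u\<in>?H. Q u * l (adj_matrix u))"
  proof -
    have "(\<Sum>u\<in>?H. Q u * l (adj_matrix u)) = (\<Sum>t<CARD('v). \<Sum>u\<in>?H. l (adj_matrix u) * G (card (u \<inter> M t)))"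
      unfolding Q_def sum_distrib_right by (subst sum.swap) (simp only: mult.commute)
    then show ?thesis using nonneg_t by (simp add: sum_nonneg)
  qed
  have weight: "(\<Sum>t<CARD('v). edge_weight G (M t) e) = \<kappa> * ((if e \<in> v then D else 0) + B)" if e: "e \<in> E" for e
  proof -
    have 1: "\<kappa> * Y / r = \<kappa> * a" "\<kappa> * Z / r = \<kappa> * b" by (simp_all add: a_def b_def)
    have 2: "(N * (\<kappa> * Z) - \<kappa> * Y - 2 * d * (\<kappa> * Z)) / (real (card E) - r - 2 * r * d) = \<kappa> * c"
      by (simp add: c_def algebra_simps)
    have "(\<Sum>t<CARD('v). edge_weight G (M t) e)
        = (if e \<in> v then r * (\<kappa> * Y / r - (N * (\<kappa> * Z) - \<kappa> * Y - 2 * d * (\<kappa> * Z)) / (real (card E) - r - 2 * r * d)) else 0)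
          + (2 * d * (\<kappa> * Z / r)
            + (N - 2 * d) * ((N * (\<kappa> * Z) - \<kappa> * Y - 2 * d * (\<kappa> * Z)) / (real (card E) - r - 2 * r * d)))"
      unfolding r_def d_def N_def M_def vs(2)
      by (rule rotation_sum[OF vs(1) e degree size[unfolded r_def d_def] sums])
    then show ?thesis unfolding 1 2 by (cases "e \<in> v") (simp_all add: D_def B_def algebra_simps)
  qed
  have bary: "ts_barycenter E $ i $ j = (if {i, j} \<in> E then N / real (card E) else 0)" for i j
  proof -
    have n: "real (card ?H) \<noteq> 0" using nonempty by simp
    have e1: "ts_barycenter E $ i $ j = real (card {u \<in> ?H. {i, j} \<in> u}) / real (card ?H)"
    proof -
      have "ts_barycenter E $ i $ j = (\<Sum>u\<in>?H. if {i, j} \<in> u then 1 / real (card ?H) else 0)"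
        unfolding ts_barycenter_sum by (simp add: adj_matrix_def if_distrib cong: if_cong)
      also have "\<dots> = real (card {u \<in> ?H. {i, j} \<in> u}) / real (card ?H)"
        by (simp flip: sum.inter_filter)
      finally show ?thesis .
    qed
    show ?thesis
    proof (cases "{i, j} \<in> E")
      case True
      have "real (card E) * real (card {u \<in> ?H. {i, j} \<in> u}) = (\<Sum>e\<in>E. real (card {u \<in> ?H. e \<in> u}))"
      proof -
        have "(\<Sum>e\<in>E. real (card {u \<in> ?H. e \<in> u})) = (\<Sum>e\<in>E. real (card {u \<in> ?H. {i, j} \<in> u}))"
          by (rule sum.cong[OF refl]) (simp only: edge_count_constant[OF _ True])
        then show ?thesis by simp
      qed
      also have "\<dots> = (\<Sum>e\<in>E. edge_weight (\<lambda>_. 1) {} e)" by (simp add: edge_weight_def)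
      also have "\<dots> = real (card ?H) * N"
        unfolding sum_edge_weight using ham_cycle_subset ham_cycle_card(1)
        by (simp add: Int_absorb2 N_def)
      finally have prod: "real (card E) * real (card {u \<in> ?H. {i, j} \<in> u}) = real (card ?H) * N" .
      have cE0: "real (card E) \<noteq> 0" using cE by linarith
      have "real (card {u \<in> ?H. {i, j} \<in> u}) = real (card ?H) * N / real (card E)"
        unfolding nonzero_eq_divide_eq[OF cE0] using prod by (simp only: mult.commute)
      then show ?thesis unfolding e1 using True n by simp
    next
      case False
      then have "{u \<in> ?H. {i, j} \<in> u} = {}" using ham_cycle_subset by blast
      then show ?thesis unfolding e1 using False by simp
    qed
  qed
  have key: "(\<Sum>u\<in>?H. Q u *\<^sub>R adj_matrix u)
      = (\<kappa> * D) *\<^sub>R adj_matrix v + (\<kappa> * B * real (card E) / N) *\<^sub>R ts_barycenter E"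
  proof (intro vec_eq_iff[THEN iffD2] allI)
    fix i j
    have "(\<Sum>u\<in>?H. Q u *\<^sub>R adj_matrix u) $ i $ j = (\<Sum>u\<in>?H. if {i, j} \<in> u then Q u else 0)"
      by (simp add: adj_matrix_def if_distrib cong: if_cong)
    also have "\<dots> = (\<Sum>u\<in>{u \<in> ?H. {i, j} \<in> u}. Q u)" by (simp flip: sum.inter_filter)
    also have "\<dots> = (\<Sum>t<CARD('v). edge_weight G (M t) {i, j})"
      unfolding Q_def edge_weight_def by (rule sum.swap)
    also have "\<dots> = ((\<kappa> * D) *\<^sub>R adj_matrix v + (\<kappa> * B * real (card E) / N) *\<^sub>R ts_barycenter E) $ i $ j"
    proof (cases "{i, j} \<in> E")
      case True
      then have "E \<noteq> {}" by blast
      then show ?thesis using weight[OF True] True N by (simp add: bary adj_matrix_def algebra_simps)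
    next
      case False
      then have none: "{u \<in> ?H. {i, j} \<in> u} = {}" and nv: "{i, j} \<notin> v" using ham_cycle_subset v by blast+
      have "edge_weight G (M t) {i, j} = 0" for t unfolding edge_weight_def none by simp
      then show ?thesis using False nv by (simp add: bary adj_matrix_def)
    qed
    finally show "(\<Sum>u\<in>?H. Q u *\<^sub>R adj_matrix u) $ i $ j
      = ((\<kappa> * D) *\<^sub>R adj_matrix v + (\<kappa> * B * real (card E) / N) *\<^sub>R ts_barycenter E) $ i $ j" .
  qed
  have "(\<Sum>u\<in>?H. Q u * l (adj_matrix u)) = l (\<Sum>u\<in>?H. Q u *\<^sub>R adj_matrix u)"
    by (rule dual_space_sum[OF ld subspace_ts_span adj_matrix_in_span finite, symmetric])
  also have "\<dots> = \<kappa> * D * l (adj_matrix v) + \<kappa> * B * real (card E) / N"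
    unfolding key using adj_matrix_in_span[OF v] ts_barycenter_in_span[of E] lb
    by (simp add: dual_spaceD[OF ld] subspace_scale[OF subspace_ts_span])
  finally have "0 \<le> \<kappa> * (D * l (adj_matrix v) + B * real (card E) / N)" using Q0 by (simp add: algebra_simps)
  then have "0 \<le> D * l (adj_matrix v) + B * real (card E) / N" using \<kappa> by (simp add: zero_le_mult_iff)
  then have "- (B * real (card E) / N) \<le> l (adj_matrix v) * D"
    unfolding mult.commute[of "l (adj_matrix v)"] by linarith
  then have "- (B * real (card E) / N) / D \<le> l (adj_matrix v)" unfolding pos_divide_le_eq[OF D] .
  then show "- ((2 * d * b + (N - 2 * d) * c) * real (card E) / (N * (r * (a - c)))) \<le> l (adj_matrix v)"
    by (simp add: B_def D_def)
qed

end

(*#PART F*)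


lemma complete_edges_eq: "complete_edges = {e. card e = 2}"
  unfolding complete_edges_def by (auto simp: card_2_iff)

lemma two_sided_complete:
  assumes "3 \<le> CARD('v::finite)"
  shows "two_sided_graph (complete_edges :: 'v set set) (\<lambda>_. True)"
proof
  show "swap x x' ` e \<in> complete_edges" if "e \<in> complete_edges" for x x' :: 'v and e
    using that unfolding complete_edges_eq by (simp add: card_image inj_on_subset[OF inj_transpose])
qed (use assms in \<open>simp_all add: complete_edges_eq\<close>)

lemma two_sided_bipartite:
  fixes A B :: "'v::finite set"
  assumes AB: "A \<inter> B = {}" "A \<union> B = UNIV" and three: "3 \<le> CARD('v)"
  shows "two_sided_graph (complete_bipartite_edges A B) (\<lambda>x. x \<in> A)"
proof
  note edge = bipartite_edge_iff[OF AB]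
  have ex: "\<exists>x y. e = {x, y} \<and> x \<in> A \<and> y \<in> B" if "e \<in> complete_bipartite_edges A B" for e
    using that unfolding complete_bipartite_edges_def by blast
  show "card e = 2" if e: "e \<in> complete_bipartite_edges A B" for e
  proof -
    obtain x y where "e = {x, y}" "x \<in> A" "y \<in> B" using ex[OF e] by blast
    then show ?thesis using AB(1) by (cases "x = y") auto
  qed
  show "swap x x' ` e \<in> complete_bipartite_edges A B"
    if x: "(x \<in> A) = (x' \<in> A)" and e: "e \<in> complete_bipartite_edges A B" for x x' e
  proof -
    obtain y z where yz: "e = {y, z}" using ex[OF e] by blast
    have "(swap x x' v \<in> A) = (v \<in> A)" for v using x by (simp add: Transposition.transpose_def)
    then show ?thesis using e unfolding yz by (simp add: edge)
  qed
  show "(x \<in> A) = (x' \<in> A) \<and> (y \<in> A) = (y' \<in> A) \<or> (x \<in> A) = (y' \<in> A) \<and> (y \<in> A) = (x' \<in> A)"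
    if "{x, y} \<in> complete_bipartite_edges A B" "{x', y'} \<in> complete_bipartite_edges A B" for x y x' y'
    using that unfolding edge by blast
qed (rule three)

lemma card_complete_edges: "card (complete_edges :: 'v::finite set set) = CARD('v) choose 2"
  unfolding complete_edges_eq using n_subsets[of "UNIV :: 'v set" 2] by simp

lemma complete_degree: "card {e \<in> complete_edges. z \<in> e} = CARD('v) - 1" for z :: "'v::finite"
proof -
  have "{e \<in> complete_edges. z \<in> e} = (\<lambda>y. {z, y}) ` (UNIV - {z})"
  proof (intro equalityI subsetI)
    fix e assume e: "e \<in> {e \<in> complete_edges. z \<in> e}"
    then obtain x y where xy: "e = {x, y}" "x \<noteq> y" unfolding complete_edges_def by blast
    have "e = {z, x} \<and> x \<noteq> z \<or> e = {z, y} \<and> y \<noteq> z" using e xy by auto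
    then show "e \<in> (\<lambda>y. {z, y}) ` (UNIV - {z})" by blast
  qed (auto simp: complete_edge_iff)
  moreover have "inj_on (\<lambda>y. {z, y}) (UNIV - {z})" by (rule inj_onI) (auto simp: doubleton_eq_iff)
  ultimately show ?thesis by (simp add: card_image)
qed

lemma card_bipartite_edges:
  fixes A B :: "'v::finite set"
  assumes "A \<inter> B = {}"
  shows "card (complete_bipartite_edges A B) = card A * card B"
proof -
  have "complete_bipartite_edges A B = (\<lambda>(a, b). {a, b}) ` (A \<times> B)"
    unfolding complete_bipartite_edges_def by auto
  moreover have "inj_on (\<lambda>(a, b). {a, b}) (A \<times> B)"
    using assms by (auto simp: inj_on_def doubleton_eq_iff)
  ultimately show ?thesis by (simp add: card_image)
qed

context two_sided_graph
begin

lemma ham_cycles_nonempty: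
  assumes \<kappa>: "0 < \<kappa>" "0 < h 1" and ne: "E \<noteq> {}"
    and count: "\<And>S. is_matching S \<Longrightarrow> S \<subseteq> E \<Longrightarrow> S \<noteq> {} \<Longrightarrow>
      real (card {u \<in> ham_cycles E. S \<subseteq> u}) = \<kappa> * h (card S)"
  shows "ham_cycles E \<noteq> {}"
proof
  assume none: "ham_cycles E = {}"
  obtain e where e: "e \<in> E" using ne by blast
  then have "is_matching {e}" using card_edge by (simp add: is_matching_def)
  then have "real (card {u \<in> ham_cycles E. {e} \<subseteq> u}) = \<kappa> * h 1" using count[of "{e}"] e by simp
  then show False using none \<kappa> by simp
qed

lemma scaling_constant_single_cycle:
  assumes size: "card E = CARD('v)" and nonempty: "ham_cycles E \<noteq> {}"
  shows "scaling_constant E F \<le> ereal 1"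
proof -
  have "u = E" if "u \<in> ham_cycles E" for u
    by (rule card_subset_eq) (use ham_cycle_subset[OF that] ham_cycle_card(1)[OF that] size in auto)
  then have H: "ham_cycles E = {E}" using nonempty by blast
  have b: "ts_barycenter E = adj_matrix E" unfolding ts_barycenter_sum H by simp
  have "scaling_constant E F \<le> ereal (1 + 0)"
  proof (rule scaling_constant_le[OF nonempty ts_g_ham_cycle])
    fix l u assume l: "l \<in> ts_B_dual_approx E F" and u: "u \<in> ham_cycles E"
    have "l (ts_barycenter E) = 1" using l by (simp add: ts_B_dual_approx_def ts_Lambda_dual_def)
    then show "- 0 \<le> l (adj_matrix u)" using u unfolding H b by simp
  qed simp_all
  then show ?thesis by simp
qed

end

lemma complete_scaling:
  assumes n: "CARD('v::finite) = n" "4 \<le> n" and k: "1 \<le> k" "k \<le> n div 2"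
  shows "scaling_constant (complete_edges :: 'v set set) (ts_F complete_edges k) \<le> ereal (complete_bound n k)"
proof -
  let ?E = "complete_edges :: 'v set set"
  have three: "3 \<le> CARD('v)" using n by simp
  interpret two_sided_graph ?E "\<lambda>_. True" by (rule two_sided_complete[OF three])
  define h :: "nat \<Rightarrow> real" where "h s = 2 ^ s * fact (n - s - 1)" for s
  obtain \<kappa> where \<kappa>: "0 < \<kappa>" "\<And>S. is_matching S \<Longrightarrow> S \<subseteq> ?E \<Longrightarrow> S \<noteq> {} \<Longrightarrow>
      real (card {u \<in> ham_cycles ?E. S \<subseteq> u}) = \<kappa> * h (card S)"
    using complete_count[OF three] unfolding h_def n(1) by blast
  define r where "r = real (n div 2)"
  define d where "d = real (n mod 2)"
  have "2 \<le> n div 2" using n(2) by linarith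
  then have r: "2 \<le> r" by (simp add: r_def)
  have nr: "real n = 2 * r + d"
  proof -
    have "n = 2 * (n div 2) + n mod 2" by simp
    then show ?thesis unfolding r_def d_def by (metis of_nat_add of_nat_mult of_nat_numeral)
  qed
  have d01: "d = 0 \<and> even n \<or> d = 1 \<and> odd n" by (cases "even n") (auto simp: d_def odd_iff_mod_2_eq_one)
  have cE: "real (card ?E) = real n * (real n - 1) / 2"
    unfolding card_complete_edges n(1) by (rule small_binomials(2))
  have size: "real (card ?E) - r - 2 * r * d = 2 * r * (r - 1)"
    using d01 unfolding cE nr by (auto simp: field_simps)
  have size0: "0 < 2 * r * (r - 1)" using r by simp
  have "0 < real (card ?E)" unfolding cE using n(2) by simp
  then have "?E \<noteq> {}" by auto
  then have ne: "ham_cycles ?E \<noteq> {}" using ham_cycles_nonempty[OF \<kappa>(1) _ _ \<kappa>(2)] by (simp add: h_def)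
  define w where "w i = (if k \<le> i then real (i choose k) * real (k choose (i - k)) else 0)" for i
  have m: "real (n div 2 choose i) * h i = complete_moment n i" for i
    by (simp add: complete_moment_def h_def)
  define Z where "Z = (\<Sum>i = 1..2 * k. w i * complete_moment n i)"
  define Y where "Y = (\<Sum>i = 1..2 * k. w i * size_biased (complete_moment n) i)"
  have Zs: "Z = (\<Sum>i = k..2 * k. (real (i choose k) * real (k choose (i - k))) * complete_moment n i)"
    and Ys: "Y = (\<Sum>i = k..2 * k. (real (i choose k) * real (k choose (i - k))) * size_biased (complete_moment n) i)"
    unfolding Z_def Y_def w_def by (rule square_weights(2)[OF k(1)])+
  have qZ: "complete_mean n k * Z \<le> Y"
    unfolding Zs Ys by (rule complete_mean_le_weighted[OF n(2)]) simp
  have positive: "0 < (\<Sum>i = k..2 * k. v i * complete_moment n i)" if v: "\<And>i. 0 \<le> v i" "v k = 1" for v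
  proof -
    have "0 < v k * complete_moment n k" using v complete_moment_pos[OF k(2)] by simp
    also have "\<dots> \<le> (\<Sum>i = k..2 * k. v i * complete_moment n i)"
      by (rule member_le_sum) (use v complete_moment_nonneg in auto)
    finally show ?thesis .
  qed
  have Z0: "0 < Z" unfolding Zs by (rule positive) auto
  define a where "a = Y / r"
  define b where "b = Z / r"
  define c where "c = (real n * Z - Y - 2 * d * Z) / (2 * r * (r - 1))"
  have even_gap: "0 < (real n - 1) * Y - real n * Z" if "even n"
  proof -
    have "0 < ((real n - 1) * complete_mean n k - real n) * Z"
      using complete_mean_pos(1)[OF n(2) k that] Z0 by simp
    also have "\<dots> = (real n - 1) * (complete_mean n k * Z) - real n * Z" by (simp add: algebra_simps)
    also have "\<dots> \<le> (real n - 1) * Y - real n * Z" using qZ n by (intro diff_right_mono mult_left_mono) auto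
    finally show ?thesis .
  qed
  have odd_gap: "0 < Y - Z" if "odd n"
  proof -
    have "0 < (complete_mean n k - 1) * Z" using complete_mean_pos(2)[OF n(2) k that] Z0 by simp
    also have "\<dots> \<le> Y - Z" using qZ by (simp add: algebra_simps)
    finally show ?thesis .
  qed
  have ac: "a - c = (if even n then ((real n - 1) * Y - real n * Z) else (real n - 2) * (Y - Z)) / (2 * r * (r - 1))"
  proof -
    have "a = 2 * (r - 1) * Y / (2 * r * (r - 1))" using r by (simp add: a_def field_simps)
    then have "a - c = (2 * (r - 1) * Y - (real n * Z - Y - 2 * d * Z)) / (2 * r * (r - 1))"
      by (simp add: c_def diff_divide_distrib)
    also have "2 * (r - 1) * Y - (real n * Z - Y - 2 * d * Z)
        = (if even n then ((real n - 1) * Y - real n * Z) else (real n - 2) * (Y - Z))"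
      using d01 unfolding nr by (auto simp: algebra_simps)
    finally show ?thesis .
  qed
  have gap: "c < a"
  proof -
    have "0 < a - c" unfolding ac using even_gap odd_gap size0 n(2) by (auto intro!: divide_pos_pos mult_pos_pos)
    then show ?thesis by simp
  qed
  have sq: "(real (j choose k) + 0 * real (j choose (k - 1)))\<^sup>2 = (\<Sum>i = 1..2 * k. w i * real (j choose i))" for j
    using square_weights(1)[OF k(1), of j] by (simp add: w_def)
  have deg: "card {e \<in> ?E. z \<in> e} = 2 * (CARD('v) div 2)" if "odd CARD('v)" for z
    using that complete_degree[of z] by simp
  have "scaling_constant ?E (ts_F ?E k)
      \<le> ereal (1 + (2 * d * b + (real n - 2 * d) * c) * real (card ?E) / (real n * (r * (a - c))))"
    using graph_scaling[where w = w and h = h and q = 0, OF k(1) sq \<kappa> ne deg, unfolded n(1), unfolded m,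
        folded r_def d_def Z_def Y_def, unfolded size, folded a_def b_def c_def] size0 gap
    by blast
  also have "1 + (2 * d * b + (real n - 2 * d) * c) * real (card ?E) / (real n * (r * (a - c))) = complete_ratio n Z Y"
  proof (cases "even n")
    case True
    then have d: "d = 0" using d01 by auto
    define Q where "Q = 2 * r * (r - 1)"
    define D where "D = (real n - 1) * Y - real n * Z"
    have D: "D > 0" using even_gap[OF True] by (simp add: D_def)
    have Q: "Q > 0" using size0 by (simp add: Q_def)
    have "(2 * d * b + (real n - 2 * d) * c) * real (card ?E) / (real n * (r * (a - c)))
        = (real n - 1) * c / (a - c)"
    proof -
      have "(2 * d * b + (real n - 2 * d) * c) * real (card ?E) = (real n * r) * ((real n - 1) * c)"
        using d nr unfolding cE by (simp add: field_simps)
      moreover have "real n * r \<noteq> 0" using n(2) r by simp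
      ultimately show ?thesis by (simp only: mult.assoc[symmetric, of "real n" r] mult_divide_mult_cancel_left simp_thms)
    qed
    also have "\<dots> = (real n - 1) * ((real n * Z - Y) / Q) / (D / Q)"
    proof -
      have "c = (real n * Z - Y) / Q" by (simp add: c_def d Q_def)
      moreover have "a - c = D / Q" unfolding ac D_def Q_def using True by simp
      ultimately show ?thesis by (simp only:)
    qed
    also have "\<dots> = (real n - 1) * (real n * Z - Y) / D" using Q by simp
    also have "1 + \<dots> = (D + (real n - 1) * (real n * Z - Y)) / D" using D by (simp add: field_simps)
    also have "D + (real n - 1) * (real n * Z - Y) = real n * (real n - 2) * Z" by (simp add: D_def algebra_simps)
    finally show ?thesis using True by (simp add: complete_ratio_def D_def)
  next
    case False
    then have d: "d = 1" using d01 by auto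
    define Q where "Q = 2 * r * (r - 1)"
    define D where "D = (real n - 2) * (Y - Z)"
    have D: "D > 0" using odd_gap[OF False] n by (simp add: D_def)
    have Q: "Q > 0" using size0 by (simp add: Q_def)
    have "(2 * d * b + (real n - 2 * d) * c) * real (card ?E) / (real n * (r * (a - c)))
        = (2 * b + (real n - 2) * c) / (a - c)"
    proof -
      have "real n - 1 = 2 * r" using d nr by simp
      then have "(2 * d * b + (real n - 2 * d) * c) * real (card ?E) = (real n * r) * (2 * b + (real n - 2) * c)"
        using d unfolding cE by simp
      moreover have "real n * r \<noteq> 0" using n(2) r by simp
      ultimately show ?thesis by (simp only: mult.assoc[symmetric, of "real n" r] mult_divide_mult_cancel_left simp_thms)
    qed
    also have "\<dots> = (4 * (r - 1) * Z + (real n - 2) * ((real n - 2) * Z - Y)) / Q / (D / Q)"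
    proof -
      have "2 * b = 4 * (r - 1) * Z / Q" using r by (simp add: b_def Q_def field_simps)
      moreover have "c = ((real n - 2) * Z - Y) / Q" by (simp add: c_def d Q_def algebra_simps)
      ultimately have "2 * b + (real n - 2) * c = (4 * (r - 1) * Z + (real n - 2) * ((real n - 2) * Z - Y)) / Q"
        by (simp only: add_divide_distrib times_divide_eq_right)
      moreover have "a - c = D / Q" unfolding ac D_def Q_def using False by simp
      ultimately show ?thesis by (simp only:)
    qed
    also have "\<dots> = (4 * (r - 1) * Z + (real n - 2) * ((real n - 2) * Z - Y)) / D"
      using Q by simp
    also have "1 + \<dots> = (D + (4 * (r - 1) * Z + (real n - 2) * ((real n - 2) * Z - Y))) / D"
      using D by (simp add: field_simps)
    also have "D + (4 * (r - 1) * Z + (real n - 2) * ((real n - 2) * Z - Y)) = real n * (real n - 3) * Z"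
      unfolding D_def nr d by (simp add: algebra_simps)
    finally show ?thesis using False by (simp add: complete_ratio_def D_def)
  qed
  also have "ereal (complete_ratio n Z Y) \<le> ereal (complete_bound n k)"
    unfolding complete_bound_eq_ratio[OF n(2) k] ereal_less_eq
  proof (rule complete_ratio_antimono[OF n(2) k])
    show "complete_mean n k * (\<Sum>i = k..2 * k. real (i choose k) * complete_moment n i)
        \<le> (\<Sum>i = k..2 * k. real (i choose k) * size_biased (complete_moment n) i)"
      by (rule complete_mean_le_weighted[OF n(2)]) simp
    show "Z * (\<Sum>i = k..2 * k. real (i choose k) * size_biased (complete_moment n) i)
        \<le> (\<Sum>i = k..2 * k. real (i choose k) * complete_moment n i) * Y"
      unfolding Zs Ys by (rule complete_reweighting[OF n(2) k(1)])
    show "0 < (\<Sum>i = k..2 * k. real (i choose k) * complete_moment n i)" by (rule positive) auto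
  qed (rule Z0)
  finally show ?thesis .
qed

lemma complete_bound_le:
  assumes n: "4 \<le> n" and k: "1 \<le> k" "k \<le> n div 2"
  shows "complete_bound n k \<le> real n / real k + 10 / real n"
proof -
  have "0 < complete_moment n k" by (rule complete_moment_pos[OF k(2)])
  also have "\<dots> = real (k choose k) * complete_moment n k" by simp
  also have "\<dots> \<le> (\<Sum>i = k..2 * k. real (i choose k) * complete_moment n i)"
    by (rule member_le_sum) (auto simp: complete_moment_nonneg)
  finally have pos: "0 < (\<Sum>i = k..2 * k. real (i choose k) * complete_moment n i)" .
  have le: "complete_mean n k * (\<Sum>i = k..2 * k. real (i choose k) * complete_moment n i)
      \<le> (\<Sum>i = k..2 * k. real (i choose k) * size_biased (complete_moment n) i)"
    by (rule complete_mean_le_weighted[OF n]) simp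
  have "complete_bound n k \<le> complete_ratio n 1 (complete_mean n k)"
    unfolding complete_bound_eq_ratio[OF n k]
    by (rule complete_ratio_antimono[OF n k]) (use pos le in \<open>auto simp: mult.commute\<close>)
  also have "\<dots> \<le> real n / real k + 10 / real n" by (rule complete_mean_bound[OF n k])
  finally show ?thesis .
qed

lemma complete_bound_3: "complete_bound 3 1 = 1"
proof -
  have "tsp_beta 3 1 = 0" by (simp add: tsp_beta_def Let_def)
  then show ?thesis by (simp add: complete_bound_def)
qed

lemma complete_scaling_3:
  assumes "CARD('v::finite) = 3"
  shows "scaling_constant (complete_edges :: 'v set set) F \<le> ereal 1"
proof -
  have three: "3 \<le> CARD('v)" using assms by simp
  interpret two_sided_graph "complete_edges :: 'v set set" "\<lambda>_. True" by (rule two_sided_complete[OF three])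
  have cE: "card (complete_edges :: 'v set set) = 3"
    unfolding card_complete_edges assms by (simp add: numeral_eq_Suc)
  obtain \<kappa> :: real where \<kappa>: "0 < \<kappa>" "\<And>S. is_matching S \<Longrightarrow> S \<subseteq> (complete_edges :: 'v set set) \<Longrightarrow> S \<noteq> {} \<Longrightarrow>
      real (card {u \<in> ham_cycles complete_edges. S \<subseteq> u}) = \<kappa> * (2 ^ card S * fact (CARD('v) - card S - 1))"
    using complete_count[OF three] by blast
  have "(complete_edges :: 'v set set) \<noteq> {}" using cE by auto
  then have "ham_cycles (complete_edges :: 'v set set) \<noteq> {}"
    using ham_cycles_nonempty[where h = "\<lambda>s. 2 ^ s * fact (CARD('v) - s - 1)", OF \<kappa>(1) _ _ \<kappa>(2)] by simp
  then show ?thesis using scaling_constant_single_cycle cE assms by simp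
qed


lemma bipartite_scaling:
  fixes A B :: "'v::finite set"
  assumes AB: "A \<inter> B = {}" "A \<union> B = UNIV" and card: "card A = n" "card B = n"
    and n: "3 \<le> n" and k: "1 \<le> k" "k \<le> n"
  shows "scaling_constant (complete_bipartite_edges A B) (ts_F (complete_bipartite_edges A B) k)
    \<le> ereal (bipartite_bound n k)"
proof -
  let ?E = "complete_bipartite_edges A B"
  have N: "CARD('v) = 2 * n"
    using card_Un_disjoint[of A B] AB card by simp
  have three: "3 \<le> CARD('v)" using N n by simp
  interpret two_sided_graph ?E "\<lambda>x. x \<in> A" by (rule two_sided_bipartite[OF AB three])
  define h :: "nat \<Rightarrow> real" where "h s = fact (2 * n - s - 1) * (fact (n - s))\<^sup>2 / fact (2 * n - 2 * s)" for s
  obtain \<kappa> where \<kappa>: "0 < \<kappa>" "\<And>S. is_matching S \<Longrightarrow> S \<subseteq> ?E \<Longrightarrow> S \<noteq> {} \<Longrightarrow>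
      real (card {u \<in> ham_cycles ?E. S \<subseteq> u}) = \<kappa> * h (card S)"
    using bipartite_count[OF AB card] n unfolding h_def by fastforce
  have cE: "real (card ?E) = real n * real n"
    using card_bipartite_edges[OF AB(1)] card by simp
  have "0 < real (card ?E)" unfolding cE using n by simp
  then have "?E \<noteq> {}" by auto
  then have ne: "ham_cycles ?E \<noteq> {}" using ham_cycles_nonempty[OF \<kappa>(1) _ _ \<kappa>(2)] by (simp add: h_def)
  obtain c w where sq: "\<And>j. (real (j choose k) + c * real (j choose (k - 1)))\<^sup>2 = (\<Sum>i = 1..2 * k. w i * real (j choose i))"
    and Z0: "0 < (\<Sum>i = 1..2 * k. w i * bipartite_moment n i)"
    and reweighted: "(\<Sum>i = 1..2 * k. w i * bipartite_moment n i) * (\<Sum>i = k..2 * k. real (i choose k) * size_biased (bipartite_moment n) i)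
      \<le> (\<Sum>i = k..2 * k. real (i choose k) * bipartite_moment n i) * (\<Sum>i = 1..2 * k. w i * size_biased (bipartite_moment n) i)"
    using bipartite_test_weights[OF n k] by blast
  have m: "real (n choose i) * h i = bipartite_moment n i" for i
    by (simp add: bipartite_moment_def h_def)
  define Z where "Z = (\<Sum>i = 1..2 * k. w i * bipartite_moment n i)"
  define Y where "Y = (\<Sum>i = 1..2 * k. w i * size_biased (bipartite_moment n) i)"
  define Z' where "Z' = (\<Sum>i = k..2 * k. real (i choose k) * bipartite_moment n i)"
  define Y' where "Y' = (\<Sum>i = k..2 * k. real (i choose k) * size_biased (bipartite_moment n) i)"
  have Z0: "0 < Z" using Z0 by (simp add: Z_def)
  have Z'0: "0 < Z'" unfolding Z'_def by (rule bipartite_bound_eq_ratio(2)[OF n k])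
  have qZ': "bipartite_mean n k * Z' \<le> Y'"
    unfolding Z'_def Y'_def by (rule bipartite_mean_le_weighted) (use n in auto)
  have "Z * Y' \<le> Z' * Y" using reweighted by (simp add: Z_def Y_def Z'_def Y'_def)
  note ratio = bipartite_ratio_antimono[OF n k Z'0 Z0 qZ' this]
  define a where "a = Y / real n"
  define b where "b = (2 * real n * Z - Y) / (real n * (real n - 1))"
  have n1: "0 < real n - 1" "0 < real n" using n by auto
  have Y: "Y = real n * a" using n1 by (simp add: a_def)
  have ab: "a - b = (Y - 2 * Z) / (real n - 1)"
  proof -
    have "a = (real n - 1) * Y / (real n * (real n - 1))" using n1 by (simp add: a_def)
    then have "a - b = real n * (Y - 2 * Z) / (real n * (real n - 1))"
      by (simp add: b_def diff_divide_distrib[symmetric] algebra_simps)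
    then show ?thesis using n1 by simp
  qed
  have gap: "b < a"
  proof -
    have "0 < a - b" unfolding ab using ratio(3) n1 by simp
    then show ?thesis by simp
  qed
  have half: "2 * n div 2 = n" "2 * n mod 2 = 0" by auto
  have "scaling_constant ?E (ts_F ?E k)
      \<le> ereal (1 + (2 * real n * b) * (real n * real n) / (2 * real n * (real n * (a - b))))"
    using graph_scaling[where w = w and h = h and q = c, OF k(1) sq \<kappa> ne, unfolded N half m,
        folded Z_def Y_def] n1 gap 
    unfolding cE a_def b_def by (simp add: right_diff_distrib)
  also have "1 + (2 * real n * b) * (real n * real n) / (2 * real n * (real n * (a - b))) = bipartite_ratio n Z Y"
  proof -
    have "(2 * real n * b) * (real n * real n) / (2 * real n * (real n * (a - b))) = real n * b / (a - b)"
      using n1 by simp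
    also have "\<dots> = ((2 * real n * Z - Y) / (real n - 1)) / ((Y - 2 * Z) / (real n - 1))"
      unfolding ab using n1 by (simp add: b_def)
    also have "\<dots> = (2 * real n * Z - Y) / (Y - 2 * Z)" using n1 by simp
    also have "1 + \<dots> = bipartite_ratio n Z Y"
      using ratio(3) by (simp add: bipartite_ratio_def field_simps)
    finally show ?thesis .
  qed
  also have "ereal (bipartite_ratio n Z Y) \<le> ereal (bipartite_bound n k)"
    unfolding bipartite_bound_eq_ratio(1)[OF n k] ereal_less_eq
    using ratio(1) unfolding Z'_def Y'_def .
  finally show ?thesis .
qed

lemma bipartite_bound_le:
  assumes n: "3 \<le> n" and k: "1 \<le> k" "k \<le> n" "k + 3 < 2 * n"
  shows "bipartite_bound n k
    \<le> 2 * real n / real k + 2 * (real k + 1) / (real k * (2 * real n - real k - 3))"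
proof -
  have le: "bipartite_mean n k * (\<Sum>i = k..2 * k. real (i choose k) * bipartite_moment n i)
      \<le> (\<Sum>i = k..2 * k. real (i choose k) * size_biased (bipartite_moment n) i)"
    by (rule bipartite_mean_le_weighted) (use n in auto)
  have "bipartite_bound n k \<le> bipartite_ratio n 1 (bipartite_mean n k)"
    unfolding bipartite_bound_eq_ratio(1)[OF n k(1,2)]
    by (rule bipartite_ratio_antimono(1)[OF n k(1,2)])
      (use bipartite_bound_eq_ratio(2)[OF n k(1,2)] le in \<open>auto simp: mult.commute\<close>)
  also have "\<dots> \<le> 2 * real n / real k + 2 * (real k + 1) / (real k * (2 * real n - real k - 3))"
    by (rule bipartite_mean_bound[OF n k])
  finally show ?thesis .
qed

lemma bipartite_bound_2:
  assumes "1 \<le> k" "k \<le> 2"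
  shows "bipartite_bound 2 k = 1"
proof -
  have "tsp_gamma 2 i - tsp_eta 2 i = 0" if "1 \<le> i" "i \<le> 2" for i
  proof -
    have "i = 1 \<or> i = 2" using that by auto
    then have "bipartite_mean 2 i = 2" by (auto simp: bipartite_mean_def)
    then show ?thesis unfolding tsp_bipartite(2)[OF order_refl that] by simp
  qed
  then have "(\<Sum>i = k..min 2 (2 * k). real (i choose k) * (tsp_gamma 2 i - tsp_eta 2 i)) = 0"
    using assms by (intro sum.neutral) auto
  then show ?thesis unfolding bipartite_bound_def by (simp only: div_by_0 mult_zero_right add_0_right)
qed

lemma bipartite_scaling_2:
  fixes A B :: "'v::finite set"
  assumes AB: "A \<inter> B = {}" "A \<union> B = UNIV" and card: "card A = 2" "card B = 2"
  shows "scaling_constant (complete_bipartite_edges A B) F \<le> ereal 1"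
proof -
  let ?E = "complete_bipartite_edges A B"
  have N: "CARD('v) = 4" using card_Un_disjoint[of A B] AB card by simp
  have three: "3 \<le> CARD('v)" using N by simp
  interpret two_sided_graph ?E "\<lambda>x. x \<in> A" by (rule two_sided_bipartite[OF AB three])
  have cE: "card ?E = 4" using card_bipartite_edges[OF AB(1)] card by simp
  define h :: "nat \<Rightarrow> real" where "h s = fact (2 * 2 - s - 1) * (fact (2 - s))\<^sup>2 / fact (2 * 2 - 2 * s)" for s
  obtain \<kappa> where \<kappa>: "0 < \<kappa>" "\<And>S. is_matching S \<Longrightarrow> S \<subseteq> ?E \<Longrightarrow> S \<noteq> {} \<Longrightarrow>
      real (card {u \<in> ham_cycles ?E. S \<subseteq> u}) = \<kappa> * h (card S)"
    using bipartite_count[OF AB card] unfolding h_def by fastforce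
  have "?E \<noteq> {}" using cE by auto
  then have "ham_cycles ?E \<noteq> {}" using ham_cycles_nonempty[OF \<kappa>(1) _ _ \<kappa>(2)] by (simp add: h_def)
  then show ?thesis using scaling_constant_single_cycle cE N by simp
qed

theorem theorem1p5:
  shows
    "(\<forall>n k. CARD('v::finite) = n \<and> 3 \<le> n \<and> 1 \<le> k \<and> k \<le> n div 2 \<longrightarrow>
        scaling_constant (complete_edges :: 'v set set) (ts_F complete_edges k)
          \<le> ereal (complete_bound n k) \<and>
        complete_bound n k \<le> real n / real k + 10 / real n)
     \<and>
     (\<forall>n k. \<forall>A B :: ('w::finite) set.
        A \<inter> B = {} \<and> A \<union> B = UNIV \<and> card A = n \<and> card B = n \<and> 2 \<le> n \<and> 1 \<le> k \<and> k \<le> n \<longrightarrow>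
        scaling_constant (complete_bipartite_edges A B) (ts_F (complete_bipartite_edges A B) k)
          \<le> ereal (bipartite_bound n k) \<and>
        (k + 3 < 2 * n \<longrightarrow>
         bipartite_bound n k
           \<le> 2 * real n / real k + 2 * (real k + 1) / (real k * (2 * real n - real k - 3))))"
proof (intro conjI allI impI; elim conjE)
  fix n k
  assume n: "CARD('v) = n" "3 \<le> n" and k: "1 \<le> k" "k \<le> n div 2"
  show "scaling_constant (complete_edges :: 'v set set) (ts_F complete_edges k) \<le> ereal (complete_bound n k)"
  proof (cases "n = 3")
    case True
    then have "k = 1" using k by simp
    then show ?thesis using complete_scaling_3 complete_bound_3 n True by simp
  next
    case False
    then show ?thesis using complete_scaling[OF n(1) _ k] n(2) by simp
  qed
  show "complete_bound n k \<le> real n / real k + 10 / real n"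
  proof (cases "n = 3")
    case True
    then have "k = 1" using k by simp
    then show ?thesis using True complete_bound_3 by simp
  next
    case False
    then show ?thesis using complete_bound_le[OF _ k] n(2) by simp
  qed
next
  fix n k and A B :: "'w set"
  assume AB: "A \<inter> B = {}" "A \<union> B = UNIV" "card A = n" "card B = n" and n: "2 \<le> n" and k: "1 \<le> k" "k \<le> n"
  show "scaling_constant (complete_bipartite_edges A B) (ts_F (complete_bipartite_edges A B) k)
      \<le> ereal (bipartite_bound n k)"
  proof (cases "n = 2")
    case True
    then show ?thesis using bipartite_scaling_2[OF AB(1,2)] bipartite_bound_2 AB k by simp
  next
    case False
    then show ?thesis using bipartite_scaling[OF AB _ k] n by simp
  qed
  assume "k + 3 < 2 * n"
  then show "bipartite_bound n k
      \<le> 2 * real n / real k + 2 * (real k + 1) / (real k * (2 * real n - real k - 3))"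
    using bipartite_bound_le[OF _ k] n k by (cases "n = 2") auto
qed

end
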